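(* Let $R_0\in(0,+\infty]$ and let $\ell$, $K$, $L$ and $A$ be as described in the context. There exist constants $c>0$ and $\beta\in(0,1)$ such that for all $r$ with $0<r\le\frac{R_0}{2}$, all $f\in L^\infty(B_r)$, and all $u\in C_b^2(\mathbb{R}^d)$ satisfying $Au=f$ in $B_r$, the following holds: $$\sup_{x,y\in B_{r/4}}\frac{|u(x)-u(y)|}{L(|x-y|)^{-\beta}}\le c\,L(r)^{\beta}\|u\|_\infty+c\,L(r)^{\beta-1}\|f\|_{L^\infty(B_r)}.$$ If $R_0=+\infty$, then the estimate holds true for every $r>0$.
   Context: $B_s$ denotes the open ball in $\mathbb{R}^d$ of radius $s$ centered at $0$. $C_b^2(\mathbb{R}^d)$ is the set of functions $\mathbb{R}^d\to\mathbb{R}$ which, together with their first and second derivatives, are continuous and bounded. The supremum is understood over $x\neq y$. The constants $c,\beta$ do not depend on $r,f,u$. Fixed constants: $R_0\in(0,+\infty]$, $\kappa\ge1$, $K_0\ge 1$, $c_L\in(0,1)$, $c_U\ge1$, $\gamma\in(0,2)$. The function $\ell:(0,R_0)\to(0,\infty)$ satisfies $\int_0^{R_0}\ell(s)\frac{ds}{s}=+\infty$ and - $\int_r^{R_0}\ell(s)\frac{ds}{s}<+\infty$ for $0<r<R_0$; - $\frac{\ell(r\lambda)}{\ell(r)}\ge c_L\lambda^{-\gamma}$ for $r>0$ and $1\le\lambda<\frac{R_0}{r}$; - $\frac{\ell(r\lambda)}{\ell(r)}\le c_U\lambda^{d}$ for $r>0$ and $1\le\lambda<\frac{R_0}{r}$.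 The kernel $K:\mathbb{R}^d\times(\mathbb{R}^d\setminus\{0\})\to[0,+\infty)$ is measurable, $K(x,h)=K(x,-h)$ for all $x,h$, and - $\kappa^{-1}|h|^{-d}\ell(|h|)\le K(x,h)\le\kappa|h|^{-d}\ell(|h|)$ for all $x\in\mathbb{R}^d$ and $0<|h|<R_0$; - $\sup_{x\in\mathbb{R}^d}\int_{\mathbb{R}^d\setminus\{0\}}(1\wedge|h|^2)K(x,h)\,dh\le K_0$. The operator $A$ is defined for $u\in C_b^2(\mathbb{R}^d)$ by $$Au(x)=\int_{\mathbb{R}^d\setminus\{0\}}\big(u(x+h)-u(x)-\langle\nabla u(x),h\rangle\mathbf{1}_{B_1}(h)\big)K(x,h)\,dh.$$ $L:(0,R_0)\to(0,\infty)$ is defined by $L(r)=\int_r^{R_0}\frac{\ell(s)}{s}\,ds$. *)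

theory Defs
  imports "HOL-Analysis.Analysis" "HOL-Probability.Essential_Supremum"
begin

definition gradient :: "('a::euclidean_space \<Rightarrow> real) \<Rightarrow> 'a \<Rightarrow> 'a" where
  "gradient u x = (THE D. GDERIV u x :> D)"

(* The gradient G and the Hessian H (as a bounded linear map) are Frechet derivatives;
   bcontfun is the set of bounded continuous functions. *)
definition Cb2 :: "('a::euclidean_space \<Rightarrow> real) set" where
  "Cb2 = {u. u \<in> bcontfun \<and>
     (\<exists>(G :: 'a \<Rightarrow> 'a) (H :: 'a \<Rightarrow> 'a \<Rightarrow>\<^sub>L 'a).
        (\<forall>x. GDERIV u x :> G x) \<and>
        (\<forall>x. (G has_derivative blinfun_apply (H x)) (at x)) \<and>
        G \<in> bcontfun \<and> H \<in> bcontfun)}"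

definition nonlocal_op ::
  "('a::euclidean_space \<Rightarrow> 'a \<Rightarrow> real) \<Rightarrow> ('a \<Rightarrow> real) \<Rightarrow> 'a \<Rightarrow> real" where
  "nonlocal_op K u x =
     (LINT h:-{0}|lborel.
        (u (x + h) - u x - (gradient u x \<bullet> h) * indicator (ball 0 1) h) * K x h)"

definition tail_integral :: "ereal \<Rightarrow> (real \<Rightarrow> real) \<Rightarrow> real \<Rightarrow> real" where
  "tail_integral R0 l r = (LBINT s=ereal r..R0. l s / s)"

definition sup_norm :: "('a \<Rightarrow> real) \<Rightarrow> real" where
  "sup_norm u = (SUP x. \<bar>u x\<bar>)"

(* Elements of L-infinity are represented by functions; only their values on S matter,
   and only up to Lebesgue null sets. *)
definition Linfty :: "'a::euclidean_space set \<Rightarrow> ('a \<Rightarrow> real) set" where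
  "Linfty S = {f. f \<in> borel_measurable (lebesgue_on S) \<and>
                  esssup (lebesgue_on S) (\<lambda>x. ereal \<bar>f x\<bar>) < \<infinity>}"

definition Linfty_norm :: "'a::euclidean_space set \<Rightarrow> ('a \<Rightarrow> real) \<Rightarrow> real" where
  "Linfty_norm S f = real_of_ereal (esssup (lebesgue_on S) (\<lambda>x. ereal \<bar>f x\<bar>))"

end

theory Submission
  imports Defs
begin

text \<open>
  The proof doubles the variables. Among all \<open>x\<close>, \<open>y\<close> near two given points and all scales \<open>\<sigma> \<le> r\<close>, maximise
  \<open>u x - u y\<close> minus \<open>M * L \<sigma> powr - \<beta> * (1 + \<beta> * (norm (x - y) / \<sigma>)\<^sup>2)\<close> and minus quadratic localisation terms.
  For fixed \<open>\<sigma>\<close> the penalty is a quadratic polynomial, so that small jumps need no regularity of \<open>l\<close>, while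
  its minimum over \<open>\<sigma>\<close> is comparable to \<open>L (norm (x - y)) powr - \<beta>\<close>. At a positive maximum with distance
  \<open>\<delta>\<close>, both kernels dominate a multiple of the same radial density, of total mass of order \<open>L \<delta>\<close>; letting \<open>x\<close>
  and \<open>y\<close> jump to a common target with this part gains a fixed multiple of \<open>L \<delta>\<close> times the penalty. All other jumps
  cost at most \<open>\<beta>\<close> times that quantity, up to terms of order \<open>L r\<close> times the supremum of \<open>u\<close>. For small \<open>\<beta>\<close> and
  \<open>M\<close> of the order of the right-hand side of the claim this is a contradiction.
\<close>

section \<open>Integration and differentiation on Euclidean spaces\<close>

text \<open>The obstacle is that \<open>L powr (- \<beta>)\<close> may be as weak as a power of a
  logarithm, and that \<open>l\<close> is merely measurable with scaling bounds. This modulus need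
  be neither concave nor twice differentiable, so it cannot itself serve as a test function. Nor are
  \<open>K x\<close> and \<open>K y\<close> close for close points; only their common lower bound is
  available. The free scale \<open>\<sigma>\<close> removes the first difficulty: a jump shorter
  than \<open>\<delta>\<close> keeps \<open>\<sigma>\<close>, a longer jump \<open>h\<close>
  competes at the scale \<open>2 * norm h\<close>. The coefficient \<open>\<beta>\<close> of the
  quadratic term comes from concavity, \<open>t powr \<beta> \<le> 1 + \<beta> * (t - 1)\<close>: it
  pays for the loss in comparing \<open>L\<close> at two scales, and makes the growth of the penalty
  over long jumps of relative size \<open>\<beta>\<close>. That growth is measured by
  \<open>sqrt (L \<delta> / L s)\<close>, whose integral against the jump density is of order
  \<open>L \<delta>\<close> because the exponent \<open>1 / 2\<close> is below 1. So
  \<open>\<beta>\<close> need only beat a ratio of constants made of the scaling constants,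
  \<open>\<kappa>\<close> and the dimension.\<close>

lemma lborel_eq_distr_affine:
  fixes t :: "'a::euclidean_space"
  assumes "\<bar>c\<bar> = 1"
  shows "distr lborel borel (\<lambda>x. t + c *\<^sub>R x) = lborel"
  using lborel_affine[of c t] assms by (simp add: density_1)

lemma ball_in_sets_borel [measurable]: "ball x r \<in> sets borel"
  by (rule borel_open) simp

lemma integral_lborel_odd:
  fixes f :: "'a::euclidean_space \<Rightarrow> real"
  assumes [measurable]: "f \<in> borel_measurable borel" and odd: "\<And>x. f (- x) = - f x"
  shows "integral\<^sup>L lborel f = 0"
proof -
  have "integral\<^sup>L lborel f = integral\<^sup>L (distr lborel borel (\<lambda>x. 0 + (-1) *\<^sub>R x)) f"
    by (subst lborel_eq_distr_affine) auto
  also have "\<dots> = (LINT x|lborel. f (0 + (-1) *\<^sub>R x))"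
    by (rule integral_distr) auto
  also have "\<dots> = - integral\<^sup>L lborel f"
    using odd by simp
  finally show ?thesis by simp
qed

lemma integral_lborel_translation:
  fixes f :: "'a::euclidean_space \<Rightarrow> real"
  assumes [measurable]: "f \<in> borel_measurable borel"
  shows "(LINT x|lborel. f (x + t)) = integral\<^sup>L lborel f"
proof -
  have "integral\<^sup>L lborel f = integral\<^sup>L (distr lborel borel (\<lambda>x. t + 1 *\<^sub>R x)) f"
    by (subst lborel_eq_distr_affine) auto
  also have "\<dots> = (LINT x|lborel. f (t + 1 *\<^sub>R x))"
    by (rule integral_distr) auto
  finally show ?thesis by (simp add: add.commute)
qed

lemma integrable_lborel_translation:
  fixes f :: "'a::euclidean_space \<Rightarrow> real"
  assumes "integrable lborel f"
  shows "integrable lborel (\<lambda>x. f (x + t))"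
proof -
  have [measurable]: "f \<in> borel_measurable borel" using assms by auto
  have "integrable (distr lborel borel (\<lambda>x. t + 1 *\<^sub>R x)) f"
    using assms by (subst lborel_eq_distr_affine) auto
  then have "integrable lborel (\<lambda>x. f (t + 1 *\<^sub>R x))"
    by (subst (asm) integrable_distr_eq) auto
  then show ?thesis by (simp add: add.commute)
qed

section \<open>Radial integration\<close>

definition sphere_area :: "'a::euclidean_space itself \<Rightarrow> real" where
  "sphere_area _ = real DIM('a) * unit_ball_vol (real DIM('a))"

lemma sphere_area_pos: "sphere_area TYPE('a::euclidean_space) > 0"
  by (simp add: sphere_area_def)

text \<open>Polar coordinates for radial functions without a surface measure: it suffices to compare
  half lines \<open>{..a}\<close>. There the left side is the volume of a ball of radius
  \<open>a\<close>, and the right side, by the fundamental theorem of calculus, the integral of the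
  derivative of that volume.\<close>

lemma distr_norm_lborel:
  "distr lborel borel (norm :: 'a::euclidean_space \<Rightarrow> real) =
     density lborel (\<lambda>s. ennreal (sphere_area TYPE('a) * s ^ (DIM('a) - 1)) * indicator {0..} s)"
    (is "?M = ?N")
proof (rule measure_eqI_generator_eq[where \<Omega> = UNIV and E = "range atMost"
        and A = "\<lambda>i. {..real i}"])
  show "Int_stable (range atMost :: real set set)"
    by (auto simp: Int_stable_def)
  show "sets ?M = sigma_sets UNIV (range atMost)" "sets ?N = sigma_sets UNIV (range atMost)"
    by (simp_all add: borel_eq_atMost)
  show "(\<Union>i. {..real i}) = UNIV" 
    using real_arch_simple by auto
  have M: "emeasure ?M {..a} = ennreal (unit_ball_vol (real DIM('a)) * a ^ DIM('a))" if "a \<ge> 0" for a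
  proof -
    have "emeasure ?M {..a} = emeasure lborel (cball 0 a :: 'a set)"
      by (subst emeasure_distr) (auto intro!: arg_cong[where f = "emeasure lborel"])
    then show ?thesis using emeasure_cball[OF that, of "0::'a"] by simp
  qed
  show "emeasure ?M {..real i} \<noteq> \<infinity>" for i
    by (subst M) auto
  show "emeasure ?M X = emeasure ?N X" if Xr: "X \<in> range atMost" for X
  proof -
    obtain a where X: "X = {..a}" using Xr by blast
    show ?thesis
    proof (cases "a \<ge> 0")
      case False
      then have "norm -` {..a} = ({} :: 'a set)"
        using order_trans[OF norm_ge_zero] by blast
      moreover have "(\<lambda>s. ennreal (sphere_area TYPE('a) * s ^ (DIM('a) - 1)) * indicator {0..} s * indicator {..a} s) = (\<lambda>s. 0)"
        using False by (auto simp: fun_eq_iff split: split_indicator)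
      ultimately show ?thesis unfolding X
        by (simp add: emeasure_distr emeasure_density)
    next
      case True
      have "emeasure ?N {..a} = (\<integral>\<^sup>+s. ennreal (sphere_area TYPE('a) * s ^ (DIM('a) - 1)) * indicator {0..a} s \<partial>lborel)"
        by (subst emeasure_density) (auto intro!: nn_integral_cong split: split_indicator)
      also have "\<dots> = ennreal (unit_ball_vol (real DIM('a)) * a ^ DIM('a) - unit_ball_vol (real DIM('a)) * 0 ^ DIM('a))"
        using True
        by (intro nn_integral_FTC_Icc)
           (auto intro!: derivative_eq_intros simp: sphere_area_def mult_ac has_real_derivative_iff_has_vector_derivative[symmetric])
      finally show ?thesis unfolding X M[OF True] by (simp add: power_0_left)
    qed
  qed
qed auto

lemma nn_integral_norm:
  fixes g :: "real \<Rightarrow> ennreal"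
  assumes [measurable]: "g \<in> borel_measurable borel"
  shows "(\<integral>\<^sup>+h. g (norm (h::'a::euclidean_space)) \<partial>lborel) =
    (\<integral>\<^sup>+s. ennreal (sphere_area TYPE('a) * s ^ (DIM('a) - 1)) * indicator {0..} s * g s \<partial>lborel)"
proof -
  have "(\<integral>\<^sup>+h. g (norm (h::'a)) \<partial>lborel) = (\<integral>\<^sup>+s. g s \<partial>distr lborel borel (norm :: 'a \<Rightarrow> real))"
    by (subst nn_integral_distr) auto
  then show ?thesis
    unfolding distr_norm_lborel by (subst (asm) nn_integral_density) (auto simp: mult_ac)
qed

text \<open>Two uses of the mean value inequality, first for \<open>G\<close> on the segment, then
  for \<open>v\<close> minus its linear part. This loses the factor \<open>1 / 2\<close> of Taylor's
  formula but needs only a bound on \<open>H\<close>; applied to a difference of two translates of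
  \<open>u\<close> it also controls the dependence on the base point.\<close>

lemma second_order_bound:
  fixes v :: "'a::euclidean_space \<Rightarrow> real"
  assumes v: "\<And>x. GDERIV v x :> G x"
    and G: "\<And>x. (G has_derivative blinfun_apply (H x)) (at x)"
    and H: "\<And>x. x \<in> ball 0 r \<Longrightarrow> norm (H x) \<le> b"
    and h: "h \<in> ball 0 r"
  shows "\<bar>v h - v 0 - G 0 \<bullet> h\<bar> \<le> b * (norm h)\<^sup>2"
proof -
  have r: "r > 0" using h by (auto intro: le_less_trans[OF norm_ge_zero])
  have b: "b \<ge> 0" using H[of 0] r by (auto intro: order_trans[OF norm_ge_zero])
  have sub: "closed_segment 0 h \<subseteq> ball 0 r"
    using h r by (intro closed_segment_subset) auto
  have G_lip: "norm (G x - G 0) \<le> b * norm h" if x: "x \<in> closed_segment 0 h" for x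
  proof -
    have "norm (G x - G 0) \<le> b * norm (x - 0)"
    proof (rule differentiable_bound[where S = "ball 0 r" and f' = "\<lambda>x. blinfun_apply (H x)"])
      show "onorm (blinfun_apply (H y)) \<le> b" if "y \<in> ball 0 r" for y
        using H[OF that] by (simp add: norm_blinfun.rep_eq)
    qed (use G sub x r in \<open>auto intro: has_derivative_at_withinI\<close>)
    moreover have "norm x \<le> norm h"
      using x by (auto simp: in_segment mult_left_le_one_le)
    ultimately show ?thesis using b by (auto intro: order_trans mult_left_mono)
  qed
  have "norm ((v h - G 0 \<bullet> h) - (v 0 - G 0 \<bullet> 0)) \<le> (b * norm h) * norm (h - 0)"
  proof (rule differentiable_bound[where S = "closed_segment 0 h" and f' = "\<lambda>x k. k \<bullet> (G x - G 0)"])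
    show "((\<lambda>h. v h - G 0 \<bullet> h) has_derivative (\<lambda>k. k \<bullet> (G x - G 0))) (at x within closed_segment 0 h)" for x
    proof (rule has_derivative_at_withinI)
      show "((\<lambda>h. v h - G 0 \<bullet> h) has_derivative (\<lambda>k. k \<bullet> (G x - G 0))) (at x)"
        using v[of x] unfolding gderiv_def
        by (auto intro!: derivative_eq_intros simp: inner_diff_right inner_commute)
    qed
    show "onorm (\<lambda>k. k \<bullet> (G x - G 0)) \<le> b * norm h" if "x \<in> closed_segment 0 h" for x
    proof (rule onorm_le)
      fix k
      have "norm (k \<bullet> (G x - G 0)) \<le> norm k * norm (G x - G 0)"
        by (rule Cauchy_Schwarz_ineq2[unfolded real_norm_def[symmetric]])
      also have "\<dots> \<le> norm k * (b * norm h)"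
        by (intro mult_left_mono G_lip that) auto
      finally show "norm (k \<bullet> (G x - G 0)) \<le> b * norm h * norm k" by (simp add: mult_ac)
    qed
  qed auto
  then show ?thesis by (simp add: power2_eq_square mult_ac)
qed

lemma GDERIV_unique:
  assumes "GDERIV u x :> D" "GDERIV u x :> E"
  shows "D = E"
proof -
  have "(\<lambda>h. h \<bullet> D) = (\<lambda>h. h \<bullet> E)"
    using assms unfolding gderiv_def by (rule has_derivative_unique)
  then have "h \<bullet> D = h \<bullet> E" for h by (rule fun_cong)
  from this[of "D - E"] have "(D - E) \<bullet> (D - E) = 0" by (simp add: inner_diff_right)
  then show ?thesis by simp
qed

lemma gradient_eq: "GDERIV u x :> D \<Longrightarrow> gradient u x = D"
  unfolding gradient_def by (rule the_equality) (auto intro: GDERIV_unique)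

text \<open>\<open>u\<close> minus the paraboloid has a local maximum at \<open>x\<close>, so its
  derivative vanishes there. At the maximum of the doubled function this identifies the gradient
  inside the operator with that of the test function.\<close>

lemma GDERIV_eq_of_touching_paraboloid:
  fixes u :: "'a::euclidean_space \<Rightarrow> real"
  assumes u: "GDERIV u x :> D" and r: "r > 0"
    and le: "\<And>h. norm h < r \<Longrightarrow> u (x + h) - u x \<le> p \<bullet> h + C * (norm h)\<^sup>2"
  shows "D = p"
proof -
  define w where "w y = u y - p \<bullet> (y - x) - C * ((y - x) \<bullet> (y - x))" for y
  have "(w has_derivative (\<lambda>h. h \<bullet> (D - p))) (at x)"
    using u unfolding gderiv_def w_def
    by (auto intro!: derivative_eq_intros simp: inner_diff_right inner_commute)
  moreover have "\<forall>y\<in>ball x r. w y \<le> w x"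
    using le[of "y - x" for y] by (auto simp: w_def dist_norm norm_minus_commute power2_norm_eq_inner algebra_simps)
  ultimately have "(\<lambda>h. h \<bullet> (D - p)) = (\<lambda>h. 0)"
    using r by (intro differential_zero_maxmin[of x "ball x r" w]) auto
  then have "(D - p) \<bullet> (D - p) = 0" by (rule fun_cong)
  then show ?thesis by simp
qed

section \<open>The function \<open>L\<close>\<close>

lemma ereal_mult_less_of_le_half:
  assumes "0 < r" "ereal r \<le> R0 / 2" "t < 2"
  shows "ereal (t * r) < R0"
proof (cases R0)
  case (real q)
  then have "2 * r \<le> q" using assms(2) by simp
  moreover have "t * r < 2 * r" using assms by simp
  ultimately show ?thesis using real by simp
qed (use assms in auto)

lemma ereal_less_of_le: "a \<le> b \<Longrightarrow> ereal b < R \<Longrightarrow> ereal a < R"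
  using le_less_trans ereal_less_eq(3) by blast

locale scaling_function =
  fixes R0 :: ereal and l :: "real \<Rightarrow> real" and cL cU \<gamma> :: real and n :: nat
  assumes R0_pos: "0 < R0"
    and cL: "0 < cL" and cU: "1 \<le> cU" and \<gamma>: "0 < \<gamma>" "\<gamma> < 2"
    and l_measurable: "l \<in> borel_measurable (restrict_space borel (einterval 0 R0))"
    and l_pos: "\<And>s. 0 < s \<Longrightarrow> ereal s < R0 \<Longrightarrow> l s > 0"
    and l_finite: "\<And>r. 0 < r \<Longrightarrow> ereal r < R0 \<Longrightarrow>
          (\<integral>\<^sup>+s\<in>einterval (ereal r) R0. ennreal (l s / s) \<partial>lborel) < \<infinity>"
    and l_lower: "\<And>r t. 0 < r \<Longrightarrow> 1 \<le> t \<Longrightarrow> ereal t < R0 / ereal r \<Longrightarrow>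
          l (r * t) / l r \<ge> cL * t powr (- \<gamma>)"
    and l_upper: "\<And>r t. 0 < r \<Longrightarrow> 1 \<le> t \<Longrightarrow> ereal t < R0 / ereal r \<Longrightarrow>
          l (r * t) / l r \<le> cU * t ^ n"
begin

abbreviation "L \<equiv> tail_integral R0 l"

text \<open>The density of which \<open>L\<close> is the tail integral, extended by zero. All
  integrals can then be taken over the whole line, with no distinction between finite and infinite
  \<open>R0\<close>.\<close>

definition w :: "real \<Rightarrow> real" where
  "w s = l s / s * indicator (einterval 0 R0) s"

lemma w_measurable [measurable]: "w \<in> borel_measurable borel"
proof -
  have "(\<lambda>s. l s * indicator (einterval 0 R0) s) \<in> borel_measurable borel"
    using l_measurable by (subst (asm) borel_measurable_restrict_space_iff) (auto simp: mult.commute)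
  then have "(\<lambda>s. (l s * indicator (einterval 0 R0) s) / s) \<in> borel_measurable borel"
    by measurable
  then show ?thesis by (simp add: w_def[abs_def])
qed

lemma w_nonneg: "0 \<le> w s"
  using l_pos[of s] by (auto simp: w_def einterval_def split: split_indicator intro!: less_imp_le divide_pos_pos)

lemma w_eq: "0 < s \<Longrightarrow> ereal s < R0 \<Longrightarrow> w s = l s / s"
  by (simp add: w_def einterval_def)

lemma w_eq_0: "s \<le> 0 \<or> R0 \<le> ereal s \<Longrightarrow> w s = 0"
  by (auto simp: w_def einterval_def indicator_def)

lemma l_lower_ratio:
  assumes "0 < r" "r \<le> s" "ereal s < R0"
  shows "l r \<le> (s / r) powr \<gamma> / cL * l s"
proof -
  have r: "l r > 0" using assms l_pos[of r] ereal_less_of_le by blast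
  have "ereal (s / r) < R0 / ereal r"
    using assms by (cases R0) (auto simp: divide_strict_right_mono)
  with l_lower[of r "s / r"] assms have "cL * (s / r) powr (- \<gamma>) \<le> l s / l r" by simp
  then have "cL * (s / r) powr (- \<gamma>) * l r \<le> l s"
    using r by (simp add: field_simps)
  then have "(s / r) powr \<gamma> * (cL * (s / r) powr (- \<gamma>) * l r) \<le> (s / r) powr \<gamma> * l s"
    by (rule mult_left_mono) simp
  then have "((s / r) powr \<gamma> * (s / r) powr (- \<gamma>)) * (cL * l r) \<le> (s / r) powr \<gamma> * l s"
    by (simp only: mult_ac)
  moreover have "(s / r) powr \<gamma> * (s / r) powr (- \<gamma>) = 1"
    using assms by (simp add: powr_add[symmetric])
  ultimately show ?thesis using cL by (simp add: field_simps)
qed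

text \<open>Rounds the exponent \<open>\<gamma>\<close> up to 2. This suffices everywhere except in
  \<open>nn_integral_small\<close>, where the strict inequality \<open>\<gamma> < 2\<close> is what
  makes the integral converge at 0.\<close>

lemma l_lower_ratio_square:
  assumes "0 < r" "r \<le> s" "ereal s < R0"
  shows "l r \<le> (s / r)\<^sup>2 / cL * l s"
proof -
  have "(s / r) powr \<gamma> \<le> (s / r) powr 2"
    using assms \<gamma> by (intro powr_mono) auto
  then have "(s / r) powr \<gamma> \<le> (s / r)\<^sup>2" using assms by simp
  moreover have "l s > 0" using assms l_pos by auto
  ultimately have "(s / r) powr \<gamma> / cL * l s \<le> (s / r)\<^sup>2 / cL * l s"
    using cL by (intro mult_right_mono divide_right_mono) auto
  with l_lower_ratio[OF assms] show ?thesis by linarith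
qed

lemma l_upper_ratio:
  assumes "0 < r" "r \<le> s" "ereal s < R0"
  shows "l s \<le> cU * (s / r) ^ n * l r"
proof -
  have r: "l r > 0" using assms l_pos[of r] ereal_less_of_le by blast
  have "ereal (s / r) < R0 / ereal r"
    using assms by (cases R0) (auto simp: divide_strict_right_mono)
  with l_upper[of r "s / r"] assms have "l s / l r \<le> cU * (s / r) ^ n" by simp
  then show ?thesis using r by (simp add: field_simps)
qed

lemma nn_integral_tail:
  assumes "0 < r" "ereal r < R0"
  shows "(\<integral>\<^sup>+s. ennreal (w s * indicator {r<..} s) \<partial>lborel) < \<infinity>"
proof -
  have "(\<integral>\<^sup>+s. ennreal (w s * indicator {r<..} s) \<partial>lborel) =
        (\<integral>\<^sup>+s\<in>einterval (ereal r) R0. ennreal (l s / s) \<partial>lborel)"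
    using assms by (intro nn_integral_cong) (auto simp: w_def einterval_def split: split_indicator)
  then show ?thesis using l_finite[OF assms] by simp
qed

lemma integrable_tail:
  assumes "0 < r" "ereal r < R0"
  shows "integrable lborel (\<lambda>s. w s * indicator {r<..} s)"
  using nn_integral_tail[OF assms]
  by (intro integrableI_nonneg) (auto simp: w_nonneg)

lemma L_eq:
  assumes "0 < r" "ereal r < R0"
  shows "L r = (LINT s|lborel. w s * indicator {r<..} s)"
proof -
  have "L r = (LINT s|lborel. indicator (einterval (ereal r) R0) s * (l s / s))"
    using assms unfolding tail_integral_def interval_lebesgue_integral_def set_lebesgue_integral_def
    by (simp add: less_imp_le)
  also have "\<dots> = (LINT s|lborel. w s * indicator {r<..} s)"
    using assms by (intro Bochner_Integration.integral_cong) (auto simp: w_def einterval_def split: split_indicator)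
  finally show ?thesis .
qed

lemma nn_integral_L:
  assumes "0 < r" "ereal r < R0"
  shows "(\<integral>\<^sup>+s. ennreal (w s * indicator {r<..} s) \<partial>lborel) = ennreal (L r)"
  unfolding L_eq[OF assms]
  by (intro nn_integral_eq_integral integrable_tail assms) (auto simp: w_nonneg)

lemma L_nonneg: "0 < r \<Longrightarrow> ereal r < R0 \<Longrightarrow> 0 \<le> L r"
  by (simp add: L_eq w_nonneg)

lemma
  assumes "0 < a" "a \<le> b" "ereal b < R0"
  shows integrable_w_Ioc: "integrable lborel (\<lambda>s. w s * indicator {a<..b} s)"
    and L_diff: "L a - L b = (LINT s|lborel. w s * indicator {a<..b} s)"
proof -
  have a: "ereal a < R0" using assms by (auto intro: ereal_less_of_le)
  have eq: "(\<lambda>s. w s * indicator {a<..b} s) = (\<lambda>s. w s * indicator {a<..} s - w s * indicator {b<..} s)"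
    using assms by (auto simp: fun_eq_iff split: split_indicator)
  show "integrable lborel (\<lambda>s. w s * indicator {a<..b} s)"
    unfolding eq using assms a by (intro Bochner_Integration.integrable_diff integrable_tail) auto
  show "L a - L b = (LINT s|lborel. w s * indicator {a<..b} s)"
    unfolding eq using assms a
    by (subst Bochner_Integration.integral_diff) (auto intro!: integrable_tail simp: L_eq)
qed

lemma nn_integral_L_diff:
  assumes "0 < a" "a \<le> b" "ereal b < R0"
  shows "(\<integral>\<^sup>+s. ennreal (w s * indicator {a<..b} s) \<partial>lborel) = ennreal (L a - L b)"
  unfolding L_diff[OF assms]
  by (intro nn_integral_eq_integral integrable_w_Ioc assms) (auto simp: w_nonneg)

section \<open>Monotonicity and growth of \<open>L\<close>\<close>

lemma L_antimono: "0 < a \<Longrightarrow> a \<le> b \<Longrightarrow> ereal b < R0 \<Longrightarrow> L b \<le> L a"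
proof -
  assume "0 < a" "a \<le> b" "ereal b < R0"
  then have "L a - L b = (LINT s|lborel. w s * indicator {a<..b} s)" by (rule L_diff)
  also have "\<dots> \<ge> 0" by (intro Bochner_Integration.integral_nonneg) (simp add: w_nonneg)
  finally show "L b \<le> L a" by simp
qed

text \<open>For \<open>s\<close> in \<open>[a, 2 * a]\<close> lower scaling loses at most
  \<open>4 / cL\<close> in \<open>l\<close>, and \<open>1 / s\<close> at most a factor 2, whence
  \<open>cL / 8\<close>.\<close>

lemma L_diff_ge:
  assumes "0 < a" "a \<le> b" "b \<le> 2 * a" "ereal b < R0"
  shows "cL / 8 * (l a / a) * (b - a) \<le> L a - L b"
proof -
  have "cL / 8 * (l a / a) * (b - a) = (LINT s|lborel. cL / 8 * (l a / a) * indicator {a<..b} s)"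
    using assms by simp
  also have "\<dots> \<le> (LINT s|lborel. w s * indicator {a<..b} s)"
  proof (rule integral_mono)
    show "integrable lborel (\<lambda>s. cL / 8 * (l a / a) * indicator {a<..b} s)"
      using assms by (intro integrable_mult_right integrable_real_indicator) auto
    show "integrable lborel (\<lambda>s. w s * indicator {a<..b} s)"
      using assms by (intro integrable_w_Ioc) auto
    show "cL / 8 * (l a / a) * indicator {a<..b} s \<le> w s * indicator {a<..b} s" for s
    proof (cases "s \<in> {a<..b}")
      case True
      then have s: "a < s" "s \<le> 2 * a" "ereal s < R0" using assms by (auto intro: ereal_less_of_le)
      have ls: "0 < l s" using s assms by (intro l_pos) auto
      have "(s / a)\<^sup>2 \<le> 2\<^sup>2"
        using s assms by (intro power_mono) (auto simp: field_simps)
      then have "(s / a)\<^sup>2 / cL * l s \<le> 4 / cL * l s"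
        using cL ls by (intro mult_right_mono divide_right_mono) auto
      with l_lower_ratio_square[of a s] s assms have la: "l a \<le> 4 / cL * l s" by linarith
      have "cL / 8 * (l a / a) \<le> cL / 8 * (4 / cL * l s / a)"
        using la assms cL by (intro mult_left_mono divide_right_mono) auto
      also have "\<dots> = l s / (2 * a)" using cL by (simp add: field_simps)
      also have "\<dots> \<le> l s / s" using s assms ls by (intro divide_left_mono) auto
      also have "\<dots> = w s" using s assms by (simp add: w_eq)
      finally show ?thesis using True by simp
    qed auto
  qed
  finally show ?thesis using assms by (simp add: L_diff)
qed

lemma L_strict_antimono:
  assumes "0 < a" "a < b" "ereal b < R0"
  shows "L b < L a"
proof -
  define b' where "b' = min b (2 * a)"
  have b': "a < b'" "b' \<le> b" "b' \<le> 2 * a" using assms by (auto simp: b'_def)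
  have b'R: "ereal b' < R0" using b' assms by (auto intro: ereal_less_of_le)
  have "0 < cL / 8 * (l a / a) * (b' - a)"
    using cL b' b'R assms l_pos[of a]
    by (intro mult_pos_pos divide_pos_pos) (auto intro: ereal_less_of_le less_imp_le)
  with L_diff_ge[of a b'] L_antimono[of b' b] b' b'R assms show ?thesis by auto
qed

lemma L_pos:
  assumes "0 < a" "ereal a < R0"
  shows "0 < L a"
proof -
  obtain b where b: "ereal a < ereal b" "ereal b < R0"
    using ereal_dense2[OF assms(2)] by auto
  then show ?thesis
    using L_strict_antimono[of a b] L_nonneg[of b] assms by auto
qed

lemma l_le_L:
  assumes "0 < r" "ereal r \<le> R0 / 2"
  shows "l r \<le> 16 / cL * L r"
proof -
  \<comment> \<open>The factor \<open>3 / 2\<close> instead of 2 keeps the end point strictly below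
    \<open>R0\<close> even when \<open>r = R0 / 2\<close>; the length \<open>r / 2\<close> then
    turns \<open>cL / 8\<close> into \<open>cL / 16\<close>.\<close>
  have R: "ereal (3 / 2 * r) < R0" using assms by (intro ereal_mult_less_of_le_half) auto
  have "cL / 8 * (l r / r) * (3 / 2 * r - r) \<le> L r - L (3 / 2 * r)"
    using assms R by (intro L_diff_ge) auto
  moreover have "0 \<le> L (3 / 2 * r)" using assms R by (intro L_nonneg) auto
  ultimately show ?thesis using assms cL by (simp add: field_simps)
qed

text \<open>The constant of \<open>L_le\<close>: the 1 accounts for \<open>L \<delta>\<close>
  itself, and \<open>8 / cL\<^sup>2\<close> is the product of \<open>1 / (2 * cL)\<close>, from
  integrating a cube, and \<open>16 / cL\<close>, from \<open>l_le_L\<close>.\<close>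

definition doubling :: real where "doubling = 1 + 8 / cL\<^sup>2"

lemma doubling_ge: "1 \<le> doubling" by (simp add: doubling_def)

text \<open>Below \<open>\<delta>\<close>, scaling with exponent 2 bounds \<open>w s\<close> by a
  multiple of \<open>l \<delta> / s ^ 3\<close>; integration gives the square, and
  \<open>l_le_L\<close> turns \<open>l \<delta>\<close> into \<open>L \<delta>\<close>. Raised to
  the power \<open>\<beta>\<close>, this polynomial bound is what keeps penalties at different
  scales comparable.\<close>

lemma L_le:
  assumes "0 < \<sigma>" "\<sigma> \<le> \<delta>" "ereal \<delta> \<le> R0 / 2"
  shows "L \<sigma> \<le> doubling * (\<delta> / \<sigma>)\<^sup>2 * L \<delta>"
proof -
  have \<delta>: "0 < \<delta>" using assms by simp
  have R: "ereal \<delta> < R0" using ereal_mult_less_of_le_half[of \<delta> R0 1] assms by simp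
  have L\<delta>: "0 < L \<delta>" using \<delta> R by (rule L_pos)
  have "ennreal (L \<sigma> - L \<delta>) = (\<integral>\<^sup>+s. ennreal (w s * indicator {\<sigma><..\<delta>} s) \<partial>lborel)"
    using assms R by (simp add: nn_integral_L_diff)
  also have "\<dots> \<le> (\<integral>\<^sup>+s. ennreal (\<delta>\<^sup>2 * l \<delta> / cL / s ^ 3) * indicator {\<sigma>..\<delta>} s \<partial>lborel)"
  proof (intro nn_integral_mono)
    fix s :: real
    show "ennreal (w s * indicator {\<sigma><..\<delta>} s) \<le> ennreal (\<delta>\<^sup>2 * l \<delta> / cL / s ^ 3) * indicator {\<sigma>..\<delta>} s"
    proof (cases "s \<in> {\<sigma><..\<delta>}")
      case True
      then have s: "0 < s" "s \<le> \<delta>" "ereal s < R0" using assms R by (auto intro: ereal_less_of_le)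
      have "w s = l s / s" using s by (simp add: w_eq)
      also have "\<dots> \<le> ((\<delta> / s)\<^sup>2 / cL * l \<delta>) / s"
        using s R by (intro divide_right_mono l_lower_ratio_square) auto
      also have "\<dots> = \<delta>\<^sup>2 * l \<delta> / cL / s ^ 3"
        by (simp add: power_divide power3_eq_cube power2_eq_square)
      finally show ?thesis using True by (auto intro: ennreal_leI)
    qed auto
  qed
  also have "\<dots> = ennreal (- (\<delta>\<^sup>2 * l \<delta> / cL / (2 * \<delta>\<^sup>2)) - (- (\<delta>\<^sup>2 * l \<delta> / cL / (2 * \<sigma>\<^sup>2))))"
    using assms l_pos[OF \<delta> R] cL
    by (intro nn_integral_FTC_Icc)
       (auto intro!: derivative_eq_intros simp: divide_simps power2_eq_square power3_eq_cube)
  also have "\<dots> \<le> ennreal (\<delta>\<^sup>2 * l \<delta> / cL / (2 * \<sigma>\<^sup>2))"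
    using l_pos[OF \<delta> R] cL by (intro ennreal_leI) auto
  finally have "L \<sigma> - L \<delta> \<le> \<delta>\<^sup>2 * l \<delta> / cL / (2 * \<sigma>\<^sup>2)"
    using l_pos[OF \<delta> R] cL by (subst (asm) ennreal_le_iff) auto
  also have "\<dots> = (\<delta> / \<sigma>)\<^sup>2 / (2 * cL) * l \<delta>" by (simp add: power_divide)
  also have "\<dots> \<le> (\<delta> / \<sigma>)\<^sup>2 / (2 * cL) * (16 / cL * L \<delta>)"
    using cL assms by (intro mult_left_mono l_le_L) auto
  also have "\<dots> = 8 / cL\<^sup>2 * (\<delta> / \<sigma>)\<^sup>2 * L \<delta>" by (simp add: power2_eq_square mult_ac)
  finally have "L \<sigma> \<le> L \<delta> + 8 / cL\<^sup>2 * (\<delta> / \<sigma>)\<^sup>2 * L \<delta>" by simp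
  moreover have "L \<delta> \<le> (\<delta> / \<sigma>)\<^sup>2 * L \<delta>"
    using assms L\<delta> by (simp add: one_le_power)
  ultimately show ?thesis by (simp add: doubling_def algebra_simps)
qed

text \<open>The full exponent \<open>\<gamma>\<close> bounds the integrand by a multiple of
  \<open>s powr (1 - \<gamma>)\<close>, which is integrable at 0 and yields the factor
  \<open>1 / (2 - \<gamma>)\<close>.\<close>

lemma nn_integral_small:
  assumes "0 < \<rho>" "ereal \<rho> \<le> R0 / 2"
  shows "(\<integral>\<^sup>+s. ennreal (s\<^sup>2 * w s) * indicator {..<\<rho>} s \<partial>lborel)
           \<le> ennreal (16 / (cL\<^sup>2 * (2 - \<gamma>)) * \<rho>\<^sup>2 * L \<rho>)"
proof -
  have R: "ereal \<rho> < R0" using ereal_mult_less_of_le_half[of \<rho> R0 1] assms by simp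
  have l\<rho>: "0 < l \<rho>" using assms R by (intro l_pos)
  have "(\<integral>\<^sup>+s. ennreal (s\<^sup>2 * w s) * indicator {..<\<rho>} s \<partial>lborel)
      \<le> (\<integral>\<^sup>+s. ennreal (\<rho> powr \<gamma> * l \<rho> / cL) * ennreal (s powr (1 - \<gamma>) * indicator {0..\<rho>} s) \<partial>lborel)"
  proof (intro nn_integral_mono)
    fix s :: real
    show "ennreal (s\<^sup>2 * w s) * indicator {..<\<rho>} s
       \<le> ennreal (\<rho> powr \<gamma> * l \<rho> / cL) * ennreal (s powr (1 - \<gamma>) * indicator {0..\<rho>} s)"
    proof (cases "s \<in> {0<..<\<rho>}")
      case True
      then have s: "0 < s" "s \<le> \<rho>" "ereal s < R0" using R by (auto intro: ereal_less_of_le less_imp_le)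
      have "s\<^sup>2 * w s = s * l s" using s by (simp add: w_eq power2_eq_square)
      also have "\<dots> \<le> s * ((\<rho> / s) powr \<gamma> / cL * l \<rho>)"
        using s R by (intro mult_left_mono l_lower_ratio) auto
      also have "\<dots> = \<rho> powr \<gamma> * l \<rho> / cL * s powr (1 - \<gamma>)"
        using s assms by (simp add: powr_diff powr_divide field_simps)
      finally show ?thesis using True l\<rho> cL by (auto intro: ennreal_leI simp: ennreal_mult[symmetric])
    next
      case False
      then show ?thesis using w_eq_0[of s] by (auto split: split_indicator)
    qed
  qed
  also have "\<dots> = ennreal (\<rho> powr \<gamma> * l \<rho> / cL) * (\<integral>\<^sup>+s. ennreal (s powr (1 - \<gamma>) * indicator {0..\<rho>} s) \<partial>lborel)"
    by (rule nn_integral_cmult) auto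
  also have "(\<integral>\<^sup>+s. ennreal (s powr (1 - \<gamma>) * indicator {0..\<rho>} s) \<partial>lborel) = ennreal (\<rho> powr (2 - \<gamma>) / (2 - \<gamma>))"
  proof -
    have "((\<lambda>s. s powr (1 - \<gamma>)) has_integral (\<rho> powr ((1 - \<gamma>) + 1) / ((1 - \<gamma>) + 1))) {0..\<rho>}"
      using \<gamma> assms by (intro has_integral_powr_from_0) auto
    then have "((\<lambda>s. if s \<in> {0..\<rho>} then s powr (1 - \<gamma>) else 0) has_integral (\<rho> powr (2 - \<gamma>) / (2 - \<gamma>))) UNIV"
      by (subst has_integral_restrict_UNIV) simp
    also have "(\<lambda>s. if s \<in> {0..\<rho>} then s powr (1 - \<gamma>) else 0) = (\<lambda>s. s powr (1 - \<gamma>) * indicator {0..\<rho>} s)"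
      by (auto simp: fun_eq_iff split: split_indicator)
    finally show ?thesis
      by (intro nn_integral_has_integral_lborel) auto
  qed
  also have "ennreal (\<rho> powr \<gamma> * l \<rho> / cL) * ennreal (\<rho> powr (2 - \<gamma>) / (2 - \<gamma>)) = ennreal (\<rho>\<^sup>2 * l \<rho> / (cL * (2 - \<gamma>)))"
  proof -
    have "\<rho> powr \<gamma> * \<rho> powr (2 - \<gamma>) = \<rho>\<^sup>2"
      using assms by (simp add: powr_add[symmetric])
    then have "(\<rho> powr \<gamma> * l \<rho> / cL) * (\<rho> powr (2 - \<gamma>) / (2 - \<gamma>)) = \<rho>\<^sup>2 * l \<rho> / (cL * (2 - \<gamma>))"
      by (simp add: field_simps)
    then show ?thesis using l\<rho> cL \<gamma> by (simp add: ennreal_mult[symmetric])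
  qed
  also have "\<dots> \<le> ennreal (\<rho>\<^sup>2 * (16 / cL * L \<rho>) / (cL * (2 - \<gamma>)))"
    using cL \<gamma> assms by (intro ennreal_leI divide_right_mono mult_left_mono l_le_L) auto
  also have "\<rho>\<^sup>2 * (16 / cL * L \<rho>) / (cL * (2 - \<gamma>)) = 16 / (cL\<^sup>2 * (2 - \<gamma>)) * \<rho>\<^sup>2 * L \<rho>"
    by (simp add: power2_eq_square mult_ac)
  finally show ?thesis .
qed

text \<open>Near \<open>s\<close>, \<open>L\<close> is a constant plus an indefinite integral of
  \<open>w\<close>. Continuity serves three purposes: intermediate values in
  \<open>mass_sublevel\<close>, measurability of the medium jump weight, and attainment of the
  maximum over the scale.\<close>

lemma continuous_on_L: "continuous_on (einterval 0 R0) L"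
proof (rule continuous_at_imp_continuous_on, rule ballI)
  fix s assume "s \<in> einterval 0 R0"
  then have s: "0 < s" "ereal s < R0" by (auto simp: einterval_def)
  obtain b where b: "s < b" "ereal b < R0"
    using ereal_dense2[OF s(2)] by auto
  define a where "a = s / 2"
  have a: "0 < a" "a < s" using s by (auto simp: a_def)
  have set_int: "set_integrable lborel {t..b} w" if "a \<le> t" "t \<le> b" for t
  proof -
    have "integrable lborel (\<lambda>s. w s * indicator {a / 2<..b} s)"
      using a b that by (intro integrable_w_Ioc) auto
    then have "set_integrable lborel {a / 2<..b} w"
      by (simp add: set_integrable_def mult.commute)
    then show ?thesis
      by (rule set_integrable_subset) (use a that in auto)
  qed
  have eq: "L t = L b + integral {t..b} w" if "t \<in> {a..b}" for t
  proof -
    have "L t - L b = (LINT s|lborel. w s * indicator {t<..b} s)"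
      using that a b by (intro L_diff) auto
    also have "\<dots> = (LINT s:{t..b}|lborel. w s)"
      unfolding set_lebesgue_integral_def
    proof (intro integral_cong_AE)
      have "AE s in lborel. s \<noteq> t" by (rule AE_lborel_singleton)
      then show "AE s in lborel. w s * indicator {t<..b} s = indicator {t..b} s *\<^sub>R w s"
        by eventually_elim (auto split: split_indicator)
    qed auto
    also have "\<dots> = integral {t..b} w"
      using set_int[of t] that by (intro set_borel_integral_eq_integral(2)) auto
    finally show ?thesis by simp
  qed
  have "continuous_on {a..b} (\<lambda>t. L b + integral {t..b} w)"
    using set_borel_integral_eq_integral(1)[OF set_int[of a]] a b
    by (intro continuous_intros indefinite_integral_continuous_1') auto
  then have "continuous_on {a..b} L"
    by (rule continuous_on_eq) (rule eq[symmetric])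
  then show "isCont L s"
    using a b by (intro continuous_on_interior[of "{a..b}"]) auto
qed

text \<open>Since \<open>L\<close> decreases, the sublevel set lies in a half line starting at a
  point \<open>c\<close> with \<open>L c \<le> \<tau>\<close>, and the mass of \<open>w\<close>
  beyond \<open>c\<close> is \<open>L c\<close>.\<close>

lemma mass_sublevel:
  assumes \<delta>: "0 < \<delta>" "ereal \<delta> < R0" and \<tau>: "0 < \<tau>"
  shows "(\<integral>\<^sup>+s. ennreal (w s) * indicator {s. \<delta> < s \<and> ereal s < R0 \<and> L s \<le> \<tau>} s \<partial>lborel) \<le> ennreal \<tau>"
proof (cases "\<exists>t. \<delta> < t \<and> ereal t < R0 \<and> L t \<le> \<tau>")
  case False
  then have "{s. \<delta> < s \<and> ereal s < R0 \<and> L s \<le> \<tau>} = {}" by auto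
  then show ?thesis by simp
next
  case True
  then obtain t where t: "\<delta> < t" "ereal t < R0" "L t \<le> \<tau>" by auto
  have "\<exists>c. \<delta> \<le> c \<and> ereal c < R0 \<and> L c \<le> \<tau> \<and> (\<forall>s. \<delta> < s \<and> ereal s < R0 \<and> L s \<le> \<tau> \<longrightarrow> c \<le> s)"
  proof (cases "L \<delta> \<le> \<tau>")
    case True
    then show ?thesis using \<delta> by (intro exI[of _ \<delta>]) auto
  next
    case False
    have "continuous_on {\<delta>..t} L"
      using \<delta> t by (intro continuous_on_subset[OF continuous_on_L])
        (auto simp: einterval_def intro: ereal_less_of_le)
    then obtain c where c: "\<delta> \<le> c" "c \<le> t" "L c = \<tau>"
      using IVT2'[of L t \<tau> \<delta>] t False by auto
    have "c \<le> s" if s: "\<delta> < s" "ereal s < R0" "L s \<le> \<tau>" for s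
    proof (rule ccontr)
      assume "\<not> c \<le> s"
      then have "L c < L s" using s c t \<delta> by (intro L_strict_antimono) (auto intro: ereal_less_of_le)
      then show False using c s by simp
    qed
    then show ?thesis using c t by (intro exI[of _ c]) (auto intro: ereal_less_of_le)
  qed
  then obtain c where c: "\<delta> \<le> c" "ereal c < R0" "L c \<le> \<tau>"
    and le: "\<And>s. \<delta> < s \<Longrightarrow> ereal s < R0 \<Longrightarrow> L s \<le> \<tau> \<Longrightarrow> c \<le> s" by blast
  have "(\<integral>\<^sup>+s. ennreal (w s) * indicator {s. \<delta> < s \<and> ereal s < R0 \<and> L s \<le> \<tau>} s \<partial>lborel)
      \<le> (\<integral>\<^sup>+s. ennreal (w s * indicator {c<..} s) \<partial>lborel)"
  proof (intro nn_integral_mono_AE)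
    have "AE s in lborel. s \<noteq> c" by (rule AE_lborel_singleton)
    then show "AE s in lborel. ennreal (w s) * indicator {s. \<delta> < s \<and> ereal s < R0 \<and> L s \<le> \<tau>} s
                 \<le> ennreal (w s * indicator {c<..} s)"
      by eventually_elim (use le in \<open>force split: split_indicator\<close>)
  qed
  also have "\<dots> = ennreal (L c)" using c \<delta> by (intro nn_integral_L) auto
  also have "\<dots> \<le> ennreal \<tau>" using c by (intro ennreal_leI)
  finally show ?thesis .
qed

text \<open>Only the values of \<open>L\<close> inside \<open>(0, R0)\<close> are controlled, hence
  the cut-off.\<close>

lemma L_measurable [measurable]: "(\<lambda>s. indicator (einterval 0 R0) s * L s) \<in> borel_measurable borel"
  using borel_measurable_continuous_on_indicator[OF _ continuous_on_L] by simp

text \<open>Layer-cake decomposition over sublevel sets of \<open>L\<close>, in place of the substitution \<open>t = L s\<close>, for which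
  \<open>L\<close> is not smooth enough.\<close>

lemma nn_integral_sqrt_ratio:
  assumes \<delta>: "0 < \<delta>" "ereal \<delta> < R0"
  shows "(\<integral>\<^sup>+s. ennreal (sqrt (L \<delta> / L s) * w s) * indicator {\<delta><..} s \<partial>lborel) \<le> ennreal (4 * L \<delta>)"
proof -
  have L\<delta>: "0 < L \<delta>" using \<delta> by (rule L_pos)
  \<comment> \<open>Where \<open>L \<delta> / L s\<close> lies between \<open>4 ^ i\<close> and
    \<open>4 ^ Suc i\<close> its root is at most \<open>2 * 2 ^ i\<close>, while \<open>S i\<close>
    has mass at most \<open>L \<delta> / 4 ^ i\<close>. The products form a geometric series with
    sum \<open>4 * L \<delta>\<close>.\<close>
  define S where "S i = {s. \<delta> < s \<and> ereal s < R0 \<and> L s \<le> L \<delta> / 4 ^ i}" for i :: nat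
  have S_meas [measurable]: "S i \<in> sets borel" for i
  proof -
    have "S i = {s \<in> space borel. \<delta> < s \<and> s \<in> einterval 0 R0 \<and> indicator (einterval 0 R0) s * L s \<le> L \<delta> / 4 ^ i}"
      using \<delta> by (auto simp: S_def einterval_def)
    also have "\<dots> \<in> sets borel" by measurable
    finally show ?thesis .
  qed
  have "(\<integral>\<^sup>+s. ennreal (sqrt (L \<delta> / L s) * w s) * indicator {\<delta><..} s \<partial>lborel)
      \<le> (\<integral>\<^sup>+s. (\<Sum>i. ennreal (2 * 2 ^ i) * (ennreal (w s) * indicator (S i) s)) \<partial>lborel)"
  proof (intro nn_integral_mono)
    fix s :: real
    show "ennreal (sqrt (L \<delta> / L s) * w s) * indicator {\<delta><..} s
       \<le> (\<Sum>i. ennreal (2 * 2 ^ i) * (ennreal (w s) * indicator (S i) s))"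
    proof (cases "\<delta> < s \<and> ereal s < R0")
      case True
      then have Ls: "0 < L s" "L s \<le> L \<delta>" using \<delta> by (auto intro: L_pos L_antimono)
      define q where "q = L \<delta> / L s"
      have q: "1 \<le> q" using Ls by (simp add: q_def)
      define N where "N = (LEAST i. q < 4 ^ i)"
      obtain i0 :: nat where "q < 4 ^ i0" using real_arch_pow[of 4 q] by auto
      then have N: "q < 4 ^ N" unfolding N_def by (rule LeastI)
      then obtain i where i: "N = Suc i" using q by (cases N) auto
      have "4 ^ i \<le> q" using not_less_Least[of i "\<lambda>i. q < 4 ^ i"] i by (auto simp: N_def)
      then have "s \<in> S i" using True Ls by (simp add: S_def q_def field_simps)
      have "q \<le> (2 * 2 ^ i)\<^sup>2"
        using N i by (simp add: power_mult_distrib power_mult[symmetric] mult.commute[of i] power_mult)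
      then have "sqrt q \<le> 2 * 2 ^ i" by (intro real_le_lsqrt) auto
      then have "ennreal (sqrt (L \<delta> / L s) * w s) * indicator {\<delta><..} s
          \<le> ennreal (2 * 2 ^ i) * (ennreal (w s) * indicator (S i) s)"
        using True \<open>s \<in> S i\<close> w_nonneg[of s]
        by (auto simp: q_def ennreal_mult[symmetric] intro!: ennreal_leI mult_right_mono)
      also have "\<dots> = (\<Sum>i\<in>{i}. ennreal (2 * 2 ^ i) * (ennreal (w s) * indicator (S i) s))"
        by simp
      also have "\<dots> \<le> (\<Sum>i. ennreal (2 * 2 ^ i) * (ennreal (w s) * indicator (S i) s))"
        by (intro sum_le_suminf summableI) auto
      finally show ?thesis .
    next
      case False
      then show ?thesis using w_eq_0[of s] by (auto simp: not_less split: split_indicator)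
    qed
  qed
  also have "\<dots> = (\<Sum>i. \<integral>\<^sup>+s. ennreal (2 * 2 ^ i) * (ennreal (w s) * indicator (S i) s) \<partial>lborel)"
    by (rule nn_integral_suminf) auto
  also have "\<dots> \<le> (\<Sum>i. ennreal (2 * L \<delta> * (1 / 2) ^ i))"
  proof (intro suminf_le summableI)
    fix i
    have "(\<integral>\<^sup>+s. ennreal (2 * 2 ^ i) * (ennreal (w s) * indicator (S i) s) \<partial>lborel)
        = ennreal (2 * 2 ^ i) * (\<integral>\<^sup>+s. ennreal (w s) * indicator (S i) s \<partial>lborel)"
      by (rule nn_integral_cmult) auto
    also have "\<dots> \<le> ennreal (2 * 2 ^ i) * ennreal (L \<delta> / 4 ^ i)"
      unfolding S_def using \<delta> L\<delta> by (intro mult_left_mono mass_sublevel) auto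
    also have "\<dots> = ennreal (2 * 2 ^ i * (L \<delta> / 4 ^ i))"
      using L\<delta> by (simp add: ennreal_mult[symmetric])
    also have "2 * 2 ^ i * (L \<delta> / 4 ^ i) = 2 * L \<delta> * (1 / 2) ^ i"
      by (simp add: power_divide field_simps power_mult_distrib[symmetric])
    finally show "(\<integral>\<^sup>+s. ennreal (2 * 2 ^ i) * (ennreal (w s) * indicator (S i) s) \<partial>lborel)
        \<le> ennreal (2 * L \<delta> * (1 / 2) ^ i)" .
  qed
  also have "\<dots> = ennreal (4 * L \<delta>)"
  proof (rule suminf_ennreal_eq)
    have "(\<lambda>i. 2 * L \<delta> * (1 / 2) ^ i) sums (2 * L \<delta> * (1 / (1 - 1 / 2)))"
      by (intro sums_mult geometric_sums) auto
    then show "(\<lambda>i. 2 * L \<delta> * (1 / 2) ^ i) sums (4 * L \<delta>)" by simp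
  qed (use L\<delta> in auto)
  finally show ?thesis .
qed

end

section \<open>Admissible kernels\<close>

locale nonlocal_kernel = scaling_function R0 l cL cU \<gamma> "DIM('a::euclidean_space)"
  for R0 l cL cU \<gamma> +
  fixes \<kappa> K0 :: real and K :: "'a::euclidean_space \<Rightarrow> 'a \<Rightarrow> real"
  assumes \<kappa>: "1 \<le> \<kappa>" and K0: "1 \<le> K0"
    and K_measurable:
          "(\<lambda>(x, h). K x h) \<in> borel_measurable (restrict_space borel (UNIV \<times> (- {0})))"
    and K_nonneg: "\<And>x h. h \<noteq> 0 \<Longrightarrow> K x h \<ge> 0"
    and K_sym: "\<And>x h. h \<noteq> 0 \<Longrightarrow> K x h = K x (- h)"
    and K_lower: "\<And>x h. 0 < norm h \<Longrightarrow> ereal (norm h) < R0 \<Longrightarrow>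
          inverse \<kappa> * norm h powr (- real DIM('a)) * l (norm h) \<le> K x h"
    and K_upper: "\<And>x h. 0 < norm h \<Longrightarrow> ereal (norm h) < R0 \<Longrightarrow>
          K x h \<le> \<kappa> * norm h powr (- real DIM('a)) * l (norm h)"
    and K_integral:
          "(SUP x. \<integral>\<^sup>+h\<in>- {0}. ennreal (min 1 ((norm h)\<^sup>2) * K x h) \<partial>lborel) \<le> ennreal K0"
begin

text \<open>This is the model density \<open>norm h powr (- d) * l (norm h)\<close> with
  \<open>d\<close> the dimension, written through \<open>w\<close> so that it is Borel on the whole
  space and vanishes at 0 and from \<open>R0\<close> on.\<close>

definition radial :: "'a \<Rightarrow> real" where
  "radial h = norm h powr (1 - real DIM('a)) * w (norm h)"

lemma radial_measurable [measurable]: "radial \<in> borel_measurable borel"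
  unfolding radial_def by measurable

lemma radial_nonneg: "0 \<le> radial h"
  by (simp add: radial_def w_nonneg)

lemma radial_eq:
  assumes "0 < norm h" "ereal (norm h) < R0"
  shows "radial h = norm h powr (- real DIM('a)) * l (norm h)"
  using assms by (simp add: radial_def w_eq powr_diff powr_minus field_simps)

text \<open>The Jacobian of polar coordinates cancels the power of the norm in
  \<open>radial\<close>; radial integrals become integrals against the density of
  \<open>L\<close>.\<close>

lemma nn_integral_radial:
  fixes \<phi> :: "real \<Rightarrow> real"
  assumes [measurable]: "\<phi> \<in> borel_measurable borel" and \<phi>: "\<And>s. 0 \<le> \<phi> s"
  shows "(\<integral>\<^sup>+h. ennreal (\<phi> (norm h) * radial h) \<partial>lborel) = ennreal (sphere_area TYPE('a)) * (\<integral>\<^sup>+s. ennreal (\<phi> s * w s) \<partial>lborel)"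
proof -
  have "(\<integral>\<^sup>+h. ennreal (\<phi> (norm h) * radial h) \<partial>lborel)
      = (\<integral>\<^sup>+h. (\<lambda>s. ennreal (\<phi> s * (s powr (1 - real DIM('a)) * w s))) (norm (h::'a)) \<partial>lborel)"
    by (simp add: radial_def)
  also have "\<dots> = (\<integral>\<^sup>+s. ennreal (sphere_area TYPE('a) * s ^ (DIM('a) - 1)) * indicator {0..} s *
      ennreal (\<phi> s * (s powr (1 - real DIM('a)) * w s)) \<partial>lborel)"
    by (rule nn_integral_norm) auto
  also have "\<dots> = (\<integral>\<^sup>+s. ennreal (sphere_area TYPE('a)) * ennreal (\<phi> s * w s) \<partial>lborel)"
  proof (intro nn_integral_cong)
    fix s :: real
    show "ennreal (sphere_area TYPE('a) * s ^ (DIM('a) - 1)) * indicator {0..} s *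
      ennreal (\<phi> s * (s powr (1 - real DIM('a)) * w s)) = ennreal (sphere_area TYPE('a)) * ennreal (\<phi> s * w s)"
    proof (cases "0 < s")
      case True
      have "s ^ (DIM('a) - 1) * s powr (1 - real DIM('a)) = 1"
        using True by (simp add: powr_realpow[symmetric] powr_add[symmetric] of_nat_diff)
      then have "sphere_area TYPE('a) * s ^ (DIM('a) - 1) * (\<phi> s * (s powr (1 - real DIM('a)) * w s)) = sphere_area TYPE('a) * (\<phi> s * w s)"
        by (metis (no_types, opaque_lifting) mult.assoc mult.commute mult_1)
      then show ?thesis
        using True sphere_area_pos[where 'a='a] \<phi> w_nonneg
        by (simp add: ennreal_mult[symmetric] less_imp_le)
    qed (use w_eq_0[of s] in auto)
  qed
  also have "\<dots> = ennreal (sphere_area TYPE('a)) * (\<integral>\<^sup>+s. ennreal (\<phi> s * w s) \<partial>lborel)"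
    by (rule nn_integral_cmult) auto
  finally show ?thesis .
qed

text \<open>What is used of a single slice \<open>K x\<close>, with constants independent of
  \<open>x\<close>. Since the later estimates see a kernel only through this predicate, the slice at
  one point may be used at another.\<close>

definition admissible :: "('a \<Rightarrow> real) \<Rightarrow> bool" where
  "admissible k \<longleftrightarrow> k \<in> borel_measurable borel \<and> (\<forall>h. 0 \<le> k h) \<and> (\<forall>h. k (- h) = k h) \<and>
     (\<forall>h. 0 < norm h \<longrightarrow> ereal (norm h) < R0 \<longrightarrow> radial h / \<kappa> \<le> k h \<and> k h \<le> \<kappa> * radial h) \<and>
     (\<integral>\<^sup>+h. ennreal (min 1 ((norm h)\<^sup>2) * k h) \<partial>lborel) \<le> ennreal K0"

lemma admissibleD:
  assumes "admissible k"
  shows admissible_measurable: "k \<in> borel_measurable borel"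
    and admissible_nonneg: "0 \<le> k h"
    and admissible_sym: "k (- h) = k h"
    and admissible_lower: "0 < norm h \<Longrightarrow> ereal (norm h) < R0 \<Longrightarrow> radial h / \<kappa> \<le> k h"
    and admissible_upper: "0 < norm h \<Longrightarrow> ereal (norm h) < R0 \<Longrightarrow> k h \<le> \<kappa> * radial h"
    and admissible_integral: "(\<integral>\<^sup>+h. ennreal (min 1 ((norm h)\<^sup>2) * k h) \<partial>lborel) \<le> ennreal K0"
  using assms by (auto simp: admissible_def)

lemma K_slice_measurable: "(\<lambda>h. indicator (- {0}) h * K x h) \<in> borel_measurable borel"
proof -
  have "(\<lambda>h. (x, h)) \<in> measurable (restrict_space borel (- {0})) (restrict_space borel (UNIV \<times> (- {0})))"
    by (intro measurable_restrict_space3 borel_measurable_continuous_onI continuous_intros) auto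
  from measurable_compose[OF this K_measurable]
  have "K x \<in> borel_measurable (restrict_space borel (- {0}))" by simp
  then show ?thesis
    by (subst (asm) borel_measurable_restrict_space_iff) (auto simp: mult.commute)
qed

lemma admissible_K: "admissible (\<lambda>h. indicator (- {0}) h * K x h)"
  unfolding admissible_def
proof (intro conjI allI impI)
  show "(\<integral>\<^sup>+h. ennreal (min 1 ((norm h)\<^sup>2) * (indicator (- {0}) h * K x h)) \<partial>lborel) \<le> ennreal K0"
  proof -
    have "(\<integral>\<^sup>+h. ennreal (min 1 ((norm h)\<^sup>2) * (indicator (- {0}) h * K x h)) \<partial>lborel)
        = (\<integral>\<^sup>+h\<in>- {0}. ennreal (min 1 ((norm h)\<^sup>2) * K x h) \<partial>lborel)"
      by (intro nn_integral_cong) (auto split: split_indicator)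
    also have "\<dots> \<le> (SUP x. \<integral>\<^sup>+h\<in>- {0}. ennreal (min 1 ((norm h)\<^sup>2) * K x h) \<partial>lborel)"
      by (rule SUP_upper) simp
    finally show ?thesis using K_integral by simp
  qed
  show "indicator (- {0}) (- h) * K x (- h) = indicator (- {0}) h * K x h" for h
    using K_sym[of h x] by (auto split: split_indicator)
qed (use K_slice_measurable K_nonneg K_lower[of _ x] K_upper[of _ x] in
      \<open>auto simp: radial_eq divide_inverse mult_ac split: split_indicator\<close>)

text \<open>\<open>\<phi>\<close> has to vanish at 0 and from \<open>R0\<close> on, because only in
  between is \<open>k\<close> dominated by \<open>radial\<close>.\<close>

lemma nn_integral_admissible_le:
  fixes \<phi> :: "real \<Rightarrow> real"
  assumes k: "admissible k" and [measurable]: "\<phi> \<in> borel_measurable borel"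
    and \<phi>: "\<And>s. 0 \<le> \<phi> s" "\<phi> 0 = 0" "\<And>s. R0 \<le> ereal s \<Longrightarrow> \<phi> s = 0"
    and le: "(\<integral>\<^sup>+s. ennreal (\<phi> s * w s) \<partial>lborel) \<le> ennreal C" and C: "0 \<le> C"
  shows "(\<integral>\<^sup>+h. ennreal (\<phi> (norm h) * k h) \<partial>lborel) \<le> ennreal (\<kappa> * sphere_area TYPE('a) * C)"
proof -
  have "(\<integral>\<^sup>+h. ennreal (\<phi> (norm h) * k h) \<partial>lborel) \<le> (\<integral>\<^sup>+h. ennreal \<kappa> * ennreal (\<phi> (norm h) * radial h) \<partial>lborel)"
  proof (intro nn_integral_mono)
    fix h :: 'a
    have "\<phi> (norm h) * k h \<le> \<kappa> * (\<phi> (norm h) * radial h)"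
    proof (cases "0 < norm h \<and> ereal (norm h) < R0")
      case True
      then have "\<phi> (norm h) * k h \<le> \<phi> (norm h) * (\<kappa> * radial h)"
        using \<phi> by (intro mult_left_mono admissible_upper[OF k]) auto
      then show ?thesis by (simp add: mult_ac)
    qed (use \<phi> in \<open>auto simp: not_less\<close>)
    then show "ennreal (\<phi> (norm h) * k h) \<le> ennreal \<kappa> * ennreal (\<phi> (norm h) * radial h)"
      using \<kappa> \<phi> radial_nonneg by (simp add: ennreal_mult[symmetric] ennreal_leI)
  qed
  also have "\<dots> = ennreal \<kappa> * (\<integral>\<^sup>+h. ennreal (\<phi> (norm h) * radial h) \<partial>lborel)"
    by (rule nn_integral_cmult) auto
  also have "\<dots> = ennreal \<kappa> * (ennreal (sphere_area TYPE('a)) * (\<integral>\<^sup>+s. ennreal (\<phi> s * w s) \<partial>lborel))"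
    using \<phi> by (subst nn_integral_radial) auto
  also have "\<dots> \<le> ennreal \<kappa> * (ennreal (sphere_area TYPE('a)) * ennreal C)"
    using le by (intro mult_left_mono) auto
  also have "\<dots> = ennreal (\<kappa> * sphere_area TYPE('a) * C)"
    using \<kappa> C sphere_area_pos[where 'a='a] by (simp add: ennreal_mult[symmetric] less_imp_le mult_ac)
  finally show ?thesis .
qed

section \<open>Mass of small, medium and large jumps\<close>

lemma small_jumps:
  assumes k: "admissible k" and \<rho>: "0 < \<rho>" "ereal \<rho> \<le> R0 / 2"
  shows "(\<integral>\<^sup>+h. ennreal ((norm h)\<^sup>2 * indicator {..<\<rho>} (norm h) * k h) \<partial>lborel)
    \<le> ennreal (\<kappa> * sphere_area TYPE('a) * (16 / (cL\<^sup>2 * (2 - \<gamma>)) * \<rho>\<^sup>2 * L \<rho>))"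
proof (rule nn_integral_admissible_le[OF k, where \<phi> = "\<lambda>s. s\<^sup>2 * indicator {..<\<rho>} s"])
  have R: "ereal \<rho> < R0" using ereal_mult_less_of_le_half[of \<rho> R0 1] \<rho> by simp
  show "s\<^sup>2 * indicator {..<\<rho>} s = 0" if "R0 \<le> ereal s" for s :: real
    using order_trans[OF less_imp_le[OF R] that] by simp
  show "0 \<le> 16 / (cL\<^sup>2 * (2 - \<gamma>)) * \<rho>\<^sup>2 * L \<rho>"
    using cL \<gamma> L_nonneg[OF \<rho>(1) R] by simp
  have "(\<integral>\<^sup>+s. ennreal (s\<^sup>2 * indicator {..<\<rho>} s * w s) \<partial>lborel)
      = (\<integral>\<^sup>+s. ennreal (s\<^sup>2 * w s) * indicator {..<\<rho>} s \<partial>lborel)"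
    by (intro nn_integral_cong) (auto split: split_indicator)
  then show "(\<integral>\<^sup>+s. ennreal (s\<^sup>2 * indicator {..<\<rho>} s * w s) \<partial>lborel)
      \<le> ennreal (16 / (cL\<^sup>2 * (2 - \<gamma>)) * \<rho>\<^sup>2 * L \<rho>)"
    using nn_integral_small[OF \<rho>] by simp
qed auto

lemma medium_jumps:
  assumes k: "admissible k" and \<delta>: "0 < \<delta>" and \<rho>: "\<delta> < \<rho>" "ereal \<rho> < R0"
  shows "(\<integral>\<^sup>+h. ennreal (sqrt (L \<delta> / L (norm h)) * indicator {\<delta>..<\<rho>} (norm h) * k h) \<partial>lborel)
    \<le> ennreal (\<kappa> * sphere_area TYPE('a) * (4 * L \<delta>))"
proof -
  \<comment> \<open>A Borel function on the whole line that agrees with \<open>L\<close> on the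
    annulus.\<close>
  define Lx where "Lx s = indicator (einterval 0 R0) s * L s" for s
  have [measurable]: "Lx \<in> borel_measurable borel" unfolding Lx_def by measurable
  have R: "ereal \<delta> < R0" using \<rho> ereal_less_of_le less_imp_le by blast
  have Lx: "Lx s = L s" if "s \<in> {\<delta>..<\<rho>}" for s
    using that \<delta> \<rho> ereal_less_of_le[of s \<rho> R0] by (auto simp: Lx_def einterval_def)
  have nonneg: "0 \<le> sqrt (L \<delta> / Lx s) * indicator {\<delta>..<\<rho>} s" for s
    using \<delta> \<rho> R L_nonneg[of s] L_nonneg[of \<delta>] ereal_less_of_le[of s \<rho> R0] Lx[of s]
    by (auto split: split_indicator)
  have "(\<integral>\<^sup>+h. ennreal (sqrt (L \<delta> / Lx (norm h)) * indicator {\<delta>..<\<rho>} (norm h) * k h) \<partial>lborel)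
    \<le> ennreal (\<kappa> * sphere_area TYPE('a) * (4 * L \<delta>))"
  proof (rule nn_integral_admissible_le[OF k, where \<phi> = "\<lambda>s. sqrt (L \<delta> / Lx s) * indicator {\<delta>..<\<rho>} s"])
    show "sqrt (L \<delta> / Lx s) * indicator {\<delta>..<\<rho>} s = 0" if "R0 \<le> ereal s" for s
      using less_le_trans[OF \<rho>(2) that] by simp
    have "(\<integral>\<^sup>+s. ennreal (sqrt (L \<delta> / Lx s) * indicator {\<delta>..<\<rho>} s * w s) \<partial>lborel)
        \<le> (\<integral>\<^sup>+s. ennreal (sqrt (L \<delta> / L s) * w s) * indicator {\<delta><..} s \<partial>lborel)"
    proof (intro nn_integral_mono_AE)
      have "AE s in lborel. s \<noteq> \<delta>" by (rule AE_lborel_singleton)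
      then show "AE s in lborel. ennreal (sqrt (L \<delta> / Lx s) * indicator {\<delta>..<\<rho>} s * w s)
          \<le> ennreal (sqrt (L \<delta> / L s) * w s) * indicator {\<delta><..} s"
        by eventually_elim (auto simp: Lx split: split_indicator)
    qed
    then show "(\<integral>\<^sup>+s. ennreal (sqrt (L \<delta> / Lx s) * indicator {\<delta>..<\<rho>} s * w s) \<partial>lborel) \<le> ennreal (4 * L \<delta>)"
      using nn_integral_sqrt_ratio[OF \<delta> R] by (rule order_trans)
    show "0 \<le> 4 * L \<delta>" using L_nonneg[OF \<delta> R] by simp
  qed (use \<delta> nonneg in auto)
  also have "(\<lambda>h. sqrt (L \<delta> / Lx (norm h)) * indicator {\<delta>..<\<rho>} (norm h) * k h)
      = (\<lambda>h. sqrt (L \<delta> / L (norm h)) * indicator {\<delta>..<\<rho>} (norm h) * k h)"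
    using Lx by (auto simp: fun_eq_iff split: split_indicator)
  finally show ?thesis .
qed

text \<open>Below \<open>R0\<close> the upper kernel bound gives a multiple of
  \<open>L \<rho>\<close>. Beyond a finite \<open>R0\<close> only the integral bound
  \<open>K0\<close> is available; it is absorbed because \<open>\<rho> \<le> R0 / 2\<close> implies
  \<open>L \<rho> \<ge> L (R0 / 2) > 0\<close>. The constant therefore depends on \<open>R0\<close>
  and \<open>L\<close>, and is only asserted to exist.\<close>

lemma large_jumps:
  "\<exists>C>0. \<forall>k \<rho>. admissible k \<longrightarrow> 0 < \<rho> \<longrightarrow> ereal \<rho> \<le> R0 / 2 \<longrightarrow>
     (\<integral>\<^sup>+h. ennreal (indicator {\<rho>..} (norm h) * k h) \<partial>lborel) \<le> ennreal (C * L \<rho>)"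
proof -
  define T where "T = {s. R0 \<le> ereal s}"
  have [measurable]: "T \<in> sets borel"
  proof (cases R0)
    case (real q)
    then have "T = {q..}" by (auto simp: T_def)
    then show ?thesis by simp
  qed (auto simp: T_def)
  have near: "(\<integral>\<^sup>+h. ennreal ((indicator {\<rho>..} (norm h) * indicator (- T) (norm h)) * k h) \<partial>lborel)
      \<le> ennreal (\<kappa> * sphere_area TYPE('a) * L \<rho>)"
    if k: "admissible k" and \<rho>: "0 < \<rho>" "ereal \<rho> \<le> R0 / 2" for k \<rho>
  proof (rule nn_integral_admissible_le[OF k, where \<phi> = "\<lambda>s. indicator {\<rho>..} s * indicator (- T) s"])
    have R: "ereal \<rho> < R0" using ereal_mult_less_of_le_half[of \<rho> R0 1] \<rho> by simp
    have "(\<integral>\<^sup>+s. ennreal (indicator {\<rho>..} s * indicator (- T) s * w s) \<partial>lborel)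
       \<le> (\<integral>\<^sup>+s. ennreal (w s * indicator {\<rho><..} s) \<partial>lborel)"
    proof (intro nn_integral_mono_AE)
      have "AE s in lborel. s \<noteq> \<rho>" by (rule AE_lborel_singleton)
      then show "AE s in lborel. ennreal (indicator {\<rho>..} s * indicator (- T) s * w s)
          \<le> ennreal (w s * indicator {\<rho><..} s)"
        by eventually_elim (auto split: split_indicator)
    qed
    then show "(\<integral>\<^sup>+s. ennreal (indicator {\<rho>..} s * indicator (- T) s * w s) \<partial>lborel) \<le> ennreal (L \<rho>)"
      using \<rho> R by (simp add: nn_integral_L)
    show "0 \<le> L \<rho>" using L_nonneg[OF \<rho>(1) R] .
  qed (use that in \<open>auto simp: T_def split: split_indicator\<close>)
  have "\<exists>B\<ge>0. \<forall>k \<rho>. admissible k \<longrightarrow> 0 < \<rho> \<longrightarrow> ereal \<rho> \<le> R0 / 2 \<longrightarrow>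
     (\<integral>\<^sup>+h. ennreal (indicator T (norm h) * k h) \<partial>lborel) \<le> ennreal (B * L \<rho>)"
  proof (cases R0)
    case (real q)
    then have q: "0 < q" using R0_pos by simp
    have T: "T = {q..}" using real by (auto simp: T_def)
    have Lq: "0 < L (q / 2)" using q real by (intro L_pos) auto
    define c where "c = min 1 (q\<^sup>2)"
    have c: "0 < c" using q by (simp add: c_def)
    show ?thesis
    proof (intro exI[of _ "K0 / c / L (q / 2)"] conjI allI impI)
      fix k \<rho> assume k: "admissible k" and \<rho>: "0 < \<rho>" "ereal \<rho> \<le> R0 / 2"
      have "L (q / 2) \<le> L \<rho>" using \<rho> real q by (intro L_antimono) auto
      have [measurable]: "k \<in> borel_measurable borel" using k by (rule admissible_measurable)
      have "(\<integral>\<^sup>+h. ennreal (indicator T (norm h) * k h) \<partial>lborel)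
          \<le> (\<integral>\<^sup>+h. ennreal (1 / c) * ennreal (min 1 ((norm h)\<^sup>2) * k h) \<partial>lborel)"
      proof (intro nn_integral_mono)
        fix h
        have "indicator T (norm h) * k h \<le> (1 / c) * (min 1 ((norm h)\<^sup>2) * k h)"
        proof (cases "norm h \<in> T")
          case True
          then have "q\<^sup>2 \<le> (norm h)\<^sup>2" using q T by (intro power_mono) auto
          then have "c \<le> min 1 ((norm h)\<^sup>2)" by (auto simp: c_def)
          then have "c * k h \<le> min 1 ((norm h)\<^sup>2) * k h"
            by (intro mult_right_mono admissible_nonneg[OF k])
          then show ?thesis using True c by (simp add: field_simps)
        qed (use c admissible_nonneg[OF k] in simp)
        then show "ennreal (indicator T (norm h) * k h) \<le> ennreal (1 / c) * ennreal (min 1 ((norm h)\<^sup>2) * k h)"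
          using c admissible_nonneg[OF k] by (simp add: ennreal_mult[symmetric] ennreal_leI)
      qed
      also have "\<dots> = ennreal (1 / c) * (\<integral>\<^sup>+h. ennreal (min 1 ((norm h)\<^sup>2) * k h) \<partial>lborel)"
        by (rule nn_integral_cmult) auto
      also have "\<dots> \<le> ennreal (1 / c) * ennreal K0"
        by (intro mult_left_mono admissible_integral[OF k]) auto
      also have "\<dots> = ennreal (K0 / c)" using c K0 by (simp add: ennreal_mult[symmetric])
      also have "\<dots> \<le> ennreal (K0 / c / L (q / 2) * L \<rho>)"
        using \<open>L (q / 2) \<le> L \<rho>\<close> Lq c K0 by (intro ennreal_leI) (simp add: field_simps)
      finally show "(\<integral>\<^sup>+h. ennreal (indicator T (norm h) * k h) \<partial>lborel) \<le> ennreal (K0 / c / L (q / 2) * L \<rho>)" .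
    qed (use c K0 Lq in auto)
  next
    case PInf
    then have "T = {}" by (auto simp: T_def)
    then show ?thesis by (intro exI[of _ 0]) auto
  qed (use R0_pos in auto)
  then obtain B where B: "B \<ge> 0" and far: "\<And>k \<rho>. admissible k \<Longrightarrow> 0 < \<rho> \<Longrightarrow> ereal \<rho> \<le> R0 / 2 \<Longrightarrow>
     (\<integral>\<^sup>+h. ennreal (indicator T (norm h) * k h) \<partial>lborel) \<le> ennreal (B * L \<rho>)" by blast
  show ?thesis
  proof (intro exI[of _ "\<kappa> * sphere_area TYPE('a) + B"] conjI allI impI)
    show "0 < \<kappa> * sphere_area TYPE('a) + B" using \<kappa> B sphere_area_pos[where 'a='a] by (simp add: add_pos_nonneg)
    fix k \<rho> assume k: "admissible k" and \<rho>: "0 < \<rho>" "ereal \<rho> \<le> R0 / 2"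
    have [measurable]: "k \<in> borel_measurable borel" using k by (rule admissible_measurable)
    have R: "ereal \<rho> < R0" using ereal_mult_less_of_le_half[of \<rho> R0 1] \<rho> by simp
    have "(\<integral>\<^sup>+h. ennreal (indicator {\<rho>..} (norm h) * k h) \<partial>lborel)
      \<le> (\<integral>\<^sup>+h. ennreal ((indicator {\<rho>..} (norm h) * indicator (- T) (norm h)) * k h)
              + ennreal (indicator T (norm h) * k h) \<partial>lborel)"
      by (intro nn_integral_mono) (auto split: split_indicator)
    also have "\<dots> = (\<integral>\<^sup>+h. ennreal ((indicator {\<rho>..} (norm h) * indicator (- T) (norm h)) * k h) \<partial>lborel)
              + (\<integral>\<^sup>+h. ennreal (indicator T (norm h) * k h) \<partial>lborel)"
      by (rule nn_integral_add) auto
    also have "\<dots> \<le> ennreal (\<kappa> * sphere_area TYPE('a) * L \<rho>) + ennreal (B * L \<rho>)"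
      by (intro add_mono near far k \<rho>)
    also have "\<dots> = ennreal ((\<kappa> * sphere_area TYPE('a) + B) * L \<rho>)"
      using \<kappa> B sphere_area_pos[where 'a='a] L_nonneg[OF \<rho>(1) R]
      by (simp add: ennreal_plus[symmetric] algebra_simps del: ennreal_plus)
    finally show "(\<integral>\<^sup>+h. ennreal (indicator {\<rho>..} (norm h) * k h) \<partial>lborel) \<le> ennreal ((\<kappa> * sphere_area TYPE('a) + B) * L \<rho>)" .
  qed
qed

section \<open>The common part of two shifted kernels\<close>

text \<open>The fraction of \<open>radial h\<close> that survives a shift by at most half of
  \<open>norm h\<close>: \<open>cL / 4\<close> and \<open>1 / cU\<close> come from the two scaling
  bounds, the power of 2 from the norm factor or from upper scaling, and \<open>\<kappa>\<close>
  from the lower kernel bound.\<close>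

definition overlap :: real where "overlap = min (cL / 4) (1 / cU) / 2 ^ DIM('a) / \<kappa>"

lemma overlap_pos: "0 < overlap"
  using cL cU \<kappa> by (simp add: overlap_def)

text \<open>The shift changes the norm by at most a factor 2. If the norm grows, lower scaling
  controls \<open>l\<close> and the power of the norm is lost; if it shrinks, upper scaling controls
  \<open>l\<close> and that power helps. Since \<open>2 * norm h\<close> is below \<open>R0\<close>,
  the shifted jump stays where the kernel has its lower bound.\<close>

lemma common_part_le:
  assumes k: "admissible k" and h: "0 < norm h" "ereal (2 * norm h) < R0" and a: "2 * norm a \<le> norm h"
  shows "overlap * radial h \<le> k (h + a)"
proof -
  define s t where "s = norm h" and "t = norm (h + a)"
  have "norm h - norm a \<le> t" "t \<le> norm h + norm a"
    unfolding t_def using norm_triangle_ineq[of h a] norm_diff_ineq[of h a] by auto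
  then have t: "s / 2 \<le> t" "t \<le> 2 * s" using a by (auto simp: s_def)
  have s: "0 < s" "ereal s < R0" using h ereal_less_of_le[of s "2 * s" R0] by (auto simp: s_def)
  have t0: "0 < t" "ereal t < R0"
    using t(1) s(1) ereal_less_of_le[OF t(2)] h(2) by (linarith, simp add: s_def)
  have ls: "0 < l s" "0 < l t" using l_pos s t0 by auto
  have powr2: "(2 * s) powr (- real DIM('a)) = s powr (- real DIM('a)) / 2 ^ DIM('a)"
    using s by (simp add: powr_mult powr_minus powr_realpow field_simps)
  have main: "min (cL / 4) (1 / cU) / 2 ^ DIM('a) * (s powr (- real DIM('a)) * l s) \<le> t powr (- real DIM('a)) * l t"
  proof (cases "s \<le> t")
    case True
    have "(t / s)\<^sup>2 \<le> 2\<^sup>2" using t s t0 by (intro power_mono) (auto simp: field_simps)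
    then have "(t / s)\<^sup>2 / cL * l t \<le> 4 / cL * l t"
      using cL ls by (intro mult_right_mono divide_right_mono) auto
    with l_lower_ratio_square[of s t] s t0 True have "l s \<le> 4 / cL * l t" by linarith
    then have "cL / 4 * l s \<le> l t" using cL by (simp add: field_simps)
    moreover have "min (cL / 4) (1 / cU) * l s \<le> cL / 4 * l s" using ls by (intro mult_right_mono) auto
    ultimately have 1: "min (cL / 4) (1 / cU) * l s \<le> l t" by linarith
    have 2: "s powr (- real DIM('a)) / 2 ^ DIM('a) \<le> t powr (- real DIM('a))"
      unfolding powr2[symmetric] using t t0 by (intro powr_mono2') auto
    have "(s powr (- real DIM('a)) / 2 ^ DIM('a)) * (min (cL / 4) (1 / cU) * l s) \<le> t powr (- real DIM('a)) * l t"
      using 1 2 ls cL cU by (intro mult_mono) auto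
    then show ?thesis by (simp add: mult_ac)
  next
    case False
    have "(s / t) ^ DIM('a) \<le> 2 ^ DIM('a)" using t s t0 by (intro power_mono) (auto simp: field_simps)
    then have "cU * (s / t) ^ DIM('a) * l t \<le> cU * 2 ^ DIM('a) * l t"
      using cU ls by (intro mult_right_mono mult_left_mono) auto
    with l_upper_ratio[of t s] s t0 False have "l s \<le> cU * 2 ^ DIM('a) * l t" by linarith
    then have "1 / cU / 2 ^ DIM('a) * l s \<le> l t" using cU by (simp add: field_simps)
    moreover have "min (cL / 4) (1 / cU) / 2 ^ DIM('a) * l s \<le> 1 / cU / 2 ^ DIM('a) * l s"
      using ls by (intro mult_right_mono divide_right_mono) auto
    ultimately have 1: "min (cL / 4) (1 / cU) / 2 ^ DIM('a) * l s \<le> l t" by linarith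
    have 2: "s powr (- real DIM('a)) \<le> t powr (- real DIM('a))"
      using False t0 by (intro powr_mono2') auto
    have "s powr (- real DIM('a)) * (min (cL / 4) (1 / cU) / 2 ^ DIM('a) * l s) \<le> t powr (- real DIM('a)) * l t"
      using 1 2 ls cL cU by (intro mult_mono) auto
    then show ?thesis by (simp add: mult_ac)
  qed
  have "overlap * radial h = (min (cL / 4) (1 / cU) / 2 ^ DIM('a) * (s powr (- real DIM('a)) * l s)) / \<kappa>"
    using s by (simp add: overlap_def radial_eq s_def)
  also have "\<dots> \<le> (t powr (- real DIM('a)) * l t) / \<kappa>"
    using main \<kappa> by (intro divide_right_mono) auto
  also have "\<dots> = radial (h + a) / \<kappa>" using t0 by (simp add: radial_eq t_def)
  also have "\<dots> \<le> k (h + a)" using t0 by (intro admissible_lower[OF k]) (auto simp: t_def)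
  finally show ?thesis .
qed

lemma nn_integral_common_part:
  assumes "0 < \<delta>" "\<delta> \<le> \<rho>" "ereal \<rho> < R0"
  shows "(\<integral>\<^sup>+h. ennreal (overlap * radial h * indicator {\<delta><..\<rho>} (norm h)) \<partial>lborel) = ennreal (overlap * sphere_area TYPE('a) * (L \<delta> - L \<rho>))"
proof -
  have "(\<integral>\<^sup>+h. ennreal (overlap * radial h * indicator {\<delta><..\<rho>} (norm h)) \<partial>lborel)
      = (\<integral>\<^sup>+h. ennreal ((\<lambda>s. overlap * indicator {\<delta><..\<rho>} s) (norm h) * radial h) \<partial>lborel)"
    by (simp add: mult_ac)
  also have "\<dots> = ennreal (sphere_area TYPE('a)) * (\<integral>\<^sup>+s. ennreal (overlap * indicator {\<delta><..\<rho>} s * w s) \<partial>lborel)"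
    using overlap_pos by (intro nn_integral_radial) auto
  also have "(\<integral>\<^sup>+s. ennreal (overlap * indicator {\<delta><..\<rho>} s * w s) \<partial>lborel)
      = (\<integral>\<^sup>+s. ennreal overlap * ennreal (w s * indicator {\<delta><..\<rho>} s) \<partial>lborel)"
    using overlap_pos w_nonneg by (intro nn_integral_cong) (simp add: ennreal_mult[symmetric] mult_ac)
  also have "\<dots> = ennreal overlap * ennreal (L \<delta> - L \<rho>)"
    using assms by (subst nn_integral_cmult) (auto simp: nn_integral_L_diff)
  finally show ?thesis
    using overlap_pos L_antimono[OF assms] sphere_area_pos[where 'a='a]
    by (simp add: ennreal_mult[symmetric] mult_ac less_imp_le)
qed

lemma admissible_integrable:
  assumes "admissible k"
  shows "integrable lborel (\<lambda>h. min 1 ((norm h)\<^sup>2) * k h)"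
    and "(LINT h|lborel. min 1 ((norm h)\<^sup>2) * k h) \<le> K0"
proof -
  have [measurable]: "k \<in> borel_measurable borel" using assms by (rule admissible_measurable)
  have nonneg: "0 \<le> min 1 ((norm h)\<^sup>2) * k h" for h
    using admissible_nonneg[OF assms] by simp
  show int: "integrable lborel (\<lambda>h. min 1 ((norm h)\<^sup>2) * k h)"
    using nonneg le_less_trans[OF admissible_integral[OF assms] ennreal_less_top]
    by (intro integrableI_nonneg) auto
  have "ennreal (LINT h|lborel. min 1 ((norm h)\<^sup>2) * k h) \<le> ennreal K0"
    using admissible_integral[OF assms] nonneg
    by (subst nn_integral_eq_integral[symmetric]) (auto simp: int)
  then show "(LINT h|lborel. min 1 ((norm h)\<^sup>2) * k h) \<le> K0"
    using K0 by simp
qed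

text \<open>Allows the cut-off radius 1 of the gradient term to be replaced by any
  \<open>\<rho>\<close>: the integrand is supported away from 0, hence integrable, and odd because
  \<open>k\<close> is symmetric.\<close>

lemma admissible_annulus:
  assumes k: "admissible k" and \<rho>: "0 < \<rho>"
  shows "integrable lborel (\<lambda>h. v \<bullet> h * (indicator (ball 0 1) h - indicator (ball 0 \<rho>) h) * k h)" (is "integrable _ ?f")
    and "(LINT h|lborel. v \<bullet> h * (indicator (ball 0 1) h - indicator (ball 0 \<rho>) h) * k h) = 0"
proof -
  have [measurable]: "k \<in> borel_measurable borel" using k by (rule admissible_measurable)
  define c where "c = norm v * max 1 \<rho> / min 1 (\<rho>\<^sup>2)"
  have "\<bar>?f h\<bar> \<le> c * (min 1 ((norm h)\<^sup>2) * k h)" for h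
  proof (cases "min 1 \<rho> \<le> norm h \<and> norm h < max 1 \<rho>")
    case True
    have "min 1 (\<rho>\<^sup>2) \<le> min 1 ((norm h)\<^sup>2)"
    proof (cases "1 \<le> norm h")
      case False
      then have "\<rho>\<^sup>2 \<le> (norm h)\<^sup>2" using True \<rho> by (intro power_mono) auto
      then show ?thesis by auto
    qed (simp add: one_le_power min.coboundedI1)
    then have q: "1 \<le> min 1 ((norm h)\<^sup>2) / min 1 (\<rho>\<^sup>2)" using \<rho> by (simp add: field_simps)
    have "\<bar>v \<bullet> h * (indicator (ball 0 1) h - indicator (ball 0 \<rho>) h)\<bar> \<le> \<bar>v \<bullet> h\<bar>"
      by (auto simp: abs_mult split: split_indicator)
    also have "\<dots> \<le> norm v * norm h" by (rule Cauchy_Schwarz_ineq2)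
    also have "\<dots> \<le> norm v * max 1 \<rho> * 1"
      using True by (simp add: mult_left_mono)
    also have "\<dots> \<le> norm v * max 1 \<rho> * (min 1 ((norm h)\<^sup>2) / min 1 (\<rho>\<^sup>2))"
      using q by (intro mult_left_mono) auto
    also have "\<dots> = c * min 1 ((norm h)\<^sup>2)" by (simp add: c_def)
    finally have "\<bar>v \<bullet> h * (indicator (ball 0 1) h - indicator (ball 0 \<rho>) h)\<bar> * k h \<le> c * min 1 ((norm h)\<^sup>2) * k h"
      by (intro mult_right_mono admissible_nonneg[OF k])
    then show ?thesis using admissible_nonneg[OF k, of h] by (simp add: abs_mult mult.assoc)
  next
    case False
    then have "?f h = 0" by (auto split: split_indicator)
    then have "\<bar>?f h\<bar> = 0" by (simp only: abs_zero)
    also have "\<dots> \<le> c * (min 1 ((norm h)\<^sup>2) * k h)"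
      using admissible_nonneg[OF k, of h] \<rho> by (simp add: c_def)
    finally show ?thesis .
  qed
  then show "integrable lborel ?f"
    by (intro Bochner_Integration.integrable_bound[OF integrable_mult_right[OF admissible_integrable(1)[OF k], of c]])
       (auto intro!: AE_I2 intro: order_trans[OF _ abs_ge_self])
  show "integral\<^sup>L lborel ?f = 0"
    by (rule integral_lborel_odd) (auto simp: admissible_sym[OF k] indicator_def)
qed

text \<open>Applied once to the increment of \<open>u\<close> at one point and once to that of
  \<open>- u\<close> at the other; \<open>p\<close> comes from the penalty, \<open>q\<close> from
  the localisation. A majorant \<open>Q\<close> of the compensated increment \<open>G\<close> has
  integral at most \<open>B\<close> against \<open>k\<close>, while the equation bounds the integral
  of \<open>G\<close> below by \<open>- F\<close>. So the slack \<open>Q - G\<close> has integral at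
  most \<open>F + B\<close>. The slack is nonnegative, and the bound persists for any density
  \<open>m\<close> below \<open>k\<close>.\<close>

lemma one_point_inequality:
  fixes g m :: "'a \<Rightarrow> real" and p q :: 'a and A N E U F \<delta> \<rho> CL CS CM :: real
  defines "T \<equiv> \<lambda>h. E * sqrt (L \<delta> / L (norm h)) + q \<bullet> h + N * (norm h)\<^sup>2 - g h"
  assumes k: "admissible k" and \<delta>: "0 < \<delta>" and \<rho>: "\<delta> < \<rho>" "ereal \<rho> \<le> R0 / 2"
    and nonneg: "0 \<le> A" "0 \<le> N" "0 \<le> E" "0 \<le> U"
    and g_meas [measurable]: "g \<in> borel_measurable borel"
    and small: "\<And>h. norm h < \<delta> \<Longrightarrow> g h \<le> (p + q) \<bullet> h + (A + N) * (norm h)\<^sup>2"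
    and medium: "\<And>h. \<delta> \<le> norm h \<Longrightarrow> norm h < \<rho> \<Longrightarrow>
      g h \<le> q \<bullet> h + N * (norm h)\<^sup>2 + E * sqrt (L \<delta> / L (norm h))"
    and large: "\<And>h. g h \<le> 2 * U"
    and int: "integrable lborel (\<lambda>h. (g h - (p + q) \<bullet> h * indicator (ball 0 1) h) * k h)"
    and ge: "- F \<le> (LINT h|lborel. (g h - (p + q) \<bullet> h * indicator (ball 0 1) h) * k h)"
    and CL: "(\<integral>\<^sup>+h. ennreal (indicator {\<rho>..} (norm h) * k h) \<partial>lborel) \<le> ennreal (CL * L \<rho>)" "0 \<le> CL"
    and CS: "CS = \<kappa> * sphere_area TYPE('a) * (16 / (cL\<^sup>2 * (2 - \<gamma>)))"
    and CM: "CM = \<kappa> * sphere_area TYPE('a) * 4"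
    and m_meas [measurable]: "m \<in> borel_measurable borel" and m: "\<And>h. 0 \<le> m h" "\<And>h. m h \<le> k h"
    and m_supp: "\<And>h. m h \<noteq> 0 \<Longrightarrow> \<delta> \<le> norm h \<and> norm h < \<rho>"
  shows "integrable lborel (\<lambda>h. T h * m h) \<and>
    (LINT h|lborel. T h * m h) \<le> F + (A * CS * \<delta>\<^sup>2 * L \<delta> + N * CS * \<rho>\<^sup>2 * L \<rho> + E * CM * L \<delta> + 2 * U * CL * L \<rho>)"
proof -
  have [measurable]: "k \<in> borel_measurable borel" using k by (rule admissible_measurable)
  have k0: "0 \<le> k h" for h using k by (rule admissible_nonneg)
  have \<rho>0: "0 < \<rho>" using \<delta> \<rho> by simp
  have R\<rho>: "ereal \<rho> < R0" using ereal_mult_less_of_le_half[of \<rho> R0 1] \<rho> \<rho>0 by simp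
  have \<delta>2: "ereal \<delta> \<le> R0 / 2" using \<rho> order_trans[of "ereal \<delta>" "ereal \<rho>"] by simp
  have R\<delta>: "ereal \<delta> < R0" using ereal_mult_less_of_le_half[of \<delta> R0 1] \<delta> \<delta>2 by simp
  have L0: "0 \<le> L \<delta>" "0 \<le> L \<rho>" using \<delta> \<rho>0 R\<rho> R\<delta> L_nonneg by auto
  have CS0: "0 \<le> CS" and CM0: "0 \<le> CM"
    using \<kappa> cL \<gamma> sphere_area_pos[where 'a='a] by (auto simp: CS CM)
  define Lx where "Lx s = indicator (einterval 0 R0) s * L s" for s
  have [measurable]: "Lx \<in> borel_measurable borel" unfolding Lx_def by measurable
  have Lx: "Lx s = L s" if "s \<in> {\<delta>..<\<rho>}" for s
    using that \<delta> R\<rho> ereal_less_of_le[of s \<rho> R0] by (auto simp: Lx_def einterval_def)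
  have sqrt0: "0 \<le> sqrt (L \<delta> / L s)" if "s \<in> {\<delta>..<\<rho>}" for s
    using that \<delta> R\<rho> L0 L_nonneg[of s] ereal_less_of_le[of s \<rho> R0] by auto
  \<comment> \<open>The two gradient parts are cut off at different radii: \<open>p\<close> at
    \<open>\<delta>\<close>, where the bound with frozen scale ends, and \<open>q\<close> at
    \<open>\<rho>\<close>, where the localisation bound is given up. Neither change alters the
    integral.\<close>
  define G where "G h = g h - p \<bullet> h * indicator (ball 0 \<delta>) h - q \<bullet> h * indicator (ball 0 \<rho>) h" for h
  define Q where "Q h = A * ((norm h)\<^sup>2 * indicator {..<\<delta>} (norm h)) + N * ((norm h)\<^sup>2 * indicator {..<\<rho>} (norm h))
     + E * (sqrt (L \<delta> / Lx (norm h)) * indicator {\<delta>..<\<rho>} (norm h)) + 2 * U * indicator {\<rho>..} (norm h)" for h :: 'a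
  have [measurable]: "G \<in> borel_measurable borel" "Q \<in> borel_measurable borel"
    unfolding G_def Q_def by measurable
  have GQ: "G h \<le> Q h" for h
  proof -
    consider "norm h < \<delta>" | "\<delta> \<le> norm h" "norm h < \<rho>" | "\<rho> \<le> norm h" by linarith
    then show ?thesis
    proof cases
      case 1
      then show ?thesis using small[of h] \<rho> by (simp add: G_def Q_def inner_add_left algebra_simps)
    next
      case 2
      then show ?thesis using medium[of h] by (simp add: G_def Q_def Lx)
    next
      case 3
      then show ?thesis using large[of h] \<rho> by (simp add: G_def Q_def)
    qed
  qed
  have eqG: "G h * k h = (g h - (p + q) \<bullet> h * indicator (ball 0 1) h) * k h
      + (p \<bullet> h * (indicator (ball 0 1) h - indicator (ball 0 \<delta>) h) * k h
       + q \<bullet> h * (indicator (ball 0 1) h - indicator (ball 0 \<rho>) h) * k h)" for h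
    by (simp add: G_def inner_add_left algebra_simps)
  have intG: "integrable lborel (\<lambda>h. G h * k h)"
    unfolding eqG by (intro Bochner_Integration.integrable_add int admissible_annulus(1)[OF k] \<delta> \<rho>0)
  have "(LINT h|lborel. G h * k h) = (LINT h|lborel. (g h - (p + q) \<bullet> h * indicator (ball 0 1) h) * k h) + (0 + 0)"
    unfolding eqG
    by (subst Bochner_Integration.integral_add Bochner_Integration.integral_add
          | intro Bochner_Integration.integrable_add int admissible_annulus(1)[OF k] \<delta> \<rho>0
          | simp only: admissible_annulus(2)[OF k \<delta>] admissible_annulus(2)[OF k \<rho>0])+
  with ge have geG: "- F \<le> (LINT h|lborel. G h * k h)" by simp
  define B where "B = A * CS * \<delta>\<^sup>2 * L \<delta> + N * CS * \<rho>\<^sup>2 * L \<rho> + E * CM * L \<delta> + 2 * U * CL * L \<rho>"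
  have B0: "0 \<le> B" using nonneg CS0 CM0 CL(2) L0 by (simp add: B_def)
  have sqrtx: "0 \<le> sqrt (L \<delta> / Lx (norm h)) * indicator {\<delta>..<\<rho>} (norm h)" for h :: 'a
    using sqrt0[of "norm h"] Lx[of "norm h"] by (auto split: split_indicator)
  have Q0: "0 \<le> Q h" for h
    using nonneg sqrtx[of h] by (simp add: Q_def)
  have nnQ: "(\<integral>\<^sup>+h. ennreal (Q h * k h) \<partial>lborel) \<le> ennreal B"
  proof -
    have "(\<integral>\<^sup>+h. ennreal (Q h * k h) \<partial>lborel) =
       (\<integral>\<^sup>+h. ennreal A * ennreal ((norm h)\<^sup>2 * indicator {..<\<delta>} (norm h) * k h)
         + ennreal N * ennreal ((norm h)\<^sup>2 * indicator {..<\<rho>} (norm h) * k h)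
         + ennreal E * ennreal (sqrt (L \<delta> / Lx (norm h)) * indicator {\<delta>..<\<rho>} (norm h) * k h)
         + ennreal (2 * U) * ennreal (indicator {\<rho>..} (norm h) * k h) \<partial>lborel)"
    proof (intro nn_integral_cong)
      fix h
      show "ennreal (Q h * k h) = ennreal A * ennreal ((norm h)\<^sup>2 * indicator {..<\<delta>} (norm h) * k h)
         + ennreal N * ennreal ((norm h)\<^sup>2 * indicator {..<\<rho>} (norm h) * k h)
         + ennreal E * ennreal (sqrt (L \<delta> / Lx (norm h)) * indicator {\<delta>..<\<rho>} (norm h) * k h)
         + ennreal (2 * U) * ennreal (indicator {\<rho>..} (norm h) * k h)"
        using nonneg k0[of h] sqrtx[of h]
        by (simp add: Q_def ennreal_mult[symmetric] ennreal_plus[symmetric] algebra_simps del: ennreal_plus)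
    qed
    also have "\<dots> = ennreal A * (\<integral>\<^sup>+h. ennreal ((norm h)\<^sup>2 * indicator {..<\<delta>} (norm h) * k h) \<partial>lborel)
         + ennreal N * (\<integral>\<^sup>+h. ennreal ((norm h)\<^sup>2 * indicator {..<\<rho>} (norm h) * k h) \<partial>lborel)
         + ennreal E * (\<integral>\<^sup>+h. ennreal (sqrt (L \<delta> / Lx (norm h)) * indicator {\<delta>..<\<rho>} (norm h) * k h) \<partial>lborel)
         + ennreal (2 * U) * (\<integral>\<^sup>+h. ennreal (indicator {\<rho>..} (norm h) * k h) \<partial>lborel)"
      by (simp add: nn_integral_add nn_integral_cmult)
    also have "(\<lambda>h. sqrt (L \<delta> / Lx (norm h)) * indicator {\<delta>..<\<rho>} (norm h) * k h)
        = (\<lambda>h. sqrt (L \<delta> / L (norm h)) * indicator {\<delta>..<\<rho>} (norm h) * k h)"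
      using Lx by (auto simp: fun_eq_iff split: split_indicator)
    also have "ennreal A * (\<integral>\<^sup>+h. ennreal ((norm h)\<^sup>2 * indicator {..<\<delta>} (norm h) * k h) \<partial>lborel)
         + ennreal N * (\<integral>\<^sup>+h. ennreal ((norm h)\<^sup>2 * indicator {..<\<rho>} (norm h) * k h) \<partial>lborel)
         + ennreal E * (\<integral>\<^sup>+h. ennreal (sqrt (L \<delta> / L (norm h)) * indicator {\<delta>..<\<rho>} (norm h) * k h) \<partial>lborel)
         + ennreal (2 * U) * (\<integral>\<^sup>+h. ennreal (indicator {\<rho>..} (norm h) * k h) \<partial>lborel)
       \<le> ennreal A * ennreal (\<kappa> * sphere_area TYPE('a) * (16 / (cL\<^sup>2 * (2 - \<gamma>)) * \<delta>\<^sup>2 * L \<delta>))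
         + ennreal N * ennreal (\<kappa> * sphere_area TYPE('a) * (16 / (cL\<^sup>2 * (2 - \<gamma>)) * \<rho>\<^sup>2 * L \<rho>))
         + ennreal E * ennreal (\<kappa> * sphere_area TYPE('a) * (4 * L \<delta>))
         + ennreal (2 * U) * ennreal (CL * L \<rho>)"
      by (intro add_mono mult_left_mono small_jumps medium_jumps CL k \<delta> \<rho> \<delta>2 \<rho>0 R\<rho>) auto
    also have "\<dots> = ennreal A * ennreal (CS * \<delta>\<^sup>2 * L \<delta>) + ennreal N * ennreal (CS * \<rho>\<^sup>2 * L \<rho>)
         + ennreal E * ennreal (CM * L \<delta>) + ennreal (2 * U) * ennreal (CL * L \<rho>)"
      by (simp add: CS CM mult_ac)
    also have "\<dots> = ennreal B"
      using nonneg CS0 CM0 CL(2) L0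
      by (simp add: B_def ennreal_mult[symmetric] ennreal_plus[symmetric] mult_ac del: ennreal_plus)
    finally show ?thesis .
  qed
  have intQ: "integrable lborel (\<lambda>h. Q h * k h)"
    using Q0 k0 le_less_trans[OF nnQ ennreal_less_top] by (intro integrableI_nonneg) auto
  have "ennreal (LINT h|lborel. Q h * k h) \<le> ennreal B"
    using nnQ Q0 k0 by (subst nn_integral_eq_integral[symmetric]) (auto simp: intQ)
  then have leQ: "(LINT h|lborel. Q h * k h) \<le> B" using B0 by simp
  have intQG: "integrable lborel (\<lambda>h. (Q h - G h) * k h)"
    using Bochner_Integration.integrable_diff[OF intQ intG] by (simp add: left_diff_distrib)
  \<comment> \<open>Between \<open>\<delta>\<close> and \<open>\<rho>\<close>, where
    \<open>m\<close> lives, only the two middle terms of \<open>Q\<close> and the \<open>q\<close>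
    part of \<open>G\<close> remain.\<close>
  have T: "T h * m h = (Q h - G h) * m h" for h
  proof (cases "m h = 0")
    case False
    then show ?thesis using m_supp[of h] Lx[of "norm h"] by (simp add: T_def Q_def G_def algebra_simps)
  qed simp
  have intT: "integrable lborel (\<lambda>h. T h * m h)"
    unfolding T
  proof (rule Bochner_Integration.integrable_bound[OF intQG])
    show "AE h in lborel. norm ((Q h - G h) * m h) \<le> norm ((Q h - G h) * k h)"
      using GQ m k0 by (intro AE_I2) (simp add: abs_mult mult_left_mono)
  qed measurable
  have "(LINT h|lborel. T h * m h) \<le> (LINT h|lborel. (Q h - G h) * k h)"
  proof (rule integral_mono[OF intT intQG])
    show "T h * m h \<le> (Q h - G h) * k h" for h
      unfolding T using GQ m by (intro mult_left_mono) auto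
  qed
  also have "\<dots> = (LINT h|lborel. Q h * k h) - (LINT h|lborel. G h * k h)"
    using Bochner_Integration.integral_diff[OF intQ intG] by (simp add: left_diff_distrib)
  also have "\<dots> \<le> F + B" using leQ geG by simp
  finally show ?thesis using intT by (simp add: B_def)
qed

end

section \<open>Bounded functions with two derivatives, and the equation at every point\<close>

lemma AE_lebesgue_on_ex_in_open:
  fixes S V :: "'a::euclidean_space set"
  assumes "AE x in lebesgue_on S. P x" "S \<in> sets lebesgue" "open V" "V \<noteq> {}" "V \<subseteq> S"
  shows "\<exists>x\<in>V. P x"
proof (rule ccontr)
  assume *: "\<not> (\<exists>x\<in>V. P x)"
  have "AE x in lebesgue. x \<in> S \<longrightarrow> P x"
    using assms(1,2) by (subst (asm) AE_restrict_space_iff) auto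
  then have "AE x in lebesgue. x \<notin> V"
    by eventually_elim (use * assms(5) in auto)
  then have "V \<in> null_sets lebesgue"
    using assms(3) by (subst AE_iff_null_sets) (auto intro!: borel_open)
  then have "negligible V" by (simp add: negligible_iff_null_sets)
  then show False using open_not_negligible assms(3,4) by blast
qed

locale bounded_C2 =
  fixes u :: "'a::euclidean_space \<Rightarrow> real" and G :: "'a \<Rightarrow> 'a" and H :: "'a \<Rightarrow> 'a \<Rightarrow>\<^sub>L 'a"
  assumes u_bcont: "u \<in> bcontfun" and u_deriv: "\<And>x. GDERIV u x :> G x"
    and G_deriv: "\<And>x. (G has_derivative blinfun_apply (H x)) (at x)"
    and G_bcont: "G \<in> bcontfun" and H_bcont: "H \<in> bcontfun"
begin

lemma u_continuous: "continuous_on S u"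
  using u_bcont continuous_on_subset by (auto simp: bcontfun_def)

lemma u_measurable [measurable]: "u \<in> borel_measurable borel"
  by (intro borel_measurable_continuous_onI u_continuous)

definition taylor :: "'a \<Rightarrow> 'a \<Rightarrow> real" where
  "taylor x h = u (x + h) - u x - (G x \<bullet> h) * indicator (ball 0 1) h"

lemma taylor_measurable [measurable]: "taylor x \<in> borel_measurable borel"
  unfolding taylor_def by measurable

lemma shift_deriv:
  "GDERIV (\<lambda>z. u (x + z)) z :> G (x + z)"
  "((\<lambda>z. G (x + z)) has_derivative blinfun_apply (H (x + z))) (at z)"
proof -
  have "((\<lambda>z. x + z) has_derivative (\<lambda>h. h)) (at z)" by (auto intro!: derivative_eq_intros)
  then show "GDERIV (\<lambda>z. u (x + z)) z :> G (x + z)"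
    "((\<lambda>z. G (x + z)) has_derivative blinfun_apply (H (x + z))) (at z)"
    using has_derivative_compose[of "\<lambda>z. x + z" "\<lambda>h. h" z UNIV u] u_deriv[of "x + z"]
      has_derivative_compose[of "\<lambda>z. x + z" "\<lambda>h. h" z UNIV G] G_deriv[of "x + z"]
    by (auto simp: gderiv_def)
qed

lemma taylor_bound: "\<exists>C\<ge>0. \<forall>x h. \<bar>taylor x h\<bar> \<le> C * min 1 ((norm h)\<^sup>2)"
proof -
  obtain b1 where b1: "\<And>x. \<bar>u x\<bar> \<le> b1"
    using u_bcont by (auto simp: bcontfun_def bounded_iff)
  obtain b2 where b2: "\<And>x. norm (H x) \<le> b2"
    using H_bcont by (auto simp: bcontfun_def bounded_iff)
  have b0: "0 \<le> b1" "0 \<le> b2"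
    using b1[of 0] b2[of 0] by (auto intro: order_trans[OF abs_ge_zero] order_trans[OF norm_ge_zero])
  show ?thesis
  proof (intro exI[of _ "2 * b1 + b2"] conjI allI)
    fix x h :: 'a
    show "\<bar>taylor x h\<bar> \<le> (2 * b1 + b2) * min 1 ((norm h)\<^sup>2)"
    proof (cases "norm h < 1")
      case True
      have "\<bar>u (x + h) - u (x + 0) - G (x + 0) \<bullet> h\<bar> \<le> b2 * (norm h)\<^sup>2"
        using True by (intro second_order_bound[where r = 1, OF shift_deriv]) (auto simp: b2)
      then have "\<bar>taylor x h\<bar> \<le> b2 * (norm h)\<^sup>2" using True by (simp add: taylor_def)
      also have "\<dots> \<le> (2 * b1 + b2) * (norm h)\<^sup>2" using b0 by (intro mult_right_mono) auto
      finally show ?thesis using True by (simp add: min_absorb2 power_le_one)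
    next
      case False
      then have "min 1 ((norm h)\<^sup>2) = 1" by (simp add: min_absorb1 one_le_power)
      then show ?thesis using b1[of "x + h"] b1[of x] b0 False by (simp add: taylor_def)
    qed
  qed (use b0 in auto)
qed

text \<open>The weight \<open>min 1 ((norm h)\<^sup>2)\<close> is the one that all admissible
  kernels integrate uniformly. For \<open>norm h < 1\<close> the bound comes from uniform continuity
  of the second derivative on a compact ball, for longer \<open>h\<close> from the Lipschitz bound
  on \<open>u\<close>.\<close>

lemma taylor_continuous:
  assumes "0 < e"
  shows "\<exists>d>0. \<forall>x'. dist x' x < d \<longrightarrow> (\<forall>h. \<bar>taylor x' h - taylor x h\<bar> \<le> e * min 1 ((norm h)\<^sup>2))"
proof -
  obtain b where b: "\<And>x. norm (G x) \<le> b"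
    using G_bcont by (auto simp: bcontfun_def bounded_iff)
  have b0: "0 \<le> b" using b[of 0] by (auto intro: order_trans[OF norm_ge_zero])
  have lip: "\<bar>u y - u z\<bar> \<le> b * dist y z" for y z
  proof -
    have "norm (u y - u z) \<le> b * norm (y - z)"
    proof (rule differentiable_bound[where S = UNIV and f' = "\<lambda>x h. h \<bullet> G x"])
      show "(u has_derivative (\<lambda>h. h \<bullet> G x)) (at x within UNIV)" for x
        using u_deriv[of x] by (simp add: gderiv_def)
      show "onorm (\<lambda>h. h \<bullet> G x) \<le> b" for x
      proof (rule onorm_le)
        fix h
        have "norm (h \<bullet> G x) \<le> norm h * norm (G x)"
          by (rule Cauchy_Schwarz_ineq2[unfolded real_norm_def[symmetric]])
        also have "\<dots> \<le> norm h * b" by (intro mult_left_mono b) auto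
        finally show "norm (h \<bullet> G x) \<le> b * norm h" by (simp add: mult_ac)
      qed
    qed auto
    then show ?thesis by (simp add: dist_norm)
  qed
  \<comment> \<open>Radius 2 contains \<open>x + z\<close> and \<open>x' + z\<close> for
    \<open>z\<close> in the unit ball and \<open>x'\<close> within distance 1 of
    \<open>x\<close>.\<close>
  have "uniformly_continuous_on (cball x 2) H"
    using H_bcont by (intro compact_uniformly_continuous) (auto simp: bcontfun_def intro: continuous_on_subset)
  then obtain d0 where d0: "d0 > 0"
    and uc: "\<And>y z. y \<in> cball x 2 \<Longrightarrow> z \<in> cball x 2 \<Longrightarrow> dist y z < d0 \<Longrightarrow> dist (H y) (H z) < e"
    unfolding uniformly_continuous_on_def using assms by metis
  define d where "d = min (min d0 1) (e / (2 * (b + 1)))"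
  have d: "0 < d" "d \<le> d0" "d \<le> 1" using d0 assms b0 by (auto simp: d_def)
  have bd: "2 * b * d \<le> e"
  proof -
    have "2 * b * d \<le> 2 * b * (e / (2 * (b + 1)))" using b0 by (intro mult_left_mono) (auto simp: d_def)
    also have "\<dots> \<le> e" using b0 assms by (simp add: field_simps)
    finally show ?thesis .
  qed
  show ?thesis
  proof (intro exI[of _ d] conjI d allI impI)
    fix x' h assume x': "dist x' x < d"
    show "\<bar>taylor x' h - taylor x h\<bar> \<le> e * min 1 ((norm h)\<^sup>2)"
    proof (cases "norm h < 1")
      case True
      have v: "GDERIV (\<lambda>z. u (x' + z) - u (x + z)) z :> G (x' + z) - G (x + z)" for z
        using GDERIV_diff[OF shift_deriv(1) shift_deriv(1)] .
      have g: "((\<lambda>z. G (x' + z) - G (x + z)) has_derivative blinfun_apply (H (x' + z) - H (x + z))) (at z)" for z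
        using has_derivative_diff[OF shift_deriv(2) shift_deriv(2)]
        by (simp add: blinfun.diff_left[abs_def] fun_diff_def)
      have "\<bar>(u (x' + h) - u (x + h)) - (u (x' + 0) - u (x + 0)) - (G (x' + 0) - G (x + 0)) \<bullet> h\<bar> \<le> e * (norm h)\<^sup>2"
      proof (rule second_order_bound[where r = 1, OF v g])
        fix z :: 'a assume z: "z \<in> ball 0 1"
        have "dist (H (x' + z)) (H (x + z)) < e"
        proof (rule uc)
          have "dist x (x' + z) \<le> norm (x - x') + norm z"
            unfolding dist_norm using norm_triangle_ineq4[of "x - x'" z] by (simp add: algebra_simps)
          then show "x' + z \<in> cball x 2" using z x' d by (simp add: dist_norm norm_minus_commute)
          show "x + z \<in> cball x 2" using z by (simp add: dist_norm)
          show "dist (x' + z) (x + z) < d0" using x' d by simp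
        qed
        then show "norm (H (x' + z) - H (x + z)) \<le> e" by (simp add: dist_norm)
      qed (use True in auto)
      then have "\<bar>taylor x' h - taylor x h\<bar> \<le> e * (norm h)\<^sup>2"
        using True by (simp add: taylor_def algebra_simps)
      then show ?thesis using True by (simp add: min_absorb2 power_le_one)
    next
      case False
      then have 1: "min 1 ((norm h)\<^sup>2) = 1" by (simp add: min_absorb1 one_le_power)
      have "\<bar>taylor x' h - taylor x h\<bar> \<le> \<bar>u (x' + h) - u (x + h)\<bar> + \<bar>u x' - u x\<bar>"
        using False by (simp add: taylor_def)
      also have "\<dots> \<le> b * dist x' x + b * dist x' x"
        using lip[of "x' + h" "x + h"] lip[of x' x] by simp
      also have "\<dots> \<le> 2 * b * d" using mult_left_mono[OF less_imp_le[OF x'] b0] by simp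
      finally show ?thesis using bd 1 by simp
    qed
  qed
qed

end

text \<open>Since the coefficients are merely measurable in \<open>x\<close>, the equation holds only almost everywhere;
  at an exceptional point it is replaced by an approximate equation with the kernel of a nearby point.\<close>

lemma (in nonlocal_kernel) equation_at_every_point:
  assumes u: "u \<in> Cb2" and eq: "AE x in lebesgue_on (ball 0 r). nonlocal_op K u x = f x"
    and f: "AE x in lebesgue_on (ball 0 r). \<bar>f x\<bar> \<le> F0" and F: "F0 < F" and x: "x \<in> ball 0 r"
  shows "\<exists>k. admissible k \<and>
    integrable lborel (\<lambda>h. (u (x + h) - u x - gradient u x \<bullet> h * indicator (ball 0 1) h) * k h) \<and>
    \<bar>LINT h|lborel. (u (x + h) - u x - gradient u x \<bullet> h * indicator (ball 0 1) h) * k h\<bar> \<le> F"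
proof -
  obtain G H where "bounded_C2 u G H"
    using u unfolding Cb2_def bounded_C2_def by auto
  then interpret bounded_C2 u G H .
  have grad: "gradient u y = G y" for y by (rule gradient_eq[OF u_deriv])
  obtain C where C: "\<And>x h. \<bar>taylor x h\<bar> \<le> C * min 1 ((norm h)\<^sup>2)" using taylor_bound by blast
  have int: "integrable lborel (\<lambda>h. taylor y h * k h)" if k: "admissible k" for y k
  proof -
    have [measurable]: "k \<in> borel_measurable borel" using k by (rule admissible_measurable)
    show ?thesis
    proof (rule Bochner_Integration.integrable_bound[OF integrable_mult_right[OF admissible_integrable(1)[OF k], of C]])
      show "AE h in lborel. norm (taylor y h * k h) \<le> norm (C * (min 1 ((norm h)\<^sup>2) * k h))"
      proof (intro AE_I2)
        fix h
        have "norm (taylor y h * k h) = \<bar>taylor y h\<bar> * k h" using admissible_nonneg[OF k] by (simp add: abs_mult)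
        also have "\<dots> \<le> C * min 1 ((norm h)\<^sup>2) * k h" by (intro mult_right_mono C admissible_nonneg[OF k])
        finally show "norm (taylor y h * k h) \<le> norm (C * (min 1 ((norm h)\<^sup>2) * k h))" by (simp add: mult.assoc)
      qed
    qed measurable
  qed
  \<comment> \<open>The weight has integral at most \<open>K0\<close> against an admissible kernel,
    so changing the base point costs at most \<open>e * K0\<close>, the gap between
    \<open>F0\<close> and \<open>F\<close>.\<close>
  define e where "e = (F - F0) / K0"
  have e: "0 < e" using F K0 by (simp add: e_def)
  obtain d where d: "d > 0" and near: "\<And>x' h. dist x' x < d \<Longrightarrow> \<bar>taylor x' h - taylor x h\<bar> \<le> e * min 1 ((norm h)\<^sup>2)"
    using taylor_continuous[OF e, of x] by blast
  have "x \<in> ball x d \<inter> ball 0 r" using x d by simp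
  then have "ball x d \<inter> ball 0 r \<noteq> {}" by blast
  then have "\<exists>x'\<in>ball x d \<inter> ball 0 r. nonlocal_op K u x' = f x' \<and> \<bar>f x'\<bar> \<le> F0"
    by (intro AE_lebesgue_on_ex_in_open[where S = "ball 0 r"] AE_conjI eq f) auto
  then obtain x' where x': "dist x' x < d" "nonlocal_op K u x' = f x'" "\<bar>f x'\<bar> \<le> F0"
    by (auto simp: dist_commute)
  define k where "k h = indicator (- {0}) h * K x' h" for h
  have k: "admissible k" unfolding k_def by (rule admissible_K)
  have [measurable]: "k \<in> borel_measurable borel" using k by (rule admissible_measurable)
  have "f x' = (LINT h|lborel. taylor x' h * k h)"
    unfolding x'(2)[symmetric] nonlocal_op_def set_lebesgue_integral_def grad
    by (intro Bochner_Integration.integral_cong) (auto simp: taylor_def k_def)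
  moreover have "\<bar>(LINT h|lborel. taylor x' h * k h) - (LINT h|lborel. taylor x h * k h)\<bar> \<le> F - F0"
  proof -
    have "(LINT h|lborel. taylor x' h * k h) - (LINT h|lborel. taylor x h * k h)
        = (LINT h|lborel. taylor x' h * k h - taylor x h * k h)"
      by (rule Bochner_Integration.integral_diff[symmetric]) (intro int k)+
    also have "\<bar>\<dots>\<bar> \<le> (LINT h|lborel. e * (min 1 ((norm h)\<^sup>2) * k h))"
      unfolding real_norm_def[symmetric]
    proof (rule Bochner_Integration.integral_norm_bound_integral)
      fix h
      have "norm (taylor x' h * k h - taylor x h * k h) = \<bar>taylor x' h - taylor x h\<bar> * k h"
        using admissible_nonneg[OF k] by (simp add: left_diff_distrib[symmetric] abs_mult)
      also have "\<dots> \<le> e * min 1 ((norm h)\<^sup>2) * k h"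
        by (intro mult_right_mono near x' admissible_nonneg[OF k])
      finally show "norm (taylor x' h * k h - taylor x h * k h) \<le> e * (min 1 ((norm h)\<^sup>2) * k h)"
        by (simp add: mult.assoc)
    qed (intro Bochner_Integration.integrable_diff int k integrable_mult_right admissible_integrable(1))+
    also have "\<dots> \<le> e * K0"
      using e admissible_integrable(2)[OF k] by simp
    finally show ?thesis using K0 by (simp add: e_def)
  qed
  ultimately have "\<bar>LINT h|lborel. taylor x h * k h\<bar> \<le> F" using x'(3) by linarith
  then show ?thesis using k int[OF k, of x] unfolding grad taylor_def by blast
qed

section \<open>Doubling of variables\<close>

text \<open>The tangent at 1 lies above the concave power; this is weighted AM-GM with the numbers
  \<open>x\<close> and 1.\<close>

lemma powr_le_affine:
  fixes x a :: real
  assumes "0 \<le> x" "0 < a" "a < 1"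
  shows "x powr a \<le> 1 + a * (x - 1)"
proof (cases "x = 0")
  case False
  then show ?thesis
    using Youngs_inequality_0[of a "1 - a" x 1] assms by (simp add: algebra_simps)
qed (use assms in simp)

text \<open>Trades a small exponent for a small factor in front of a fixed power, the one that
  \<open>nn_integral_sqrt_ratio\<close> integrates.\<close>

lemma powr_le_sqrt:
  fixes y b :: real
  assumes "0 \<le> y" "0 < b" "b < 1 / 2"
  shows "y powr b \<le> 1 + 2 * b * sqrt y"
proof -
  have "y powr b = sqrt y powr (2 * b)"
    using assms by (simp add: powr_half_sqrt[symmetric] powr_powr)
  also have "\<dots> \<le> 1 + 2 * b * (sqrt y - 1)"
    using assms by (intro powr_le_affine) auto
  also have "\<dots> \<le> 1 + 2 * b * sqrt y" using assms by simp
  finally show ?thesis .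
qed

text \<open>The range of the scale is not compact, but small scales cannot compete: there the penalty is large unless
  \<open>x\<close> and \<open>y\<close> are so close that \<open>u x - u y\<close> is below the value at the starting point.\<close>

lemma penalised_maximum:
  fixes u :: "'a::euclidean_space \<Rightarrow> real" and S :: "'a set"
  defines "\<Phi> \<equiv> \<lambda>M \<beta> c \<psi> \<psi>' x y \<sigma>. u x - u y - M * (c \<sigma> * (1 + \<beta> * (norm (x - y) / \<sigma>)\<^sup>2)) - \<psi> x - \<psi>' y"
  assumes S: "compact S" and u: "continuous_on S u" and \<psi>: "continuous_on S \<psi>" "continuous_on S \<psi>'"
    and c: "continuous_on {0<..r} c" "\<And>s. 0 < s \<Longrightarrow> s \<le> r \<Longrightarrow> 0 \<le> c s"
    and \<psi>0: "\<And>x. 0 \<le> \<psi> x" "\<And>x. 0 \<le> \<psi>' x" and U: "\<And>x. \<bar>u x\<bar> \<le> U"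
    and blowup: "\<And>Z. \<exists>s0>0. \<forall>s. 0 < s \<longrightarrow> s < s0 \<longrightarrow> s \<le> r \<longrightarrow> Z \<le> c s / s\<^sup>2"
    and M: "0 < M" and \<beta>: "0 < \<beta>"
    and start: "x1 \<in> S" "y1 \<in> S" "0 < s1" "s1 \<le> r" "0 < \<Phi> M \<beta> c \<psi> \<psi>' x1 y1 s1"
  shows "\<exists>x0\<in>S. \<exists>y0\<in>S. \<exists>s0. 0 < s0 \<and> s0 \<le> r \<and> 0 < \<Phi> M \<beta> c \<psi> \<psi>' x0 y0 s0 \<and>
     (\<forall>x\<in>S. \<forall>y\<in>S. \<forall>s. 0 < s \<longrightarrow> s \<le> r \<longrightarrow> \<Phi> M \<beta> c \<psi> \<psi>' x y s \<le> \<Phi> M \<beta> c \<psi> \<psi>' x0 y0 s0)"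
proof -
  define \<theta> where "\<theta> = \<Phi> M \<beta> c \<psi> \<psi>' x1 y1 s1"
  have \<theta>: "0 < \<theta>" using start by (simp add: \<theta>_def)
  have "uniformly_continuous_on S u" using S u by (intro compact_uniformly_continuous)
  then obtain e where e: "0 < e" and ue: "\<And>x y. x \<in> S \<Longrightarrow> y \<in> S \<Longrightarrow> dist x y < e \<Longrightarrow> dist (u x) (u y) < \<theta>"
    unfolding uniformly_continuous_on_def using \<theta> by metis
  \<comment> \<open>The level is chosen so that at scales below \<open>t\<close> the quadratic term
    alone reaches \<open>2 * U\<close> as soon as \<open>dist x y \<ge> e\<close>.\<close>
  obtain t where t: "0 < t" and tb: "\<And>s. 0 < s \<Longrightarrow> s < t \<Longrightarrow> s \<le> r \<Longrightarrow> 2 * U / (M * \<beta> * e\<^sup>2) \<le> c s / s\<^sup>2"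
    using blowup[of "2 * U / (M * \<beta> * e\<^sup>2)"] by blast
  \<comment> \<open>\<open>a \<le> s1\<close> keeps the starting point in the compact set
    \<open>P\<close>; hence the maximum over \<open>P\<close> is at least \<open>\<theta>\<close>
    and dominates the discarded scales as well.\<close>
  define a where "a = min t s1"
  have a: "0 < a" "a \<le> s1" using t start by (auto simp: a_def)
  define P where "P = S \<times> S \<times> {a..r}"
  have small: "\<Phi> M \<beta> c \<psi> \<psi>' x y s \<le> \<theta>" if xy: "x \<in> S" "y \<in> S" and s: "0 < s" "s \<le> r" "s < a" for x y s
  proof (cases "dist x y < e")
    case True
    have "0 \<le> M * (c s * (1 + \<beta> * (norm (x - y) / s)\<^sup>2))"
      using M \<beta> c(2)[of s] s by auto
    then have "\<Phi> M \<beta> c \<psi> \<psi>' x y s \<le> u x - u y" using \<psi>0[of x] \<psi>0[of y] by (simp add: \<Phi>_def)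
    also have "\<dots> \<le> \<theta>" using ue[OF xy True] by (simp add: dist_norm)
    finally show ?thesis .
  next
    case False
    have "2 * U = (M * \<beta> * e\<^sup>2) * (2 * U / (M * \<beta> * e\<^sup>2))" using M \<beta> e by simp
    also have "\<dots> \<le> (M * \<beta> * e\<^sup>2) * (c s / s\<^sup>2)"
      using M \<beta> s by (intro mult_left_mono tb) (auto simp: a_def)
    also have "\<dots> \<le> (M * \<beta> * (norm (x - y))\<^sup>2) * (c s / s\<^sup>2)"
      using M \<beta> False e c(2)[of s] s
      by (intro mult_right_mono mult_left_mono power_mono) (auto simp: dist_norm)
    also have "\<dots> \<le> M * (c s * (1 + \<beta> * (norm (x - y) / s)\<^sup>2))"
      using M c(2)[of s] s by (simp add: power_divide algebra_simps)
    finally have "\<Phi> M \<beta> c \<psi> \<psi>' x y s \<le> u x - u y - 2 * U"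
      using \<psi>0[of x] \<psi>0[of y] by (simp add: \<Phi>_def)
    also have "\<dots> \<le> 0" using U[of x] U[of y] by linarith
    finally show ?thesis using \<theta> by simp
  qed
  have cont: "continuous_on P (\<lambda>(x, y, s). \<Phi> M \<beta> c \<psi> \<psi>' x y s)"
    unfolding \<Phi>_def P_def case_prod_unfold using a
    by (intro continuous_intros continuous_on_compose2[OF u] continuous_on_compose2[OF \<psi>(1)]
        continuous_on_compose2[OF \<psi>(2)] continuous_on_compose2[OF c(1)]) auto
  have P: "compact P" unfolding P_def by (intro compact_Times S compact_Icc)
  have ne: "(x1, y1, s1) \<in> P" using start a by (simp add: P_def)
  obtain z where z: "z \<in> P" and max: "\<And>p. p \<in> P \<Longrightarrow> (\<lambda>(x, y, s). \<Phi> M \<beta> c \<psi> \<psi>' x y s) p \<le> (\<lambda>(x, y, s). \<Phi> M \<beta> c \<psi> \<psi>' x y s) z"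
    using continuous_attains_sup[OF P _ cont] ne by blast
  obtain x0 y0 s0 where zeq: "z = (x0, y0, s0)" by (cases z)
  have ge: "\<theta> \<le> \<Phi> M \<beta> c \<psi> \<psi>' x0 y0 s0" using max[OF ne] by (simp add: zeq \<theta>_def)
  show ?thesis
  proof (rule bexI[of _ x0], rule bexI[of _ y0], rule exI[of _ s0], intro conjI ballI allI impI)
    show "0 < s0" "s0 \<le> r" "x0 \<in> S" "y0 \<in> S" using z a by (auto simp: zeq P_def)
    show "0 < \<Phi> M \<beta> c \<psi> \<psi>' x0 y0 s0" using ge \<theta> by simp
    fix x y s assume xy: "x \<in> S" "y \<in> S" and s: "0 < s" "s \<le> r"
    show "\<Phi> M \<beta> c \<psi> \<psi>' x y s \<le> \<Phi> M \<beta> c \<psi> \<psi>' x0 y0 s0"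
    proof (cases "s < a")
      case True
      then show ?thesis using small[OF xy s] ge by simp
    next
      case False
      then show ?thesis using max[of "(x, y, s)"] xy s by (simp add: zeq P_def)
    qed
  qed
qed

section \<open>The penalty as a function of the scale\<close>

context scaling_function
begin

text \<open>\<open>L s\<close> grows at most like the inverse square of \<open>s\<close>, so
  \<open>L s powr (- \<beta>)\<close> is at least a multiple of \<open>s powr (2 * \<beta>)\<close>,
  and of \<open>s\<close> itself when \<open>s < 1\<close>, since \<open>2 * \<beta> < 1\<close>.
  Division by the square of \<open>s\<close> then blows up.\<close>

lemma modulus_blowup:
  assumes r: "0 < r" "ereal r \<le> R0 / 2" and \<beta>: "0 < \<beta>" "\<beta> < 1 / 2"
  shows "\<exists>s0>0. \<forall>s. 0 < s \<longrightarrow> s < s0 \<longrightarrow> s \<le> r \<longrightarrow> Z \<le> L s powr (- \<beta>) / s\<^sup>2"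
proof -
  have R: "ereal r < R0" using ereal_mult_less_of_le_half[of r R0 1] r by simp
  define A where "A = doubling * r\<^sup>2 * L r"
  have A: "0 < A" using doubling_ge L_pos[OF r(1) R] r by (simp add: A_def)
  define b where "b = A powr (- \<beta>)"
  have b: "0 < b" using A by (simp add: b_def)
  show ?thesis
  proof (intro exI[of _ "min 1 (b / max 1 Z)"] conjI allI impI)
    show "0 < min 1 (b / max 1 Z)" using b by simp
    fix s assume s: "0 < s" "s < min 1 (b / max 1 Z)" "s \<le> r"
    have Rs: "ereal s < R0" using ereal_less_of_le[OF s(3) R] .
    have "L s \<le> A / s\<^sup>2"
      using L_le[OF s(1) s(3) r(2)] by (simp add: A_def power_divide mult_ac)
    then have "(A / s\<^sup>2) powr (- \<beta>) \<le> L s powr (- \<beta>)"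
      using \<beta> L_pos[OF s(1) Rs] by (intro powr_mono2') auto
    moreover have "(A / s\<^sup>2) powr (- \<beta>) = b * s powr (2 * \<beta>)"
    proof -
      have "(s\<^sup>2) powr (- \<beta>) = s powr (- (2 * \<beta>))"
        using s by (simp add: powr_numeral[symmetric] powr_powr del: powr_numeral)
      then show ?thesis using A s by (simp add: b_def powr_divide powr_minus divide_simps)
    qed
    ultimately have 1: "b * s powr (2 * \<beta>) \<le> L s powr (- \<beta>)" by simp
    have "s powr 1 \<le> s powr (2 * \<beta>)" using s \<beta> by (intro powr_mono') auto
    then have "b * s \<le> b * s powr (2 * \<beta>)" using b s by (intro mult_left_mono) auto
    with 1 have 2: "b * s \<le> L s powr (- \<beta>)" by simp
    have "Z * s \<le> max 1 Z * s" using s by (intro mult_right_mono) auto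
    also have "\<dots> \<le> b" using s(2) by (simp add: field_simps)
    finally have "Z * s * s \<le> b * s" using s by (intro mult_right_mono) auto
    with 2 have "Z * s\<^sup>2 \<le> L s powr (- \<beta>)" by (simp only: power2_eq_square mult.assoc)
    then show "Z \<le> L s powr (- \<beta>) / s\<^sup>2" using s by (simp add: pos_le_divide_eq)
  qed
qed

text \<open>The penalty \<open>\<lambda>\<sigma>. L \<sigma> powr - \<beta> * (1 + \<beta> * (\<delta> / \<sigma>)\<^sup>2)\<close>, minimised over \<open>\<sigma>\<close>, is comparable to
  \<open>L \<delta> powr - \<beta>\<close> with constants tending to \<open>1\<close> as \<open>\<beta>\<close> tends to \<open>0\<close>.\<close>

lemma penalty_ge:
  assumes r: "0 < r" "ereal r \<le> R0 / 2" and \<beta>: "0 < \<beta>" "\<beta> < 1 / 2"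
    and \<delta>: "0 < \<delta>" "\<delta> \<le> r" and \<sigma>: "0 < \<sigma>" "\<sigma> \<le> r"
  shows "(doubling * L \<delta>) powr (- \<beta>) \<le> L \<sigma> powr (- \<beta>) * (1 + \<beta> * (\<delta> / \<sigma>)\<^sup>2)"
    and "\<delta> \<ge> \<sigma> \<Longrightarrow> (doubling * (\<delta> / \<sigma>)\<^sup>2 * L \<delta>) powr (- \<beta>) \<le> L \<sigma> powr (- \<beta>)"
proof -
  have R: "ereal r < R0" using ereal_mult_less_of_le_half[of r R0 1] r by simp
  have L\<sigma>: "0 < L \<sigma>" and L\<delta>: "0 < L \<delta>"
    using \<delta> \<sigma> ereal_less_of_le[OF _ R] L_pos by auto
  show 2: "(doubling * (\<delta> / \<sigma>)\<^sup>2 * L \<delta>) powr (- \<beta>) \<le> L \<sigma> powr (- \<beta>)" if "\<delta> \<ge> \<sigma>"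
    using \<beta> L\<sigma> that \<delta> \<sigma> order_trans[of "ereal \<delta>" "ereal r"] r by (intro powr_mono2' L_le) auto
  show "(doubling * L \<delta>) powr (- \<beta>) \<le> L \<sigma> powr (- \<beta>) * (1 + \<beta> * (\<delta> / \<sigma>)\<^sup>2)"
  proof (cases "\<delta> \<le> \<sigma>")
    case True
    have "L \<sigma> \<le> L \<delta>" using True \<delta> \<sigma> ereal_less_of_le[OF _ R] by (intro L_antimono) auto
    also have "\<dots> \<le> doubling * L \<delta>" using doubling_ge L\<delta> by simp
    finally have "(doubling * L \<delta>) powr (- \<beta>) \<le> L \<sigma> powr (- \<beta>) * 1"
      using \<beta> L\<sigma> by (simp add: powr_mono2')
    also have "\<dots> \<le> L \<sigma> powr (- \<beta>) * (1 + \<beta> * (\<delta> / \<sigma>)\<^sup>2)"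
      using \<beta> by (intro mult_left_mono) auto
    finally show ?thesis .
  next
    case False
    define \<tau> where "\<tau> = (\<delta> / \<sigma>)\<^sup>2"
    have \<tau>: "0 < \<tau>" using \<delta> \<sigma> by (simp add: \<tau>_def)
    \<comment> \<open>The factor \<open>\<tau> powr \<beta>\<close> lost in \<open>L_le\<close> is
      paid for by the quadratic term of the penalty.\<close>
    have "\<tau> powr \<beta> \<le> (1 + \<tau>) powr \<beta>" using \<tau> \<beta> by (intro powr_mono2) auto
    also have "\<dots> \<le> 1 + \<beta> * \<tau>" using powr_le_affine[of "1 + \<tau>" \<beta>] \<tau> \<beta> by simp
    finally have 1: "\<tau> powr \<beta> \<le> 1 + \<beta> * \<tau>" .
    have "(doubling * L \<delta>) powr (- \<beta>) = (doubling * \<tau> * L \<delta>) powr (- \<beta>) * \<tau> powr \<beta>"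
      using \<tau> doubling_ge L\<delta> by (simp add: powr_mult powr_minus field_simps)
    also have "\<dots> \<le> L \<sigma> powr (- \<beta>) * (1 + \<beta> * \<tau>)"
      using 1 2 False \<tau> by (intro mult_mono) (auto simp: \<tau>_def)
    finally show ?thesis by (simp add: \<tau>_def)
  qed
qed

text \<open>The last hypothesis says that the scale \<open>\<sigma>\<close> does no worse than the
  scale \<open>\<delta>\<close>. With \<open>t = \<delta> / \<sigma> \<ge> 1\<close>, cancelling
  \<open>L \<delta> powr (- \<beta>)\<close> leaves \<open>1 + \<beta> * t\<^sup>2\<close> below a
  quantity exceeding 1 by at most a multiple of \<open>\<beta> * t\<close>. Dividing by
  \<open>\<beta>\<close> bounds \<open>t\<close> uniformly in \<open>\<beta>\<close>, which keeps
  the second derivative of the penalty under control.\<close>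

lemma penalty_minimiser_ratio:
  assumes r: "0 < r" "ereal r \<le> R0 / 2" and \<beta>: "0 < \<beta>" "\<beta> < 1 / 2"
    and \<delta>: "0 < \<delta>" "\<delta> \<le> r" and \<sigma>: "0 < \<sigma>" "\<sigma> \<le> r"
    and le: "L \<sigma> powr (- \<beta>) * (1 + \<beta> * (\<delta> / \<sigma>)\<^sup>2) \<le> L \<delta> powr (- \<beta>) * (1 + \<beta>)"
  shows "(\<delta> / \<sigma>)\<^sup>2 \<le> (1 + 4 * doubling)\<^sup>2"
proof (cases "\<delta> < \<sigma>")
  case True
  then have "\<delta> / \<sigma> \<le> 1" using \<delta> \<sigma> by simp
  then have "\<delta> / \<sigma> \<le> 1 + 4 * doubling" using doubling_ge by linarith
  then show ?thesis using \<delta> \<sigma> by (intro power_mono) (auto simp: less_imp_le)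
next
  case False
  have R: "ereal r < R0" using ereal_mult_less_of_le_half[of r R0 1] r by simp
  have L\<delta>: "0 < L \<delta>" using \<delta> ereal_less_of_le[OF _ R] L_pos by auto
  define t where "t = \<delta> / \<sigma>"
  have t: "1 \<le> t" using False \<sigma> by (simp add: t_def)
  have "(doubling * t\<^sup>2 * L \<delta>) powr (- \<beta>) * (1 + \<beta> * t\<^sup>2) \<le> L \<sigma> powr (- \<beta>) * (1 + \<beta> * t\<^sup>2)"
    using penalty_ge(2)[OF r \<beta> \<delta> \<sigma>] False \<beta> by (intro mult_right_mono) (auto simp: t_def)
  also have "\<dots> \<le> L \<delta> powr (- \<beta>) * (1 + \<beta>)" using le by (simp add: t_def)
  finally have *: "(doubling * t\<^sup>2 * L \<delta>) powr (- \<beta>) * (1 + \<beta> * t\<^sup>2) \<le> L \<delta> powr (- \<beta>) * (1 + \<beta>)" .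
  define Y where "Y = (doubling * t\<^sup>2) powr \<beta>"
  have Y: "0 < Y" using doubling_ge t by (simp add: Y_def)
  have "(doubling * t\<^sup>2 * L \<delta>) powr (- \<beta>) = L \<delta> powr (- \<beta>) / Y"
    using L\<delta> doubling_ge by (subst powr_mult) (auto simp: Y_def powr_minus_divide)
  with * have "L \<delta> powr (- \<beta>) * ((1 + \<beta> * t\<^sup>2) / Y) \<le> L \<delta> powr (- \<beta>) * (1 + \<beta>)" by simp
  then have "(1 + \<beta> * t\<^sup>2) / Y \<le> 1 + \<beta>" by (rule mult_left_le_imp_le) (use L\<delta> in simp)
  then have "1 + \<beta> * t\<^sup>2 \<le> (1 + \<beta>) * (doubling * t\<^sup>2) powr \<beta>"
    using Y by (simp add: Y_def[symmetric] pos_divide_le_eq)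
  also have "\<dots> \<le> (1 + \<beta>) * (1 + 2 * \<beta> * sqrt (doubling * t\<^sup>2))"
    using \<beta> doubling_ge by (intro mult_left_mono powr_le_sqrt) auto
  also have "sqrt (doubling * t\<^sup>2) = sqrt doubling * t" using t by (simp add: real_sqrt_mult)
  also have "(1 + \<beta>) * (1 + 2 * \<beta> * (sqrt doubling * t)) \<le> (1 + \<beta>) * (1 + 2 * \<beta> * (doubling * t))"
  proof -
    have "sqrt doubling \<le> doubling" using doubling_ge by (intro real_le_lsqrt) (auto simp: power2_eq_square)
    then show ?thesis using \<beta> t by (intro mult_left_mono add_left_mono mult_right_mono) auto
  qed
  also have "\<dots> = 1 + \<beta> + (1 + \<beta>) * (2 * \<beta> * (doubling * t))" by (simp add: algebra_simps)
  also have "\<dots> \<le> 1 + \<beta> + 2 * (2 * \<beta> * (doubling * t))"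
    using \<beta> doubling_ge t by (intro add_left_mono mult_right_mono) auto
  finally have "\<beta> * t\<^sup>2 \<le> \<beta> * (1 + 4 * doubling * t)" by (simp add: algebra_simps)
  then have "t\<^sup>2 \<le> 1 + 4 * doubling * t" using \<beta> by simp
  also have "\<dots> \<le> (1 + 4 * doubling) * t" using t by (simp add: algebra_simps)
  finally have "t \<le> 1 + 4 * doubling" using t by (simp add: power2_eq_square)
  then show ?thesis using t by (intro power_mono) (auto simp: t_def)
qed

text \<open>\<open>s\<close> is the length of a jump and \<open>2 * s\<close> the scale used after
  it. Going from \<open>\<delta>\<close> to \<open>2 * s\<close> multiplies the modulus by at most
  \<open>(4 * doubling\<^sup>2 * q) powr \<beta>\<close> with \<open>q = L \<delta> / L s\<close>,
  and \<open>powr_le_sqrt\<close> makes the excess over 1 proportional to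
  \<open>\<beta>\<close>.\<close>

lemma penalty_growth:
  assumes r: "0 < r" "ereal r \<le> R0 / 2" and \<beta>: "0 < \<beta>" "\<beta> < 1 / 2"
    and \<delta>: "0 < \<delta>" and s: "\<delta> \<le> s" "2 * s \<le> r" and P: "(doubling * L \<delta>) powr (- \<beta>) \<le> P"
  shows "L (2 * s) powr (- \<beta>) * (1 + \<beta>) - P \<le> 9 * \<beta> * doubling * P * sqrt (L \<delta> / L s)"
proof -
  have R: "ereal r < R0" using ereal_mult_less_of_le_half[of r R0 1] r by simp
  have L0: "0 < L \<delta>" "0 < L s" "0 < L (2 * s)" and LL: "L s \<le> L \<delta>"
    using \<delta> s r ereal_less_of_le[OF _ R] by (auto intro!: L_pos L_antimono)
  define q where "q = L \<delta> / L s"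
  have q: "1 \<le> q" using LL L0 by (simp add: q_def)
  have P0: "0 < P" using P L0 doubling_ge by (auto intro: less_le_trans[rotated])
  have "L s \<le> doubling * (2 * s / s)\<^sup>2 * L (2 * s)"
    using s \<delta> r order_trans[of "ereal (2 * s)" "ereal r"] by (intro L_le) auto
  then have "L s \<le> 4 * doubling * L (2 * s)" using s \<delta> by simp
  then have "L s / (4 * doubling) \<le> L (2 * s)" using doubling_ge by (simp add: field_simps)
  then have "L (2 * s) powr (- \<beta>) \<le> (L s / (4 * doubling)) powr (- \<beta>)"
    using \<beta> L0 doubling_ge by (intro powr_mono2') auto
  also have "L s / (4 * doubling) = (doubling * L \<delta>) / (4 * doubling\<^sup>2 * q)"
    using L0 doubling_ge by (simp add: q_def power2_eq_square)
  also have "((doubling * L \<delta>) / (4 * doubling\<^sup>2 * q)) powr (- \<beta>) = (doubling * L \<delta>) powr (- \<beta>) * (4 * doubling\<^sup>2 * q) powr \<beta>"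
    using L0 doubling_ge q by (subst powr_divide) (auto simp: powr_minus field_simps)
  also have "\<dots> \<le> P * (1 + 2 * \<beta> * sqrt (4 * doubling\<^sup>2 * q))"
    using P P0 \<beta> q by (intro mult_mono powr_le_sqrt) auto
  also have "sqrt (4 * doubling\<^sup>2 * q) = 2 * doubling * sqrt q" using doubling_ge by (simp add: real_sqrt_mult)
  finally have "L (2 * s) powr (- \<beta>) \<le> P * (1 + 4 * \<beta> * (doubling * sqrt q))" by (simp add: mult_ac)
  then have "L (2 * s) powr (- \<beta>) * (1 + \<beta>) \<le> P * (1 + 4 * \<beta> * (doubling * sqrt q)) * (1 + \<beta>)"
    using \<beta> by (intro mult_right_mono) auto
  also have "\<dots> = P + P * (\<beta> * 1 + 4 * \<beta> * (doubling * sqrt q) * (1 + \<beta>))" by (simp add: algebra_simps)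
  \<comment> \<open>From \<open>1 \<le> doubling * sqrt q\<close> and
    \<open>1 + \<beta> \<le> 2\<close>; the coefficients \<open>1 + 8\<close> give the 9.\<close>
  also have "\<dots> \<le> P + P * (\<beta> * (doubling * sqrt q) + 4 * \<beta> * (doubling * sqrt q) * 2)"
  proof -
    have "1 * 1 \<le> doubling * sqrt q" using doubling_ge q by (intro mult_mono) auto
    then show ?thesis using \<beta> P0 by (intro add_left_mono mult_left_mono add_mono) auto
  qed
  finally show ?thesis by (simp add: q_def algebra_simps)
qed

end

section \<open>Analysis at the maximum point\<close>

context nonlocal_kernel
begin

text \<open>At the maximum point \<open>(x0, y0)\<close> the part \<open>m\<close> common to the two kernels makes both points jump to the same
  place, which destroys the whole penalty; all other jumps are estimated by the penalty at the target.\<close>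

lemma comparison_at_maximum:
  fixes u :: "'a \<Rightarrow> real" and x0 y0 x1 y1 :: 'a and r F U M N P E A \<beta> \<sigma> \<delta> CL CS CM :: real
  assumes r: "0 < r" "ereal r \<le> R0 / 2" and \<beta>: "0 < \<beta>" "\<beta> < 1 / 2"
    and u: "u \<in> Cb2" and U: "\<And>x. \<bar>u x\<bar> \<le> U"
    and eq: "\<And>x. x \<in> ball 0 r \<Longrightarrow> \<exists>k. admissible k \<and>
      integrable lborel (\<lambda>h. (u (x + h) - u x - gradient u x \<bullet> h * indicator (ball 0 1) h) * k h) \<and>
      \<bar>LINT h|lborel. (u (x + h) - u x - gradient u x \<bullet> h * indicator (ball 0 1) h) * k h\<bar> \<le> F"
    and CL: "0 \<le> CL" "\<And>k. admissible k \<Longrightarrow>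
      (\<integral>\<^sup>+h. ennreal (indicator {r / 8..} (norm h) * k h) \<partial>lborel) \<le> ennreal (CL * L (r / 8))"
    and CS: "CS = \<kappa> * sphere_area TYPE('a) * (16 / (cL\<^sup>2 * (2 - \<gamma>)))"
    and CM: "CM = \<kappa> * sphere_area TYPE('a) * 4"
    and \<delta>: "\<delta> = norm (x0 - y0)" "0 < \<delta>" "2 * \<delta> < r / 16" and \<sigma>: "0 < \<sigma>" "\<sigma> \<le> r"
    and P: "P = L \<sigma> powr (- \<beta>) * (1 + \<beta> * (\<delta> / \<sigma>)\<^sup>2)"
    and A: "A = M * \<beta> * L \<sigma> powr (- \<beta>) / \<sigma>\<^sup>2" and E: "E = M * (9 * \<beta> * doubling * P)"
    and M: "0 < M" and N: "0 \<le> N"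
    and centre: "x0 \<in> cball 0 (3 / 8 * r)" "y0 \<in> cball 0 (3 / 8 * r)"
    and max: "\<And>x y s. x \<in> cball 0 (r / 2) \<Longrightarrow> y \<in> cball 0 (r / 2) \<Longrightarrow> 0 < s \<Longrightarrow> s \<le> r \<Longrightarrow>
      u x - u y - M * (L s powr (- \<beta>) * (1 + \<beta> * (norm (x - y) / s)\<^sup>2)) - N * (norm (x - x1))\<^sup>2 - N * (norm (y - y1))\<^sup>2
      \<le> u x0 - u y0 - M * P - N * (norm (x0 - x1))\<^sup>2 - N * (norm (y0 - y1))\<^sup>2"
    and pos: "0 < u x0 - u y0 - M * P - N * (norm (x0 - x1))\<^sup>2 - N * (norm (y0 - y1))\<^sup>2"
  shows "M * P * (overlap * sphere_area TYPE('a) * (L (2 * \<delta>) - L (r / 16)))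
    \<le> 2 * (F + (A * CS * \<delta>\<^sup>2 * L \<delta> + N * CS * (r / 8)\<^sup>2 * L (r / 8) + E * CM * L \<delta> + 2 * U * CL * L (r / 8)))"
proof -
  have R: "ereal r < R0" using ereal_mult_less_of_le_half[of r R0 1] r by simp
  obtain G H where "bounded_C2 u G H"
    using u unfolding Cb2_def bounded_C2_def by auto
  then interpret bounded_C2 u G H .
  have grad: "gradient u y = G y" for y by (rule gradient_eq[OF u_deriv])
  define a where "a = x0 - y0"
  define c where "c s = L s powr (- \<beta>)" for s
  \<comment> \<open>Common jumps are longer than \<open>2 * \<delta>\<close>, so the shift by
    \<open>a\<close>, of norm \<open>\<delta>\<close>, is at most half of them, as
    \<open>common_part_le\<close> demands. The bound \<open>r / 16\<close> keeps the shifted jumps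
    below \<open>r / 8\<close>.\<close>
  define m where "m h = overlap * radial h * indicator {2 * \<delta><..r / 16} (norm h)" for h
  define q1 q2 where "q1 = (2 * N) *\<^sub>R (x0 - x1)" and "q2 = (2 * N) *\<^sub>R (y0 - y1)"
  define p where "p = (2 * A) *\<^sub>R a"
  have \<rho>: "\<delta> < r / 8" "0 < r / 8" "ereal (r / 8) \<le> R0 / 2" "ereal (r / 8) < R0"
    using \<delta> r R order_trans[of "ereal (r / 8)" "ereal r" "R0 / 2"] ereal_less_of_le[of "r / 8" r R0] by auto
  have L\<delta>: "0 < L \<delta>" using \<delta> \<rho> ereal_less_of_le[of \<delta> "r / 8" R0] by (intro L_pos) auto
  have P_ge: "(doubling * L \<delta>) powr (- \<beta>) \<le> P"
    unfolding P using \<delta> r by (intro penalty_ge(1)[OF r \<beta> _ _ \<sigma>]) auto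
  have P0: "0 \<le> P" using \<beta> by (simp add: P)
  have A0: "0 \<le> A" using M \<beta> by (simp add: A)
  have E0: "0 \<le> E" using M \<beta> doubling_ge P0 by (simp add: E)
  have U0: "0 \<le> U" using U[of 0] by linarith
  have pen: "M * (c \<sigma> * (1 + \<beta> * (t / \<sigma>)\<^sup>2)) = M * c \<sigma> + A * t\<^sup>2" for t
    using \<sigma> by (simp add: A c_def power_divide algebra_simps)
  have MP: "M * P = M * c \<sigma> + A * (norm a)\<^sup>2"
    using pen[of "norm a"] by (simp add: P c_def a_def \<delta>(1))
  have sq: "(norm (b + h))\<^sup>2 = (norm b)\<^sup>2 + 2 * (b \<bullet> h) + (norm h)\<^sup>2" for b h :: 'a
    by (simp add: power2_norm_eq_inner inner_add_left inner_add_right inner_commute)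
  have in_S: "x0 + h \<in> cball 0 (r / 2)" "y0 + h \<in> cball 0 (r / 2)" if "norm h < r / 8" for h
    using that centre norm_triangle_ineq[of x0 h] norm_triangle_ineq[of y0 h] by auto
  have in_S0: "x0 \<in> cball 0 (r / 2)" "y0 \<in> cball 0 (r / 2)" using in_S[of 0] r by auto
  have x1h: "(norm (x0 + h - x1))\<^sup>2 = (norm (x0 - x1))\<^sup>2 + 2 * ((x0 - x1) \<bullet> h) + (norm h)\<^sup>2"
    and y1h: "(norm (y0 + h - y1))\<^sup>2 = (norm (y0 - y1))\<^sup>2 + 2 * ((y0 - y1) \<bullet> h) + (norm h)\<^sup>2" for h
    using sq[of "x0 - x1" h] sq[of "y0 - y1" h] by (simp_all add: algebra_simps)
  have q1h: "q1 \<bullet> h + N * (norm h)\<^sup>2 = N * (norm (x0 + h - x1))\<^sup>2 - N * (norm (x0 - x1))\<^sup>2"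
    and q2h: "q2 \<bullet> h + N * (norm h)\<^sup>2 = N * (norm (y0 + h - y1))\<^sup>2 - N * (norm (y0 - y1))\<^sup>2" for h
    unfolding q1_def q2_def x1h y1h by (simp_all add: distrib_left)
  \<comment> \<open>The competitor moves one point and keeps \<open>\<sigma>\<close>. Expanding the
    squares gives a touching paraboloid with second-order coefficient \<open>A + N\<close>.\<close>
  have small1: "u (x0 + h) - u x0 \<le> (p + q1) \<bullet> h + (A + N) * (norm h)\<^sup>2" if h: "norm h < r / 8" for h
  proof -
    have "u (x0 + h) - u y0 - (M * c \<sigma> + A * (norm (a + h))\<^sup>2) - N * (norm (x0 + h - x1))\<^sup>2 - N * (norm (y0 - y1))\<^sup>2
      \<le> u x0 - u y0 - (M * c \<sigma> + A * (norm a)\<^sup>2) - N * (norm (x0 - x1))\<^sup>2 - N * (norm (y0 - y1))\<^sup>2"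
      using max[OF in_S(1)[OF h] in_S0(2) \<sigma>] unfolding c_def[symmetric] pen MP
      by (simp add: a_def algebra_simps)
    then have "u (x0 + h) - u x0 \<le> A * ((norm (a + h))\<^sup>2 - (norm a)\<^sup>2) + (q1 \<bullet> h + N * (norm h)\<^sup>2)"
      unfolding q1h by (simp add: algebra_simps)
    then show ?thesis unfolding sq by (simp add: p_def inner_add_left algebra_simps)
  qed
  have small2: "u y0 - u (y0 + h) \<le> (- p + q2) \<bullet> h + (A + N) * (norm h)\<^sup>2" if h: "norm h < r / 8" for h
  proof -
    have "u x0 - u (y0 + h) - (M * c \<sigma> + A * (norm (a + - h))\<^sup>2) - N * (norm (x0 - x1))\<^sup>2 - N * (norm (y0 + h - y1))\<^sup>2
      \<le> u x0 - u y0 - (M * c \<sigma> + A * (norm a)\<^sup>2) - N * (norm (x0 - x1))\<^sup>2 - N * (norm (y0 - y1))\<^sup>2"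
      using max[OF in_S0(1) in_S(2)[OF h] \<sigma>] unfolding c_def[symmetric] pen MP
      by (simp add: a_def algebra_simps)
    then have "u y0 - u (y0 + h) \<le> A * ((norm (a + - h))\<^sup>2 - (norm a)\<^sup>2) + (q2 \<bullet> h + N * (norm h)\<^sup>2)"
      unfolding q2h by (simp add: algebra_simps)
    then show ?thesis unfolding sq by (simp add: p_def inner_add_left inner_diff_left algebra_simps)
  qed
  \<comment> \<open>After a jump with \<open>norm h \<ge> \<delta>\<close> the new distance
    \<open>t\<close> is at most \<open>2 * norm h\<close>, so at that scale the quadratic term
    contributes at most a factor \<open>1 + \<beta>\<close>.\<close>
  have grow: "M * (c (2 * norm h) * (1 + \<beta> * (t / (2 * norm h))\<^sup>2)) \<le> M * P + E * sqrt (L \<delta> / L (norm h))"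
    if h: "\<delta> \<le> norm h" "norm h < r / 8" and t: "0 \<le> t" "t \<le> 2 * norm h" for h :: 'a and t
  proof -
    have h0: "0 < norm h" using h \<delta> by linarith
    have "(t / (2 * norm h))\<^sup>2 \<le> 1\<^sup>2" using t h0 by (intro power_mono) auto
    then have "M * (c (2 * norm h) * (1 + \<beta> * (t / (2 * norm h))\<^sup>2)) \<le> M * (c (2 * norm h) * (1 + \<beta> * 1))"
      using M \<beta> by (intro mult_left_mono add_left_mono) (auto simp: c_def)
    also have "\<dots> \<le> M * (P + 9 * \<beta> * doubling * P * sqrt (L \<delta> / L (norm h)))"
    proof (rule mult_left_mono)
      have "2 * norm h \<le> r" using h r by linarith
      from penalty_growth[OF r \<beta> \<delta>(2) h(1) this P_ge]
      show "c (2 * norm h) * (1 + \<beta> * 1) \<le> P + 9 * \<beta> * doubling * P * sqrt (L \<delta> / L (norm h))"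
        by (simp add: c_def)
    qed (use M in simp)
    finally show ?thesis by (simp add: E algebra_simps)
  qed
  have medium1: "u (x0 + h) - u x0 \<le> q1 \<bullet> h + N * (norm h)\<^sup>2 + E * sqrt (L \<delta> / L (norm h))"
    if h: "\<delta> \<le> norm h" "norm h < r / 8" for h
  proof -
    have t: "norm (x0 + h - y0) \<le> 2 * norm h"
      using norm_triangle_ineq[of "x0 - y0" h] h \<delta>(1) by (simp add: algebra_simps)
    have "0 < 2 * norm h" "2 * norm h \<le> r" using h \<delta> by linarith+
    from max[OF in_S(1)[OF h(2)] in_S0(2) this] grow[OF h norm_ge_zero t]
    show ?thesis unfolding q1h c_def by linarith
  qed
  have medium2: "u y0 - u (y0 + h) \<le> q2 \<bullet> h + N * (norm h)\<^sup>2 + E * sqrt (L \<delta> / L (norm h))"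
    if h: "\<delta> \<le> norm h" "norm h < r / 8" for h
  proof -
    have t: "norm (x0 - (y0 + h)) \<le> 2 * norm h"
      using norm_triangle_ineq4[of "x0 - y0" h] h \<delta>(1) by (simp add: algebra_simps)
    have "0 < 2 * norm h" "2 * norm h \<le> r" using h \<delta> by linarith+
    from max[OF in_S0(1) in_S(2)[OF h(2)] this] grow[OF h norm_ge_zero t]
    show ?thesis unfolding q2h c_def by linarith
  qed
  \<comment> \<open>The gradients at the two points are those of the test function, so the equations
    can be rewritten with \<open>p + q1\<close> and, for \<open>- u\<close>, with
    \<open>- p + q2\<close>.\<close>
  have G1: "G x0 = p + q1"
    by (rule GDERIV_eq_of_touching_paraboloid[OF u_deriv \<rho>(2) small1])
  have "GDERIV (\<lambda>x. - u x) y0 :> - G y0" by (rule GDERIV_minus[OF u_deriv])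
  then have G2: "- G y0 = - p + q2"
    by (rule GDERIV_eq_of_touching_paraboloid[OF _ \<rho>(2)]) (use small2 in simp)
  have m_meas [measurable]: "m \<in> borel_measurable borel" unfolding m_def by measurable
  have m0: "0 \<le> m h" for h using overlap_pos radial_nonneg by (simp add: m_def)
  have m_supp: "2 * \<delta> < norm h \<and> norm h \<le> r / 16" if "m h \<noteq> 0" for h
    using that by (auto simp: m_def split: split_indicator_asm)
  have m_le: "m h \<le> k (h + b)" if k: "admissible k" and b: "norm b \<le> \<delta>" for k h b
  proof (cases "2 * \<delta> < norm h \<and> norm h \<le> r / 16")
    case True
    have "overlap * radial h \<le> k (h + b)"
    proof (rule common_part_le[OF k])
      show "0 < norm h" using True \<delta> by linarith
      show "2 * norm b \<le> norm h" using True b by linarith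
      show "ereal (2 * norm h) < R0" by (rule ereal_less_of_le[OF _ \<rho>(4)]) (use True in linarith)
    qed
    then show ?thesis using True by (simp add: m_def)
  next
    case False
    then have "m h = 0" by (auto simp: m_def)
    then show ?thesis using admissible_nonneg[OF k] by simp
  qed
  have ball: "x0 \<in> ball 0 r" "y0 \<in> ball 0 r" using centre r by auto
  obtain k1 where k1: "admissible k1"
    and int1: "integrable lborel (\<lambda>h. (u (x0 + h) - u x0 - (p + q1) \<bullet> h * indicator (ball 0 1) h) * k1 h)"
    and ge1: "\<bar>LINT h|lborel. (u (x0 + h) - u x0 - (p + q1) \<bullet> h * indicator (ball 0 1) h) * k1 h\<bar> \<le> F"
    using eq[OF ball(1)] unfolding grad G1 by blast
  obtain k2 where k2: "admissible k2"
    and int2: "integrable lborel (\<lambda>h. (u (y0 + h) - u y0 - G y0 \<bullet> h * indicator (ball 0 1) h) * k2 h)"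
    and ge2: "\<bar>LINT h|lborel. (u (y0 + h) - u y0 - G y0 \<bullet> h * indicator (ball 0 1) h) * k2 h\<bar> \<le> F"
    using eq[OF ball(2)] unfolding grad by blast
  have eq2: "(u y0 - u (y0 + h) - (- p + q2) \<bullet> h * indicator (ball 0 1) h) * k2 h
      = - ((u (y0 + h) - u y0 - G y0 \<bullet> h * indicator (ball 0 1) h) * k2 h)" for h
    unfolding G2[symmetric] by (simp add: algebra_simps)
  define B where "B = A * CS * \<delta>\<^sup>2 * L \<delta> + N * CS * (r / 8)\<^sup>2 * L (r / 8) + E * CM * L \<delta> + 2 * U * CL * L (r / 8)"
  define T1 where "T1 h = E * sqrt (L \<delta> / L (norm h)) + q1 \<bullet> h + N * (norm h)\<^sup>2 - (u (x0 + h) - u x0)" for h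
  define T2 where "T2 h = E * sqrt (L \<delta> / L (norm h)) + q2 \<bullet> h + N * (norm h)\<^sup>2 - (u y0 - u (y0 + h))" for h
  have I1: "integrable lborel (\<lambda>h. T1 h * m h) \<and> (LINT h|lborel. T1 h * m h) \<le> F + B"
    unfolding T1_def B_def
  proof (rule one_point_inequality[where g = "\<lambda>h. u (x0 + h) - u x0" and p = p and k = k1 and A = A and CL = CL])
    show "m h \<le> k1 h" for h using m_le[OF k1, of 0 h] \<delta> by simp
    show "\<delta> \<le> norm h \<and> norm h < r / 8" if "m h \<noteq> 0" for h using m_supp[OF that] \<delta> r by linarith
    show "u (x0 + h) - u x0 \<le> 2 * U" for h using U[of "x0 + h"] U[of x0] by linarith
    show "u (x0 + h) - u x0 \<le> (p + q1) \<bullet> h + (A + N) * (norm h)\<^sup>2" if "norm h < \<delta>" for h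
      using that \<rho> by (intro small1) simp
    show "- F \<le> (LINT h|lborel. (u (x0 + h) - u x0 - (p + q1) \<bullet> h * indicator (ball 0 1) h) * k1 h)"
      using ge1 by linarith
  qed (use k1 \<delta> \<rho> A0 N E0 U0 int1 CL CS CM m0 medium1 in auto)
  \<comment> \<open>At \<open>y0\<close> the common part is translated by \<open>a\<close>: the jump
    \<open>h + a\<close> from \<open>y0\<close> ends where the jump \<open>h\<close> from
    \<open>x0\<close> ends.\<close>
  have I2: "integrable lborel (\<lambda>h. T2 h * m (h - a)) \<and> (LINT h|lborel. T2 h * m (h - a)) \<le> F + B"
    unfolding T2_def B_def
  proof (rule one_point_inequality[where g = "\<lambda>h. u y0 - u (y0 + h)" and p = "- p" and k = k2 and A = A and CL = CL])
    show "m (h - a) \<le> k2 h" for h using m_le[OF k2, of a "h - a"] \<delta> by (simp add: a_def)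
    show "\<delta> \<le> norm h \<and> norm h < r / 8" if "m (h - a) \<noteq> 0" for h
      using m_supp[OF that] \<delta> norm_triangle_ineq4[of h a] norm_triangle_ineq[of "h - a" a] by (auto simp: a_def)
    show "u y0 - u (y0 + h) \<le> 2 * U" for h using U[of "y0 + h"] U[of y0] by linarith
    show "u y0 - u (y0 + h) \<le> (- p + q2) \<bullet> h + (A + N) * (norm h)\<^sup>2" if "norm h < \<delta>" for h
      using that \<rho> by (intro small2) simp
    show "integrable lborel (\<lambda>h. (u y0 - u (y0 + h) - (- p + q2) \<bullet> h * indicator (ball 0 1) h) * k2 h)"
      unfolding eq2 by (intro integrable_minus int2)
    show "- F \<le> (LINT h|lborel. (u y0 - u (y0 + h) - (- p + q2) \<bullet> h * indicator (ball 0 1) h) * k2 h)"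
      unfolding eq2 using ge2 by simp
  qed (use k2 \<delta> \<rho> A0 N E0 U0 CL CS CM m0 medium2 in auto)
  have T2_meas: "(\<lambda>h. T2 h * m (h - a)) \<in> borel_measurable borel" using conjunct1[OF I2] by auto
  have "(LINT h|lborel. T2 (h + a) * m h) = (LINT h|lborel. T2 h * m (h - a))"
    using integral_lborel_translation[OF T2_meas, of a] by simp
  moreover have I2': "integrable lborel (\<lambda>h. T2 (h + a) * m h)"
    using integrable_lborel_translation[OF conjunct1[OF I2], of a] by simp
  ultimately have I: "(LINT h|lborel. T1 h * m h + T2 (h + a) * m h) \<le> 2 * (F + B)"
    using I1 I2 by simp
  have nn_m: "(\<integral>\<^sup>+h. ennreal (m h) \<partial>lborel) = ennreal (overlap * sphere_area TYPE('a) * (L (2 * \<delta>) - L (r / 16)))"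
    unfolding m_def using \<delta> r \<rho> ereal_less_of_le[of "r / 16" "r / 8" R0] by (intro nn_integral_common_part) auto
  have int_m: "integrable lborel m" using m0 by (intro integrableI_nonneg) (auto simp: nn_m)
  have LL: "L (r / 16) \<le> L (2 * \<delta>)"
    using \<delta> r \<rho> ereal_less_of_le[of "r / 16" "r / 8" R0] by (intro L_antimono) auto
  have int_m_eq: "integral\<^sup>L lborel m = overlap * sphere_area TYPE('a) * (L (2 * \<delta>) - L (r / 16))"
    using nn_m m0 LL overlap_pos sphere_area_pos[where 'a='a]
    by (intro integral_eq_nn_integral[THEN trans]) (auto simp: less_imp_le)
  have "M * P * integral\<^sup>L lborel m = (LINT h|lborel. M * P * m h)" by simp
  also have "\<dots> \<le> (LINT h|lborel. T1 h * m h + T2 (h + a) * m h)"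
  proof (rule integral_mono)
    show "integrable lborel (\<lambda>h. M * P * m h)" using int_m by simp
    show "integrable lborel (\<lambda>h. T1 h * m h + T2 (h + a) * m h)" using conjunct1[OF I1] I2' by simp
    fix h
    show "M * P * m h \<le> T1 h * m h + T2 (h + a) * m h"
    proof (cases "m h = 0")
      case False
      have h: "2 * \<delta> < norm h" "norm h \<le> r / 16" using m_supp[OF False] by auto
      have na: "norm a = \<delta>" by (simp add: a_def \<delta>(1))
      have ha: "0 < norm (h + a)" "norm (h + a) < r / 8"
        using h \<delta> norm_triangle_ineq[of h a] norm_diff_ineq[of h a] na by linarith+
      have h0: "0 < norm h" "norm h < r / 8" using h \<delta> r by linarith+
      have "0 \<le> sqrt (L \<delta> / L (norm h))" "0 \<le> sqrt (L \<delta> / L (norm (h + a)))"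
        using L\<delta> L_nonneg[OF h0(1)] L_nonneg[OF ha(1)] ereal_less_of_le[OF less_imp_le \<rho>(4)] h0(2) ha(2) by auto
      then have e: "0 \<le> E * sqrt (L \<delta> / L (norm h))" "0 \<le> E * sqrt (L \<delta> / L (norm (h + a)))"
        using E0 by auto
      have z: "y0 + (h + a) = x0 + h" by (simp add: a_def)
      have n: "0 \<le> N * (norm (x0 + h - x1))\<^sup>2" "0 \<le> N * (norm (y0 + (h + a) - y1))\<^sup>2" using N by auto
      \<comment> \<open>The value of \<open>u\<close> at the common target occurs with opposite
        signs and cancels. What remains contains \<open>u x0 - u y0\<close> minus the two
        localisation terms, which exceeds \<open>M * P\<close> by \<open>pos\<close>; the rest is
        nonnegative.\<close>
      have "M * P \<le> T1 h + T2 (h + a)"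
        using pos e n q1h[of h] q2h[of "h + a"] unfolding T1_def T2_def z by linarith
      then have "M * P * m h \<le> (T1 h + T2 (h + a)) * m h" using m0 by (intro mult_right_mono)
      then show ?thesis by (simp add: algebra_simps)
    qed simp
  qed
  also note I
  finally show ?thesis unfolding int_m_eq B_def .
qed

text \<open>An equation that holds up to the bound \<open>F\<close>, at every point and with some
  admissible kernel, frees the argument from null sets, and \<open>F > 0\<close> ensures
  \<open>M > 0\<close>. One sign of the difference suffices, since \<open>x1\<close> and
  \<open>y1\<close> may be exchanged.\<close>

lemma regularity_estimate:
  "\<exists>C>0. \<exists>\<beta>\<in>{0<..<1}. \<forall>r F U u x1 y1. 0 < r \<longrightarrow> ereal r \<le> R0 / 2 \<longrightarrow> 0 < F \<longrightarrow> u \<in> Cb2 \<longrightarrow> (\<forall>x. \<bar>u x\<bar> \<le> U) \<longrightarrow>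
     (\<forall>x\<in>ball 0 r. \<exists>k. admissible k \<and>
        integrable lborel (\<lambda>h. (u (x + h) - u x - gradient u x \<bullet> h * indicator (ball 0 1) h) * k h) \<and>
        \<bar>LINT h|lborel. (u (x + h) - u x - gradient u x \<bullet> h * indicator (ball 0 1) h) * k h\<bar> \<le> F) \<longrightarrow>
     x1 \<in> ball 0 (r / 4) \<longrightarrow> y1 \<in> ball 0 (r / 4) \<longrightarrow> x1 \<noteq> y1 \<longrightarrow>
     u x1 - u y1 \<le> C * (L r powr \<beta> * U + L r powr (\<beta> - 1) * F) * L (norm (x1 - y1)) powr (- \<beta>)"
proof -
  define CS CM where "CS = \<kappa> * sphere_area TYPE('a) * (16 / (cL\<^sup>2 * (2 - \<gamma>)))"
    and "CM = \<kappa> * sphere_area TYPE('a) * 4"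
  have CS0: "0 < CS" and CM0: "0 < CM"
    using \<kappa> cL \<gamma> sphere_area_pos[where 'a='a] by (auto simp: CS_def CM_def)
  obtain CL where CL: "0 < CL" "\<And>k \<rho>. admissible k \<Longrightarrow> 0 < \<rho> \<Longrightarrow> ereal \<rho> \<le> R0 / 2 \<Longrightarrow>
     (\<integral>\<^sup>+h. ennreal (indicator {\<rho>..} (norm h) * k h) \<partial>lborel) \<le> ennreal (CL * L \<rho>)"
    using large_jumps by blast
  \<comment> \<open>\<open>D\<close> collects the factors of
    \<open>M * P * \<beta> * L \<delta>\<close> in the costs: small jumps through
    \<open>penalty_minimiser_ratio\<close>, medium jumps through
    \<open>penalty_growth\<close>.\<close>
  define D where "D = (1 + 4 * doubling)\<^sup>2 * CS + 9 * doubling * CM"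
  have D: "0 < D" using doubling_ge CS0 CM0 unfolding D_def by (intro add_pos_pos mult_pos_pos) auto
  \<comment> \<open>\<open>c5 * L \<delta>\<close> is a lower bound for the mass of common jumps:
    half of \<open>L (2 * \<delta>)\<close> survives the subtraction of \<open>L (r / 16)\<close>,
    and \<open>L_le\<close> from \<open>\<delta>\<close> to \<open>2 * \<delta>\<close> costs
    \<open>4 * doubling\<close>.\<close>
  define c5 where "c5 = overlap * sphere_area TYPE('a) / (8 * doubling)"
  have c5: "0 < c5" using overlap_pos doubling_ge sphere_area_pos[where 'a='a] by (simp add: c5_def)
  \<comment> \<open>The costs proportional to \<open>\<beta>\<close> may consume at most half of the
    gain; \<open>1 / 4\<close> guarantees the bound \<open>\<beta> < 1 / 2\<close> needed for the
    penalty lemmas.\<close>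
  define \<beta> where "\<beta> = min (1 / 4) (c5 / (4 * D))"
  have \<beta>: "0 < \<beta>" "\<beta> < 1 / 2" using c5 D by (auto simp: \<beta>_def)
  have "\<beta> \<le> c5 / (4 * D)" by (simp add: \<beta>_def)
  then have \<beta>D: "2 * \<beta> * D \<le> c5 / 2" using D by (simp add: field_simps)
  \<comment> \<open>Localisation and jumps beyond \<open>r / 8\<close> cost
    \<open>4 * U * (CS + CL) * L (r / 8)\<close> at the two points together, and \<open>L_le\<close>
    from \<open>r / 8\<close> to \<open>r\<close> contributes \<open>64 * doubling\<close>.\<close>
  define C6 where "C6 = 256 * doubling * (CS + CL)"
  have C6: "0 < C6" using doubling_ge CS0 CL by (simp add: C6_def)
  \<comment> \<open>The first entry makes the penalty reach \<open>2 * U\<close> when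
    \<open>L \<delta>\<close> is comparable to \<open>L r\<close>; the second yields the final
    contradiction.\<close>
  define C7 where "C7 = max (2 * doubling * (2048 * doubling\<^sup>2)) (2 * doubling * (3 + C6) / c5)"
  have C7: "0 < C7" "2 * doubling * (2048 * doubling\<^sup>2) \<le> C7" "2 * doubling * (3 + C6) / c5 \<le> C7"
    using doubling_ge by (auto simp: C7_def less_max_iff_disj)
  show ?thesis
  proof (rule exI[of _ "2 * C7"], intro conjI, use C7 in simp, rule bexI[of _ \<beta>], intro allI impI, rule ccontr)
    fix r F U :: real and u :: "'a \<Rightarrow> real" and x1 y1 :: 'a
    assume r: "0 < r" "ereal r \<le> R0 / 2" and F: "0 < F" and u: "u \<in> Cb2" and "\<forall>x. \<bar>u x\<bar> \<le> U"
      and eq: "\<forall>x\<in>ball 0 r. \<exists>k. admissible k \<and>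
        integrable lborel (\<lambda>h. (u (x + h) - u x - gradient u x \<bullet> h * indicator (ball 0 1) h) * k h) \<and>
        \<bar>LINT h|lborel. (u (x + h) - u x - gradient u x \<bullet> h * indicator (ball 0 1) h) * k h\<bar> \<le> F"
      and x1: "x1 \<in> ball 0 (r / 4)" and y1: "y1 \<in> ball 0 (r / 4)" and neq: "x1 \<noteq> y1"
      and not_le: "\<not> u x1 - u y1 \<le> 2 * C7 * (L r powr \<beta> * U + L r powr (\<beta> - 1) * F) * L (norm (x1 - y1)) powr - \<beta>"
    have U: "\<bar>u x\<bar> \<le> U" for x using \<open>\<forall>x. \<bar>u x\<bar> \<le> U\<close> by blast
    have U0: "0 \<le> U" using U[of 0] by linarith
    have R: "ereal r < R0" using ereal_mult_less_of_le_half[of r R0 1] r by simp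
    have half: "ereal s \<le> R0 / 2" if "s \<le> r" for s
      using that r order_trans[of "ereal s" "ereal r"] by simp
    have Lr: "0 < L r" using r R by (intro L_pos)
    define M where "M = C7 * (L r powr \<beta> * U + L r powr (\<beta> - 1) * F)"
    have M: "0 < M"
      unfolding M_def using C7(1) F U0 Lr by (intro mult_pos_pos add_nonneg_pos) auto
    \<comment> \<open>Moving a point by \<open>r / 8\<close> costs \<open>2 * U\<close>, as much as
      \<open>u x - u y\<close> can ever be. So the maximum point stays within radius
      \<open>3 / 8 * r\<close>, and jumps shorter than \<open>r / 8\<close> remain in
      \<open>cball 0 (r / 2)\<close>.\<close>
    define N where "N = 2 * U / (r / 8)\<^sup>2"
    have N: "0 \<le> N" using U0 by (simp add: N_def)
    have Nr: "N * (r / 8)\<^sup>2 = 2 * U" using r by (simp add: N_def)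
    obtain G H where "bounded_C2 u G H"
      using u unfolding Cb2_def bounded_C2_def by auto
    then interpret bounded_C2 u G H .
    define s1 where "s1 = norm (x1 - y1)"
    have s1: "0 < s1" "s1 \<le> r"
      using neq x1 y1 norm_triangle_ineq4[of x1 y1] r by (auto simp: s1_def)
    have cont: "continuous_on {0<..r} (\<lambda>s. L s powr (- \<beta>))"
    proof -
      have "continuous_on {0<..r} L"
        by (rule continuous_on_subset[OF continuous_on_L])
           (use ereal_less_of_le[OF _ R] in \<open>auto simp: einterval_def\<close>)
      then show ?thesis
        using L_pos ereal_less_of_le[OF _ R] by (intro continuous_intros) fastforce+
    qed
    \<comment> \<open>At the scale \<open>s1 = norm (x1 - y1)\<close> the penalty is
      \<open>1 + \<beta>\<close> times the modulus; the 2 in \<open>2 * C7\<close> absorbs that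
      factor.\<close>
    have start: "0 < u x1 - u y1 - M * (L s1 powr (- \<beta>) * (1 + \<beta> * (norm (x1 - y1) / s1)\<^sup>2))
        - N * (norm (x1 - x1))\<^sup>2 - N * (norm (y1 - y1))\<^sup>2"
    proof -
      have "M * (L s1 powr (- \<beta>) * (1 + \<beta>)) \<le> M * (L s1 powr (- \<beta>) * 2)"
        using M \<beta> by (intro mult_left_mono) auto
      also have "\<dots> < u x1 - u y1" using not_le by (simp only: M_def s1_def not_le mult_ac)
      finally show ?thesis using s1 by (simp add: s1_def[symmetric])
    qed
    have "\<exists>x0\<in>cball 0 (r / 2). \<exists>y0\<in>cball 0 (r / 2). \<exists>\<sigma>. 0 < \<sigma> \<and> \<sigma> \<le> r \<and>
      0 < u x0 - u y0 - M * (L \<sigma> powr (- \<beta>) * (1 + \<beta> * (norm (x0 - y0) / \<sigma>)\<^sup>2)) - N * (norm (x0 - x1))\<^sup>2 - N * (norm (y0 - y1))\<^sup>2 \<and>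
      (\<forall>x\<in>cball 0 (r / 2). \<forall>y\<in>cball 0 (r / 2). \<forall>s. 0 < s \<longrightarrow> s \<le> r \<longrightarrow>
        u x - u y - M * (L s powr (- \<beta>) * (1 + \<beta> * (norm (x - y) / s)\<^sup>2)) - N * (norm (x - x1))\<^sup>2 - N * (norm (y - y1))\<^sup>2
        \<le> u x0 - u y0 - M * (L \<sigma> powr (- \<beta>) * (1 + \<beta> * (norm (x0 - y0) / \<sigma>)\<^sup>2)) - N * (norm (x0 - x1))\<^sup>2 - N * (norm (y0 - y1))\<^sup>2)"
    proof (rule penalised_maximum[where S = "cball 0 (r / 2)" and u = u and M = M and \<beta> = \<beta> and r = r and U = U
          and c = "\<lambda>s. L s powr (- \<beta>)" and \<psi> = "\<lambda>x. N * (norm (x - x1))\<^sup>2" and \<psi>' = "\<lambda>y. N * (norm (y - y1))\<^sup>2"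
          and ?x1.0 = x1 and ?y1.0 = y1 and ?s1.0 = s1])
      show "\<exists>s0>0. \<forall>s. 0 < s \<longrightarrow> s < s0 \<longrightarrow> s \<le> r \<longrightarrow> Z \<le> L s powr (- \<beta>) / s\<^sup>2" for Z
        using modulus_blowup[OF r \<beta>] .
      show "continuous_on (cball 0 (r / 2)) (\<lambda>x. N * (norm (x - x1))\<^sup>2)"
        "continuous_on (cball 0 (r / 2)) (\<lambda>y. N * (norm (y - y1))\<^sup>2)"
        by (intro continuous_intros)+
      show "x1 \<in> cball 0 (r / 2)" "y1 \<in> cball 0 (r / 2)" using x1 y1 r by auto
    qed (use N start in \<open>auto simp: s1 M \<beta> U intro: u_continuous cont\<close>)
    then obtain x0 y0 \<sigma> where mem: "x0 \<in> cball 0 (r / 2)" "y0 \<in> cball 0 (r / 2)" and \<sigma>: "0 < \<sigma>" "\<sigma> \<le> r"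
      and pos0: "0 < u x0 - u y0 - M * (L \<sigma> powr (- \<beta>) * (1 + \<beta> * (norm (x0 - y0) / \<sigma>)\<^sup>2)) - N * (norm (x0 - x1))\<^sup>2 - N * (norm (y0 - y1))\<^sup>2"
      and max0: "\<And>x y s. x \<in> cball 0 (r / 2) \<Longrightarrow> y \<in> cball 0 (r / 2) \<Longrightarrow> 0 < s \<Longrightarrow> s \<le> r \<Longrightarrow>
        u x - u y - M * (L s powr (- \<beta>) * (1 + \<beta> * (norm (x - y) / s)\<^sup>2)) - N * (norm (x - x1))\<^sup>2 - N * (norm (y - y1))\<^sup>2
        \<le> u x0 - u y0 - M * (L \<sigma> powr (- \<beta>) * (1 + \<beta> * (norm (x0 - y0) / \<sigma>)\<^sup>2)) - N * (norm (x0 - x1))\<^sup>2 - N * (norm (y0 - y1))\<^sup>2"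
      by blast
    define \<delta> where "\<delta> = norm (x0 - y0)"
    define P where "P = L \<sigma> powr (- \<beta>) * (1 + \<beta> * (\<delta> / \<sigma>)\<^sup>2)"
    have P0: "0 \<le> P" using \<beta> by (simp add: P_def)
    have MP0: "0 \<le> M * P" using M P0 by simp
    have NN: "0 \<le> N * (norm (x0 - x1))\<^sup>2" "0 \<le> N * (norm (y0 - y1))\<^sup>2" using N by auto
    have pos: "0 < u x0 - u y0 - M * P - N * (norm (x0 - x1))\<^sup>2 - N * (norm (y0 - y1))\<^sup>2"
      using pos0 by (simp add: P_def \<delta>_def)
    have max: "u x - u y - M * (L s powr (- \<beta>) * (1 + \<beta> * (norm (x - y) / s)\<^sup>2)) - N * (norm (x - x1))\<^sup>2 - N * (norm (y - y1))\<^sup>2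
        \<le> u x0 - u y0 - M * P - N * (norm (x0 - x1))\<^sup>2 - N * (norm (y0 - y1))\<^sup>2"
      if "x \<in> cball 0 (r / 2)" "y \<in> cball 0 (r / 2)" "0 < s" "s \<le> r" for x y s
      using max0[OF that] by (simp add: P_def \<delta>_def)
    have uU: "u x0 - u y0 \<le> 2 * U" using U[of x0] U[of y0] by linarith
    have "\<delta> \<noteq> 0"
    proof
      assume "\<delta> = 0"
      then have "x0 = y0" by (simp add: \<delta>_def)
      with pos MP0 NN show False by simp
    qed
    then have \<delta>0: "0 < \<delta>" by (simp add: \<delta>_def)
    have \<delta>r: "\<delta> \<le> r" using mem norm_triangle_ineq4[of x0 y0] by (simp add: \<delta>_def)
    have L\<delta>: "0 < L \<delta>" using \<delta>0 ereal_less_of_le[OF \<delta>r R] by (intro L_pos)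
    have close: "norm (x0 - x1) < r / 8" "norm (y0 - y1) < r / 8"
    proof -
      have "N * (norm (x0 - x1))\<^sup>2 < N * (r / 8)\<^sup>2" "N * (norm (y0 - y1))\<^sup>2 < N * (r / 8)\<^sup>2"
        using pos uU MP0 NN unfolding Nr by linarith+
      then have sq: "(norm (x0 - x1))\<^sup>2 < (r / 8)\<^sup>2" "(norm (y0 - y1))\<^sup>2 < (r / 8)\<^sup>2"
        using N by (auto simp: mult_less_cancel_left)
      then show "norm (x0 - x1) < r / 8" "norm (y0 - y1) < r / 8"
        using power2_less_imp_less[OF sq(1)] power2_less_imp_less[OF sq(2)] r by simp_all
    qed
    have centre: "x0 \<in> cball 0 (3 / 8 * r)" "y0 \<in> cball 0 (3 / 8 * r)"
      using close x1 y1 norm_triangle_ineq[of "x0 - x1" x1] norm_triangle_ineq[of "y0 - y1" y1] by auto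
    have P_ge: "(doubling * L \<delta>) powr (- \<beta>) \<le> P"
      unfolding P_def by (rule penalty_ge(1)[OF r \<beta> \<delta>0 \<delta>r \<sigma>])
    \<comment> \<open>Otherwise \<open>L \<delta>\<close> is at most a fixed multiple of
      \<open>L r\<close>, with \<open>2048 = 4 * 2 * 256\<close> in the worse case. Then
      \<open>M * P \<ge> 2 * U\<close>, which is incompatible with a positive maximum.\<close>
    have far: "2 * \<delta> < r / 16 \<and> 2 * L (r / 16) \<le> L (2 * \<delta>)"
    proof (rule ccontr)
      assume *: "\<not> ?thesis"
      have "L \<delta> \<le> 2048 * doubling\<^sup>2 * L r"
      proof (cases "2 * \<delta> < r / 16")
        case True
        have "L \<delta> \<le> doubling * (2 * \<delta> / \<delta>)\<^sup>2 * L (2 * \<delta>)" using \<delta>0 True r by (intro L_le half) auto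
        then have "L \<delta> \<le> 4 * doubling * L (2 * \<delta>)" using \<delta>0 by simp
        also have "\<dots> \<le> 4 * doubling * (2 * L (r / 16))" using * True doubling_ge by (intro mult_left_mono) auto
        also have "\<dots> \<le> 4 * doubling * (2 * (doubling * (r / (r / 16))\<^sup>2 * L r))"
          using doubling_ge r by (intro mult_left_mono L_le half) auto
        also have "\<dots> = 2048 * doubling\<^sup>2 * L r" using r by (simp add: power2_eq_square)
        finally show ?thesis .
      next
        case False
        have "L \<delta> \<le> L (r / 32)" using False r ereal_less_of_le[OF \<delta>r R] by (intro L_antimono) auto
        also have "\<dots> \<le> doubling * (r / (r / 32))\<^sup>2 * L r" using r by (intro L_le half) auto
        also have "\<dots> = 1024 * doubling * L r" using r by simp
        also have "\<dots> \<le> 2048 * doubling\<^sup>2 * L r"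
          using doubling_ge Lr by (intro mult_right_mono) (auto simp: power2_eq_square intro: mult_mono)
        finally show ?thesis .
      qed
      then have le: "doubling * L \<delta> \<le> doubling * (2048 * doubling\<^sup>2) * L r" using doubling_ge by simp
      define Z where "Z = doubling * (2048 * doubling\<^sup>2)"
      have "1 * 1 \<le> doubling * doubling\<^sup>2" using doubling_ge by (intro mult_mono) (auto simp: one_le_power)
      then have Z: "1 \<le> Z" by (simp add: Z_def)
      have "L r powr (- \<beta>) / Z \<le> L r powr (- \<beta>) / Z powr \<beta>"
        using Z \<beta> powr_mono[of \<beta> 1 Z] by (intro divide_left_mono) auto
      also have "\<dots> = (Z * L r) powr (- \<beta>)"
        using Z Lr by (simp add: powr_mult powr_minus field_simps)
      also have "\<dots> \<le> (doubling * L \<delta>) powr (- \<beta>)"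
        using le \<beta> doubling_ge L\<delta> by (intro powr_mono2') (auto simp: Z_def)
      also have "\<dots> \<le> P" by (rule P_ge)
      finally have PZ: "L r powr (- \<beta>) / Z \<le> P" .
      have "2 * U \<le> C7 * U / Z"
        using C7(2) Z U0 mult_right_mono[of "2 * Z" C7 U] by (simp add: Z_def field_simps)
      also have "\<dots> = C7 * (L r powr \<beta> * U) * (L r powr (- \<beta>) / Z)"
        using Lr by (simp add: powr_minus field_simps)
      also have "\<dots> \<le> M * (L r powr (- \<beta>) / Z)"
        using C7(1) F U0 Z by (intro mult_right_mono) (auto simp: M_def)
      also have "\<dots> \<le> M * P" using PZ M by (intro mult_left_mono) auto
      finally have "2 * U \<le> M * P" .
      then show False using pos uU NN by linarith
    qed
    define A E where "A = M * \<beta> * L \<sigma> powr (- \<beta>) / \<sigma>\<^sup>2" and "E = M * (9 * \<beta> * doubling * P)"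
    have combine: "Z \<le> 2 * F + 2 * a' + 2 * e' + v"
      if "X \<le> 2 * (F + (a + n + b + t))" "Z \<le> X" "a \<le> a'" "b = e'" "n + t \<le> v / 2"
      for X Z a n b t a' e' v :: real
      using that by argo
    have "M * P * (overlap * sphere_area TYPE('a) * (L (2 * \<delta>) - L (r / 16)))
      \<le> 2 * (F + (A * CS * \<delta>\<^sup>2 * L \<delta> + N * CS * (r / 8)\<^sup>2 * L (r / 8) + E * CM * L \<delta> + 2 * U * CL * L (r / 8)))"
      by (rule comparison_at_maximum[OF r \<beta> u U _ _ _ CS_def CM_def \<delta>_def \<delta>0 _ \<sigma> P_def A_def E_def M N centre max pos])
         (use eq CL r far half in auto)
    moreover have "M * P * (c5 * L \<delta>) \<le> M * P * (overlap * sphere_area TYPE('a) * (L (2 * \<delta>) - L (r / 16)))"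
    proof (rule mult_left_mono[OF _ MP0])
      have "L \<delta> \<le> doubling * (2 * \<delta> / \<delta>)\<^sup>2 * L (2 * \<delta>)" using \<delta>0 far r by (intro L_le half) auto
      then have "L \<delta> / (8 * doubling) \<le> L (2 * \<delta>) / 2" using \<delta>0 doubling_ge by (simp add: field_simps)
      also have "\<dots> \<le> L (2 * \<delta>) - L (r / 16)" using far by simp
      finally have "(overlap * sphere_area TYPE('a)) * (L \<delta> / (8 * doubling)) \<le> (overlap * sphere_area TYPE('a)) * (L (2 * \<delta>) - L (r / 16))"
        using overlap_pos sphere_area_pos[where 'a='a] by (intro mult_left_mono) auto
      then show "c5 * L \<delta> \<le> overlap * sphere_area TYPE('a) * (L (2 * \<delta>) - L (r / 16))"
        by (simp add: c5_def)
    qed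
    moreover have "A * CS * \<delta>\<^sup>2 * L \<delta> \<le> M * P * \<beta> * ((1 + 4 * doubling)\<^sup>2 * CS) * L \<delta>"
    proof -
      have "L \<sigma> powr (- \<beta>) * 1 \<le> P" unfolding P_def using \<beta> by (intro mult_left_mono) auto
      then have LP: "L \<sigma> powr (- \<beta>) \<le> P" by simp
      \<comment> \<open>Maximality in the scale, tested at the same two points with
        \<open>\<delta>\<close> in place of \<open>\<sigma>\<close>.\<close>
      have "P \<le> L \<delta> powr (- \<beta>) * (1 + \<beta>)"
      proof -
        have "M * P \<le> M * (L \<delta> powr (- \<beta>) * (1 + \<beta>))"
          using max[OF mem \<delta>0 \<delta>r] \<delta>0 by (simp add: \<delta>_def[symmetric])
        then show ?thesis using M by simp
      qed
      then have ratio: "(\<delta> / \<sigma>)\<^sup>2 \<le> (1 + 4 * doubling)\<^sup>2"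
        unfolding P_def by (rule penalty_minimiser_ratio[OF r \<beta> \<delta>0 \<delta>r \<sigma>])
      have "A * CS * \<delta>\<^sup>2 * L \<delta> = M * \<beta> * CS * L \<delta> * (L \<sigma> powr (- \<beta>) * (\<delta> / \<sigma>)\<^sup>2)"
        by (simp add: A_def power_divide)
      also have "\<dots> \<le> M * \<beta> * CS * L \<delta> * (P * (1 + 4 * doubling)\<^sup>2)"
        using LP ratio M \<beta> CS0 L\<delta> P0 by (intro mult_left_mono mult_mono) auto
      finally show ?thesis by (simp add: mult_ac)
    qed
    moreover have "E * CM * L \<delta> = M * P * \<beta> * (9 * doubling * CM) * L \<delta>" by (simp add: E_def mult_ac)
    moreover have "N * CS * (r / 8)\<^sup>2 * L (r / 8) + 2 * U * CL * L (r / 8) \<le> C6 * U * L r / 2"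
    proof -
      have "N * CS * (r / 8)\<^sup>2 * L (r / 8) + 2 * U * CL * L (r / 8) = (N * (r / 8)\<^sup>2) * CS * L (r / 8) + 2 * U * CL * L (r / 8)"
        by (simp only: mult_ac)
      also have "\<dots> = 2 * U * (CS + CL) * L (r / 8)"
        unfolding Nr by (simp add: algebra_simps)
      also have "\<dots> \<le> 2 * U * (CS + CL) * (doubling * (r / (r / 8))\<^sup>2 * L r)"
        using U0 CS0 CL(1) r by (intro mult_left_mono L_le half) auto
      also have "\<dots> = C6 * U * L r / 2" using r by (simp add: C6_def)
      finally show ?thesis .
    qed
    ultimately have "M * P * (c5 * L \<delta>) \<le> 2 * F + 2 * (M * P * \<beta> * ((1 + 4 * doubling)\<^sup>2 * CS) * L \<delta>)
        + 2 * (M * P * \<beta> * (9 * doubling * CM) * L \<delta>) + C6 * U * L r"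
      by (rule combine)
    also have "\<dots> = 2 * F + M * P * L \<delta> * (2 * \<beta> * D) + C6 * U * L r"
      by (simp add: D_def algebra_simps)
    also have "\<dots> \<le> 2 * F + M * P * L \<delta> * (c5 / 2) + C6 * U * L r"
      using \<beta>D MP0 L\<delta> by (intro add_right_mono add_left_mono mult_left_mono) auto
    finally have main: "c5 / 2 * M * (P * L \<delta>) \<le> 2 * F + C6 * U * L r"
      by (simp add: algebra_simps)
    \<comment> \<open>\<open>P * L \<delta>\<close> is at least of order
      \<open>L \<delta> powr (1 - \<beta>)\<close>, and a positive power of \<open>L\<close> is
      smallest at \<open>r\<close>. This removes \<open>\<delta>\<close> from the
      inequality.\<close>
    have "L r powr (1 - \<beta>) / doubling \<le> P * L \<delta>"
    proof -
      have "L r powr (1 - \<beta>) / doubling \<le> L \<delta> powr (1 - \<beta>) / doubling"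
        using \<beta> Lr doubling_ge L_antimono[OF \<delta>0 \<delta>r R] by (intro divide_right_mono powr_mono2) auto
      also have "\<dots> \<le> L \<delta> powr (1 - \<beta>) / doubling powr \<beta>"
        using doubling_ge \<beta> powr_mono[of \<beta> 1 doubling] by (intro divide_left_mono) auto
      also have "\<dots> = (doubling * L \<delta>) powr (- \<beta>) * L \<delta>"
        using doubling_ge L\<delta> by (simp add: powr_mult powr_minus powr_diff field_simps)
      also have "\<dots> \<le> P * L \<delta>" using P_ge L\<delta> by (intro mult_right_mono) auto
      finally show ?thesis .
    qed
    then have "c5 / 2 * M * (L r powr (1 - \<beta>) / doubling) \<le> c5 / 2 * M * (P * L \<delta>)"
      using c5 M by (intro mult_left_mono) auto
    also note main
    also have "c5 / 2 * M * (L r powr (1 - \<beta>) / doubling) = c5 / (2 * doubling) * (M * L r powr (1 - \<beta>))" by simp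
    also have "M * L r powr (1 - \<beta>) = C7 * (U * L r + F)"
    proof -
      have "L r powr \<beta> * L r powr (1 - \<beta>) = L r" "L r powr (\<beta> - 1) * L r powr (1 - \<beta>) = 1"
        using Lr by (simp_all add: powr_add[symmetric])
      moreover have "M * L r powr (1 - \<beta>) = C7 * (U * (L r powr \<beta> * L r powr (1 - \<beta>)) + F * (L r powr (\<beta> - 1) * L r powr (1 - \<beta>)))"
        by (simp add: M_def algebra_simps)
      ultimately show ?thesis by simp
    qed
    finally have "c5 / (2 * doubling) * C7 * (U * L r + F) \<le> 2 * F + C6 * U * L r"
      by (simp only: mult.assoc)
    \<comment> \<open>The 3 exceeds the coefficient 2 of \<open>F\<close>, and \<open>C6\<close>
      matches that of \<open>U * L r\<close>; a strictly positive quantity is left on the wrong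
      side.\<close>
    moreover have "3 + C6 \<le> c5 / (2 * doubling) * C7"
      using C7(3) c5 doubling_ge by (simp add: field_simps)
    then have "(3 + C6) * (U * L r + F) \<le> c5 / (2 * doubling) * C7 * (U * L r + F)"
      using U0 Lr F by (intro mult_right_mono) auto
    ultimately have "3 * (U * L r) + F + C6 * F \<le> 0" by (simp add: algebra_simps)
    moreover have "0 \<le> U * L r" "0 \<le> C6 * F" using U0 Lr C6 F by auto
    ultimately show False using F by linarith
  qed (use \<beta> in auto)
qed

end

section \<open>From the estimate with an arbitrary bound on the right-hand side to the
  supremum\<close>

theorem theorem3:
  fixes R0 :: ereal
    and \<kappa> K0 c\<^sub>L c\<^sub>U \<gamma> :: real
    and l :: "real \<Rightarrow> real"
    and K :: "'a::euclidean_space \<Rightarrow> 'a \<Rightarrow> real"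
  assumes "0 < R0" and "\<kappa> \<ge> 1" and "K0 \<ge> 1"
    and "0 < c\<^sub>L" "c\<^sub>L < 1" and "c\<^sub>U \<ge> 1" and "0 < \<gamma>" "\<gamma> < 2"
    and l_measurable: "l \<in> borel_measurable (restrict_space borel (einterval 0 R0))"
    and l_pos: "\<And>s. 0 < s \<Longrightarrow> ereal s < R0 \<Longrightarrow> l s > 0"
    and l_infinite: "(\<integral>\<^sup>+s\<in>einterval 0 R0. ennreal (l s / s) \<partial>lborel) = \<infinity>"
    and l_finite: "\<And>r. 0 < r \<Longrightarrow> ereal r < R0 \<Longrightarrow>
          (\<integral>\<^sup>+s\<in>einterval (ereal r) R0. ennreal (l s / s) \<partial>lborel) < \<infinity>"
    and l_lower: "\<And>r t. 0 < r \<Longrightarrow> 1 \<le> t \<Longrightarrow> ereal t < R0 / ereal r \<Longrightarrow>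
          l (r * t) / l r \<ge> c\<^sub>L * t powr (- \<gamma>)"
    and l_upper: "\<And>r t. 0 < r \<Longrightarrow> 1 \<le> t \<Longrightarrow> ereal t < R0 / ereal r \<Longrightarrow>
          l (r * t) / l r \<le> c\<^sub>U * t ^ DIM('a)"
    and K_measurable:
          "(\<lambda>(x, h). K x h) \<in> borel_measurable (restrict_space borel (UNIV \<times> (- {0})))"
    and K_nonneg: "\<And>x h. h \<noteq> 0 \<Longrightarrow> K x h \<ge> 0"
    and K_sym: "\<And>x h. h \<noteq> 0 \<Longrightarrow> K x h = K x (- h)"
    and K_lower: "\<And>x h. 0 < norm h \<Longrightarrow> ereal (norm h) < R0 \<Longrightarrow>
          inverse \<kappa> * norm h powr (- real DIM('a)) * l (norm h) \<le> K x h"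
    and K_upper: "\<And>x h. 0 < norm h \<Longrightarrow> ereal (norm h) < R0 \<Longrightarrow>
          K x h \<le> \<kappa> * norm h powr (- real DIM('a)) * l (norm h)"
    and K_integral:
          "(SUP x. \<integral>\<^sup>+h\<in>- {0}. ennreal (min 1 ((norm h)\<^sup>2) * K x h) \<partial>lborel) \<le> ennreal K0"
  shows "\<exists>c>0. \<exists>\<beta>\<in>{0<..<1}. \<forall>r f u.
      0 < r \<and> ereal r \<le> R0 / 2 \<and> f \<in> Linfty (ball 0 r) \<and> u \<in> Cb2 \<and>
      (AE x in lebesgue_on (ball 0 r). nonlocal_op K u x = f x) \<longrightarrow>
      (SUP (x, y)\<in>{(x, y). x \<in> ball 0 (r / 4) \<and> y \<in> ball 0 (r / 4) \<and> x \<noteq> y}.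
          ereal (\<bar>u x - u y\<bar> / tail_integral R0 l (norm (x - y)) powr (- \<beta>)))
      \<le> ereal (c * tail_integral R0 l r powr \<beta> * sup_norm u
               + c * tail_integral R0 l r powr (\<beta> - 1) * Linfty_norm (ball 0 r) f)"
proof -
  interpret nonlocal_kernel R0 l c\<^sub>L c\<^sub>U \<gamma> \<kappa> K0 K
    by unfold_locales (fact assms)+
  obtain C \<beta> where C: "0 < C" and \<beta>: "\<beta> \<in> {0<..<1}"
    and est0: "\<forall>r F U u x1 y1. 0 < r \<longrightarrow> ereal r \<le> R0 / 2 \<longrightarrow> 0 < F \<longrightarrow> u \<in> Cb2 \<longrightarrow> (\<forall>x. \<bar>u x\<bar> \<le> U) \<longrightarrow>
     (\<forall>x\<in>ball 0 r. \<exists>k. admissible k \<and>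
        integrable lborel (\<lambda>h. (u (x + h) - u x - gradient u x \<bullet> h * indicator (ball 0 1) h) * k h) \<and>
        \<bar>LINT h|lborel. (u (x + h) - u x - gradient u x \<bullet> h * indicator (ball 0 1) h) * k h\<bar> \<le> F) \<longrightarrow>
     x1 \<in> ball 0 (r / 4) \<longrightarrow> y1 \<in> ball 0 (r / 4) \<longrightarrow> x1 \<noteq> y1 \<longrightarrow>
     u x1 - u y1 \<le> C * (L r powr \<beta> * U + L r powr (\<beta> - 1) * F) * L (norm (x1 - y1)) powr (- \<beta>)"
    using regularity_estimate by (elim exE conjE bexE) (rule that)
  note est = est0[rule_format]
  show ?thesis
  proof (rule exI[of _ C], intro conjI C, rule bexI[OF _ \<beta>], intro allI impI, elim conjE)
    fix r :: real and f u :: "'a \<Rightarrow> real"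
    assume r: "0 < r" "ereal r \<le> R0 / 2" and f: "f \<in> Linfty (ball 0 r)" and u: "u \<in> Cb2"
      and eq: "AE x in lebesgue_on (ball 0 r). nonlocal_op K u x = f x"
    have R: "ereal r < R0" using ereal_mult_less_of_le_half[of r R0 1] r by simp
    define F0 where "F0 = Linfty_norm (ball 0 r) f"
    define e where "e = esssup (lebesgue_on (ball 0 r)) (\<lambda>x. ereal \<bar>f x\<bar>)"
    have e_AE: "AE x in lebesgue_on (ball 0 r). ereal \<bar>f x\<bar> \<le> e"
      unfolding e_def by (rule esssup_AE)
    \<comment> \<open>The ball has positive measure, so the essential supremum dominates an actual
      value and is not minus infinity.\<close>
    have "\<exists>x\<in>ball 0 r. ereal \<bar>f x\<bar> \<le> e"
      using r by (intro AE_lebesgue_on_ex_in_open[OF e_AE]) auto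
    then have "0 \<le> e" by (auto intro: order_trans[rotated])
    moreover have "e < \<infinity>" using f by (simp add: Linfty_def e_def)
    ultimately have e: "e = ereal F0" "0 \<le> F0"
      by (cases e; simp add: F0_def Linfty_norm_def e_def)+
    have F0: "AE x in lebesgue_on (ball 0 r). \<bar>f x\<bar> \<le> F0" using e_AE unfolding e by simp
    obtain b where "\<And>x. \<bar>u x\<bar> \<le> b"
      using u by (auto simp: Cb2_def bcontfun_def bounded_iff)
    then have "bdd_above (range (\<lambda>x. \<bar>u x\<bar>))" by (rule bdd_aboveI2)
    then have U: "\<bar>u x\<bar> \<le> sup_norm u" for x
      unfolding sup_norm_def by (rule cSUP_upper[OF UNIV_I])
    define W where "W F = C * (L r powr \<beta> * sup_norm u + L r powr (\<beta> - 1) * F)" for F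
    have pair: "u x - u y \<le> W F0 * L (norm (x - y)) powr (- \<beta>)"
      if xy: "x \<in> ball 0 (r / 4)" "y \<in> ball 0 (r / 4)" "x \<noteq> y" for x y
    \<comment> \<open>\<open>equation_at_every_point\<close> needs a margin above \<open>F0\<close>.
      As \<open>C\<close> and \<open>\<beta>\<close> do not depend on \<open>F\<close>, letting
      \<open>F\<close> decrease to \<open>F0\<close> removes it, including the case
      \<open>F0 = 0\<close>.\<close>
    proof (rule tendsto_le[OF trivial_limit_at_right_real])
      show "((\<lambda>F. W F * L (norm (x - y)) powr (- \<beta>)) \<longlongrightarrow> W F0 * L (norm (x - y)) powr (- \<beta>)) (at_right F0)"
        unfolding W_def by (intro tendsto_intros)
      show "((\<lambda>F. u x - u y) \<longlongrightarrow> u x - u y) (at_right F0)" by simp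
      show "\<forall>\<^sub>F F in at_right F0. u x - u y \<le> W F * L (norm (x - y)) powr (- \<beta>)"
        using eventually_at_right_less[of F0]
      proof eventually_elim
        fix F assume F: "F0 < F"
        show "u x - u y \<le> W F * L (norm (x - y)) powr (- \<beta>)"
          unfolding W_def using e(2) F
          by (intro est r u U xy equation_at_every_point[OF u eq F0 F]) auto
      qed
    qed
    show "(SUP (x, y)\<in>{(x, y). x \<in> ball 0 (r / 4) \<and> y \<in> ball 0 (r / 4) \<and> x \<noteq> y}.
          ereal (\<bar>u x - u y\<bar> / L (norm (x - y)) powr (- \<beta>)))
      \<le> ereal (C * L r powr \<beta> * sup_norm u + C * L r powr (\<beta> - 1) * Linfty_norm (ball 0 r) f)"
    proof (rule SUP_least, clarify)
      fix x y :: 'a assume xy: "x \<in> ball 0 (r / 4)" "y \<in> ball 0 (r / 4)" "x \<noteq> y"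
      have "norm (x - y) \<le> r" using xy norm_triangle_ineq4[of x y] r by simp
      then have "0 < L (norm (x - y))"
        using xy ereal_less_of_le[OF _ R] by (intro L_pos) auto
      then have pos: "0 < L (norm (x - y)) powr (- \<beta>)" by simp
      have "\<bar>u x - u y\<bar> \<le> W F0 * L (norm (x - y)) powr (- \<beta>)"
        using pair[OF xy] pair[OF xy(2,1)] xy(3) by (auto simp: norm_minus_commute abs_le_iff)
      then have "\<bar>u x - u y\<bar> / L (norm (x - y)) powr (- \<beta>) \<le> W F0"
        using pos by (simp add: pos_divide_le_eq)
      then show "ereal (\<bar>u x - u y\<bar> / L (norm (x - y)) powr (- \<beta>))
          \<le> ereal (C * L r powr \<beta> * sup_norm u + C * L r powr (\<beta> - 1) * Linfty_norm (ball 0 r) f)"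
        by (simp add: W_def F0_def algebra_simps)
    qed
  qed
qed

end
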